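(* Let $a,b>0$ and $$A_0=\begin{pmatrix}-1 & ab \\ -a/b & -1\end{pmatrix},\qquad A_1=\begin{pmatrix}-1 & -a/b \\ a b & -1\end{pmatrix}.$$ Let $\chi(\beta)$, $\beta>0$, be the growth exponent of the associated randomly switched system with $\lambda=1/2$, defined in the context. If $a(b-1/b)>2$, i.e. $b>\frac{1+\sqrt{1+a^2}}{a}$, then there exists $\beta_c\in(0,+\infty)$ such that $\chi$ is negative on $(0,\beta_c)$ and positive on $(\beta_c,+\infty)$.
   Context: Let $e_\theta=(\cos\theta,\sin\theta)$, $\mathbb{T}=\mathbb{R}/2\pi\mathbb{Z}$, and, for $i\in\{0,1\}$, $d_i(\theta)=\langle A_ie_\theta,e_{\theta+\pi/2}\rangle$ and $\mathcal{A}(\theta,i)=\langle A_ie_\theta,e_\theta\rangle$. The angular process is the Markov process $(\Theta,I)$ on $\mathbb{T}\times\{0,1\}$ with generator $L_\beta f(\theta,i)=d_i(\theta)\partial_\theta f(\theta,i)+\frac{\beta}{2}(f(\theta,1-i)-f(\theta,i))$: $I$ jumps from $i$ to $1-i$ at rate $\beta/2$, and $\dot\Theta_t=d_{I_t}(\Theta_t)$. It is the angular part of the process $(X,I)$ with $\dot X_t=A_{I_t}X_t$, $X_0\neq0$. Let $\mu_\beta$ be its invariant probability measure. Then $\chi(\beta)=\int\mathcal{A}(\theta,i)\,d\mu_\beta(\theta,i)$, which is the almost sure limit of $\frac1t\log\|X_t\|$ as $t\to\infty$. *)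

theory Defs
  imports "HOL-Probability.Probability"
begin

definition e_vec :: "real \<Rightarrow> real^2" where
  "e_vec \<theta> = vector [cos \<theta>, sin \<theta>]"

definition ang_speed :: "(nat \<Rightarrow> real^2^2) \<Rightarrow> nat \<Rightarrow> real \<Rightarrow> real" where
  "ang_speed A i \<theta> = (A i *v e_vec \<theta>) \<bullet> e_vec (\<theta> + pi / 2)"

definition rad_growth :: "(nat \<Rightarrow> real^2^2) \<Rightarrow> real \<Rightarrow> nat \<Rightarrow> real" where
  "rad_growth A \<theta> i = (A i *v e_vec \<theta>) \<bullet> e_vec \<theta>"

text \<open>
  The circle \<open>\<real>/2\<pi>\<int>\<close> is represented by the complex unit circle, an angle \<open>\<theta>\<close> corresponding
  to the point \<open>cis \<theta>\<close>. A point \<open>z\<close> is read back as the angle \<open>Arg z\<close>; which representative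
  is taken is irrelevant, because this is only done inside \<open>2\<pi>\<close>-periodic functions.
  The switching index lives in \<open>{0, 1} :: nat set\<close>, so that \<open>1 - i\<close> is the other index.
\<close>

definition states :: "(complex \<times> nat) set" where
  "states = sphere 0 1 \<times> {0, 1}"

definition state_space :: "(complex \<times> nat) measure" where
  "state_space = restrict_space borel states"

definition C1_fun :: "(complex \<times> nat \<Rightarrow> real) \<Rightarrow> bool" where
  "C1_fun f \<longleftrightarrow> (\<forall>i\<in>{0, 1}.
      (\<forall>\<theta>. (\<lambda>s. f (cis s, i)) differentiable (at \<theta>)) \<and>
      continuous_on UNIV (deriv (\<lambda>s. f (cis s, i))))"

definition ang_generator ::
    "(nat \<Rightarrow> real^2^2) \<Rightarrow> real \<Rightarrow> (complex \<times> nat \<Rightarrow> real) \<Rightarrow> complex \<times> nat \<Rightarrow> real" where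
  "ang_generator A \<beta> f = (\<lambda>(z, i).
      ang_speed A i (Arg z) * deriv (\<lambda>s. f (cis s, i)) (Arg z)
      + \<beta> / 2 * (f (z, 1 - i) - f (z, i)))"

definition feller_semigroup ::
    "(real \<Rightarrow> complex \<times> nat \<Rightarrow> (complex \<times> nat) measure) \<Rightarrow> bool" where
  "feller_semigroup P \<longleftrightarrow>
      (\<forall>t\<ge>0. P t \<in> state_space \<rightarrow>\<^sub>M prob_algebra state_space) \<and>
      (\<forall>x\<in>states. P 0 x = return state_space x) \<and>
      (\<forall>s\<ge>0. \<forall>t\<ge>0. \<forall>x\<in>states. P (s + t) x = P s x \<bind> P t) \<and>
      (\<forall>f :: complex \<times> nat \<Rightarrow> real. continuous_on states f \<longrightarrow>
         (\<forall>t\<ge>0. continuous_on states (\<lambda>x. \<integral>y. f y \<partial>P t x)) \<and>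
         uniform_limit states (\<lambda>t x. \<integral>y. f y \<partial>P t x) f (at_right 0))"

text \<open>
  Transition semigroups \<open>P\<close> of the angular process: the generator of \<open>P\<close> is given on functions
  that are continuously differentiable in the angle by the operator \<open>ang_generator A \<beta>\<close>.
  These functions form a core, so this determines \<open>P t\<close> for \<open>t \<ge> 0\<close>.
\<close>

definition angular_semigroup ::
    "(nat \<Rightarrow> real^2^2) \<Rightarrow> real \<Rightarrow> (real \<Rightarrow> complex \<times> nat \<Rightarrow> (complex \<times> nat) measure) \<Rightarrow> bool" where
  "angular_semigroup A \<beta> P \<longleftrightarrow> feller_semigroup P \<and>
      (\<forall>f. C1_fun f \<longrightarrow>
         uniform_limit states (\<lambda>t x. ((\<integral>y. f y \<partial>P t x) - f x) / t)
           (ang_generator A \<beta> f) (at_right 0))"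

definition angular_invariant ::
    "(nat \<Rightarrow> real^2^2) \<Rightarrow> real \<Rightarrow> (complex \<times> nat) measure \<Rightarrow> bool" where
  "angular_invariant A \<beta> \<mu> \<longleftrightarrow> \<mu> \<in> space (prob_algebra state_space) \<and>
      (\<exists>P. angular_semigroup A \<beta> P \<and> (\<forall>t\<ge>0. \<mu> \<bind> P t = \<mu>))"

definition invariant_measure :: "(nat \<Rightarrow> real^2^2) \<Rightarrow> real \<Rightarrow> (complex \<times> nat) measure" where
  "invariant_measure A \<beta> = (THE \<mu>. angular_invariant A \<beta> \<mu>)"

definition growth_exponent :: "(nat \<Rightarrow> real^2^2) \<Rightarrow> real \<Rightarrow> real" where
  "growth_exponent A \<beta> = (\<integral>(z, i). rad_growth A (Arg z) i \<partial>invariant_measure A \<beta>)"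

end

theory Submission imports Defs
begin

text \<open>
  For this pair of matrices the stationary Fokker--Planck equations can be integrated explicitly.
  With \<open>m = (b - 1/b) / 2\<close>, the invariant measure has density
  \<open>exp (V \<theta>) / \<bar>d\<^sub>i(\<theta>)\<bar>\<close> up to a constant, where \<open>V \<theta> = \<beta>/(2a) * arctan (m * sin (2\<theta>))\<close>. Hence
  \<open>\<chi>(\<beta>)\<close> is, up to a positive factor, the integral of
  \<open>(a * m * sin (2\<theta>) - 1) * exp (V \<theta>) / (1 + (m * sin (2\<theta>))\<^sup>2)\<close>. Multiplying the exponential
  by \<open>exp (- \<beta>/(2a) * arctan (1/a))\<close> turns this integral into a strictly increasing function of
  \<open>\<beta>\<close>, which is negative at \<open>0\<close> and tends to infinity when \<open>a * m > 1\<close>.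

  The semigroup itself is constructed as a Dyson series over the number of jumps. Solving the
  Poisson equation \<open>L f = g - \<integral>g d\<mu>\<close> explicitly shows both that \<open>\<mu>\<close> is invariant for every
  semigroup with generator \<open>L\<close> and that no other probability measure is.
\<close>

section \<open>Dyson series of a flow with jumps\<close>

text \<open>\<open>invariant_measure\<close> is a definite description over the measures invariant
  under some semigroup with the prescribed generator on C1 functions. So one semigroup has to be
  exhibited, and uniqueness has to hold across all such semigroups. A proof that C1 functions form a
  core is avoided: once the Poisson equation is solvable for every continuous right-hand side, time
  averages are known, and they determine the measure.

  The density is explicit because the two fields never vanish and rotate in opposite senses. Adding
  the two stationary equations shows that the flux d_0 rho_0 + d_1 rho_1 is constant. With the
  constant 0, |d_i| rho_i = exp V for both i, where V' = \<beta>/2 (1/|d_0| - 1/|d_1|). This V is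
  periodic since |d_1| - |d_0| is a times the derivative of m sin(2\<theta>), while |d_0| |d_1| =
  a^2 (1 + (m sin(2\<theta>))^2).

  The number arctan(1/a) is the value of arctan(m sin(2\<theta>)) where a m sin(2\<theta>) - 1
  vanishes. Hence the tilted exponent and the radial rate have the same sign at each angle, and the
  tilted integrand is nondecreasing in \<beta> pointwise.\<close>

lemma ennreal_suminf_swap:
  fixes f :: "nat \<Rightarrow> nat \<Rightarrow> ennreal"
  shows "(\<Sum>i. \<Sum>j. f i j) = (\<Sum>j. \<Sum>i. f i j)"
  using nn_integral_suminf[of "\<lambda>j i. f i j" "count_space UNIV"]
  by (simp add: nn_integral_count_space_nat)

lemma continuous_on_compact_boundE:
  fixes f :: "'a::topological_space \<Rightarrow> real"
  assumes "compact S" "continuous_on S f"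
  obtains B where "B > 0" "\<And>y. y \<in> S \<Longrightarrow> \<bar>f y\<bar> \<le> B"
proof -
  have "bounded (f ` S)"
    using assms by (intro compact_imp_bounded compact_continuous_image)
  then obtain B where "B > 0" "\<forall>y\<in>f ` S. norm y \<le> B"
    by (auto simp: bounded_pos)
  with that show ?thesis by auto
qed

lemma exp_second_order:
  fixes u :: real
  assumes "u \<ge> 0"
  shows "\<bar>exp (- u) - 1 + u\<bar> \<le> u\<^sup>2"
proof -
  have "exp (- u) \<ge> 1 - u" using exp_ge_add_one_self[of "- u"] by simp
  moreover have "exp (- u) \<le> 1 / (1 + u)"
    using exp_ge_add_one_self[of u] assms by (simp add: exp_minus field_simps)
  moreover have "1 / (1 + u) \<le> 1 - u + u\<^sup>2"
    using assms by (simp add: field_simps power2_eq_square)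
  ultimately show ?thesis by (simp add: abs_le_iff)
qed

text \<open>A deterministic motion interrupted at the times of a Poisson process of rate
  \<open>l\<close> by the map \<open>J\<close>. In the application the flow rotates with frozen
  index and \<open>J\<close> flips the index.\<close>

locale switched_flow =
  fixes S :: "'a::{second_countable_topology, t2_space} set"
    and flow :: "real \<Rightarrow> 'a \<Rightarrow> 'a" and J :: "'a \<Rightarrow> 'a" and l :: real
  assumes compact_S: "compact S" and S_nonempty: "S \<noteq> {}"
    and flow_cont: "continuous_on (UNIV \<times> S) (\<lambda>(t, x). flow t x)"
    and flow_in: "x \<in> S \<Longrightarrow> flow t x \<in> S"
    and flow_0: "x \<in> S \<Longrightarrow> flow 0 x = x"
    and flow_add: "x \<in> S \<Longrightarrow> flow (s + t) x = flow t (flow s x)"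
    and J_in: "x \<in> S \<Longrightarrow> J x \<in> S"
    and J_cont: "continuous_on S J"
    and l_pos: "l > 0"
begin

abbreviation M where "M \<equiv> restrict_space borel S"

lemma space_M [simp]: "space M = S"
  by (simp add: space_restrict_space)

lemma measurable_J [measurable]: "J \<in> M \<rightarrow>\<^sub>M M"
  by (intro measurable_restrict_space2 borel_measurable_continuous_on_restrict J_cont) (auto intro: J_in)

lemma measurable_flow [measurable]: "(\<lambda>(t, x). flow t x) \<in> borel \<Otimes>\<^sub>M M \<rightarrow>\<^sub>M M"
proof -
  have [measurable]: "(\<lambda>x. x) \<in> M \<rightarrow>\<^sub>M borel"
    by (rule measurable_restrict_space1) simp
  have "(\<lambda>p :: real \<times> 'a. (fst p, snd p)) \<in> borel \<Otimes>\<^sub>M M \<rightarrow>\<^sub>M borel \<Otimes>\<^sub>M borel"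
    by (intro measurable_Pair measurable_fst measurable_compose[OF measurable_snd \<open>(\<lambda>x. x) \<in> M \<rightarrow>\<^sub>M borel\<close>])
  \<comment> \<open>Second countability enters here: the product of the Borel sigma-algebras is the
    Borel sigma-algebra of the product, so joint continuity of the flow gives joint
    measurability.\<close>
  then have "(\<lambda>p. p) \<in> borel \<Otimes>\<^sub>M M \<rightarrow>\<^sub>M restrict_space borel ((UNIV :: real set) \<times> S)"
    by (intro measurable_restrict_space2) (auto simp: space_pair_measure borel_prod)
  from measurable_compose[OF this borel_measurable_continuous_on_restrict[OF flow_cont]]
  show ?thesis
    by (intro measurable_restrict_space2) (auto simp: space_pair_measure intro: flow_in)
qed

text \<open>For t \<ge> 0, \<open>T n t f x\<close> is the expectation of \<open>f\<close> at time
  \<open>t\<close> on the event of exactly \<open>n\<close> jumps, started at \<open>x\<close>; the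
  recursion conditions on the time \<open>s\<close> of the first jump. Values in
  \<open>ennreal\<close> spare all integrability questions. The half-open interval splits exactly at
  intermediate times and makes every term with a jump vanish at \<open>t = 0\<close>.\<close>

fun T :: "nat \<Rightarrow> real \<Rightarrow> ('a \<Rightarrow> ennreal) \<Rightarrow> 'a \<Rightarrow> ennreal" where
  "T 0 t f x = ennreal (exp (- l * t)) * f (flow t x)"
| "T (Suc n) t f x = (\<integral>\<^sup>+ s. indicator {0..<t} s * ennreal (l * exp (- l * s))
      * T n (t - s) f (J (flow s x)) \<partial>lborel)"

lemma measurable_T_pair [measurable]:
  assumes [measurable]: "f \<in> borel_measurable M"
  shows "(\<lambda>(t, x). T n t f x) \<in> borel_measurable (borel \<Otimes>\<^sub>M M)"
proof (induction n)
  case 0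
  show ?case by simp
next
  case (Suc n)
  note Suc[measurable]
  have [measurable]: "(\<lambda>p :: (real \<times> 'a) \<times> real. T n (fst (fst p) - snd p) f (J (flow (snd p) (snd (fst p)))))
      \<in> borel_measurable ((borel \<Otimes>\<^sub>M M) \<Otimes>\<^sub>M lborel)"
  proof -
    have "(\<lambda>p :: (real \<times> 'a) \<times> real. (fst (fst p) - snd p, J (flow (snd p) (snd (fst p)))))
        \<in> (borel \<Otimes>\<^sub>M M) \<Otimes>\<^sub>M lborel \<rightarrow>\<^sub>M borel \<Otimes>\<^sub>M M"
      by measurable
    from measurable_compose[OF this Suc] show ?thesis by (simp add: split_def)
  qed
  have "(\<lambda>p :: real \<times> 'a. \<integral>\<^sup>+ s. indicator {s. 0 \<le> s \<and> s < fst p} s * ennreal (l * exp (- l * s))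
      * T n (fst p - s) f (J (flow s (snd p))) \<partial>lborel) \<in> borel_measurable (borel \<Otimes>\<^sub>M M)"
    by measurable
  then show ?case by (simp add: split_def atLeastLessThan_def atLeast_def lessThan_def Collect_conj_eq)
qed

lemma measurable_T [measurable]:
  assumes [measurable]: "f \<in> borel_measurable M"
  shows "T n t f \<in> borel_measurable M"
proof -
  have "(\<lambda>x. (t, x)) \<in> M \<rightarrow>\<^sub>M borel \<Otimes>\<^sub>M M" by measurable
  from measurable_compose[OF this measurable_T_pair[OF assms]] show ?thesis by simp
qed

lemma measurable_T_integrand [measurable]:
  assumes "f \<in> borel_measurable M" and x: "x \<in> S"
  shows "(\<lambda>s. T n (t - s) f (J (flow s x))) \<in> borel_measurable borel"
proof -
  have [measurable]: "x \<in> space M" using x by simp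
  have "(\<lambda>s. (t - s, J (flow s x))) \<in> borel \<rightarrow>\<^sub>M borel \<Otimes>\<^sub>M M"
    by measurable
  from measurable_compose[OF this measurable_T_pair[OF assms(1)]] show ?thesis by simp
qed

lemma T_cong:
  assumes "x \<in> S" "\<And>y. y \<in> S \<Longrightarrow> f y = g y"
  shows "T n t f x = T n t g x"
  using assms(1)
proof (induction n arbitrary: t x)
  case 0
  then show ?case by (simp add: assms(2) flow_in)
next
  case (Suc n)
  then show ?case by (auto intro!: nn_integral_cong arg_cong2[where f="(*)"] simp: J_in flow_in)
qed

lemma T_mono:
  assumes "x \<in> S" "\<And>y. y \<in> S \<Longrightarrow> f y \<le> g y"
  shows "T n t f x \<le> T n t g x"
  using assms(1)
proof (induction n arbitrary: t x)
  case 0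
  then show ?case by (simp add: assms(2) flow_in mult_left_mono)
next
  case (Suc n)
  then show ?case by (auto intro!: nn_integral_mono mult_left_mono simp: J_in flow_in)
qed

lemma T_cmult:
  assumes f: "f \<in> borel_measurable M" and "x \<in> S"
  shows "T n t (\<lambda>y. c * f y) x = c * T n t f x"
  using assms(2)
proof (induction n arbitrary: t x)
  case 0
  then show ?case by (simp add: mult_ac)
next
  case (Suc n)
  note [measurable] = measurable_T_integrand[OF f Suc.prems]
  show ?case
    by (simp add: Suc J_in flow_in nn_integral_cmult[symmetric] mult_ac)
qed

lemma T_add:
  assumes f: "f \<in> borel_measurable M" and g: "g \<in> borel_measurable M" and "x \<in> S"
  shows "T n t (\<lambda>y. f y + g y) x = T n t f x + T n t g x"
  using assms(3)
proof (induction n arbitrary: t x)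
  case 0
  then show ?case by (simp add: distrib_left)
next
  case (Suc n)
  note [measurable] = measurable_T_integrand[OF f Suc.prems] measurable_T_integrand[OF g Suc.prems]
  show ?case
    by (simp add: Suc J_in flow_in nn_integral_add[symmetric] distrib_left)
qed

lemma T_SUP:
  assumes f: "\<And>i. f i \<in> borel_measurable M" and inc: "incseq f" and "x \<in> S"
  shows "T n t (\<lambda>y. SUP i. f i y) x = (SUP i. T n t (f i) x)"
  using assms(3)
proof (induction n arbitrary: t x)
  case 0
  then show ?case by (simp add: SUP_mult_left_ennreal)
next
  case (Suc n)
  note [measurable] = measurable_T_integrand[OF f Suc.prems]
  have inc': "f i y \<le> f j y" if "i \<le> j" for i j y using inc that by (auto simp: incseq_def le_fun_def)
  have "T (Suc n) t (\<lambda>y. SUP i. f i y) x = (\<integral>\<^sup>+ s. (SUP i. indicator {0..<t} s * ennreal (l * exp (- l * s))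
      * T n (t - s) (f i) (J (flow s x))) \<partial>lborel)"
    by (simp add: Suc J_in flow_in SUP_mult_left_ennreal)
  also have "\<dots> = (SUP i. T (Suc n) t (f i) x)"
    unfolding T.simps
    by (rule nn_integral_monotone_convergence_SUP)
      (auto simp: incseq_def le_fun_def intro!: mult_left_mono T_mono J_in flow_in Suc.prems inc')
  finally show ?case .
qed

text \<open>The Poisson weights of mean \<open>l * t\<close>. They do not depend on
  \<open>x\<close>, since the jump rate is constant; later this provides bounds uniform in the
  starting point.\<close>

lemma T_const:
  assumes "t \<ge> 0" "x \<in> S"
  shows "T n t (\<lambda>_. 1) x = ennreal (exp (- l * t) * (l * t) ^ n / fact n)"
  using assms
proof (induction n arbitrary: t x)
  case 0
  then show ?case by simp
next
  case (Suc n)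
  let ?F = "\<lambda>s. - (exp (- l * t) * (l * (t - s)) ^ Suc n / fact (Suc n))"
  have D: "(?F has_real_derivative l * exp (- l * t) * (l * (t - s)) ^ n / fact n) (at s)" for s
  proof -
    have 1: "((\<lambda>s. (l * (t - s)) ^ Suc n) has_real_derivative real (Suc n) * (- l * (l * (t - s)) ^ n)) (at s)"
        by (rule DERIV_cong, (rule derivative_eq_intros refl)+) (simp del: of_nat_Suc)
    have 2: "- (exp (- l * t) * p / fact (Suc n)) = - (exp (- l * t) / fact (Suc n)) * p" for p by simp
    have 3: "fact (Suc n) = real (Suc n) * fact n" by simp
    have 4: "real (Suc n) \<noteq> 0" by simp
    have 5: "- (e / (N * f)) * (N * (- l * p)) = l * e * p / f" if "N \<noteq> 0" for e N f p :: real
      using that by simp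
    show ?thesis unfolding 2
      by (rule DERIV_cong[OF DERIV_cmult[OF 1]]) (simp only: 3 5[OF 4])
  qed
  have "T (Suc n) t (\<lambda>_. 1) x
      = (\<integral>\<^sup>+ s. ennreal (l * exp (- l * t) * (l * (t - s)) ^ n / fact n) * indicator {0..t} s \<partial>lborel)"
    unfolding T.simps
  proof (intro nn_integral_cong_AE)
    have "AE s in lborel. s \<noteq> t" by (rule AE_lborel_singleton)
    then show "AE s in lborel. indicator {0..<t} s * ennreal (l * exp (- l * s)) * T n (t - s) (\<lambda>_. 1) (J (flow s x)) =
      ennreal (l * exp (- l * t) * (l * (t - s)) ^ n / fact n) * indicator {0..t} s"
    proof eventually_elim
      case (elim s)
      show ?case
      proof (cases "0 \<le> s \<and> s < t")
        case True
        have "ennreal (l * exp (- l * s)) * ennreal (exp (- l * (t - s)) * (l * (t - s)) ^ n / fact n)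
            = ennreal (l * exp (- l * t) * (l * (t - s)) ^ n / fact n)"
          using True l_pos by (simp add: ennreal_mult[symmetric] exp_add[symmetric] algebra_simps exp_diff exp_minus divide_simps)
        then show ?thesis using True Suc by (simp add: J_in flow_in indicator_def)
      next
        case False
        then show ?thesis using elim by (auto simp: indicator_def)
      qed
    qed
  qed
  also have "\<dots> = ennreal (?F t - ?F 0)"
  proof (rule nn_integral_FTC_Icc[where F = ?F])
    show "(?F has_real_derivative l * exp (- l * t) * (l * (t - s)) ^ n / fact n) (at s)" for s
      by (rule D)
  qed (use Suc.prems l_pos in auto)
  finally show ?case by simp
qed

text \<open>Split according to the number \<open>k\<close> of jumps before time \<open>s\<close>.\<close>

lemma T_add_time:
  assumes f: "f \<in> borel_measurable M" and "s \<ge> 0" "t \<ge> 0" "x \<in> S"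
  shows "T n (s + t) f x = (\<Sum>k\<le>n. T k s (T (n - k) t f) x)"
  using assms(2-)
proof (induction n arbitrary: s x)
  case 0
  have "exp (- (l * (s + t))) = exp (- (l * s)) * exp (- (l * t))"
    by (simp add: exp_add[symmetric] algebra_simps)
  then show ?case using 0 by (simp add: flow_add ennreal_mult mult_ac)
next
  case (Suc n)
  note [measurable] = measurable_T_integrand[OF f \<open>x \<in> S\<close>]
  note [measurable] = measurable_T_integrand[OF measurable_T[OF f] \<open>x \<in> S\<close>]
  note [measurable] = measurable_T_integrand[OF f flow_in[OF \<open>x \<in> S\<close>]]
  let ?g = "\<lambda>r. ennreal (l * exp (- l * r)) * T n (s + t - r) f (J (flow r x))"
  \<comment> \<open>If the first jump comes before \<open>s\<close>, the induction hypothesis yields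
    the terms with at least one jump before \<open>s\<close>; if it comes later, shifting time by
    \<open>s\<close> yields the term \<open>k = 0\<close>.\<close>
  have "T (Suc n) (s + t) f x = (\<integral>\<^sup>+ r. indicator {0..<s} r * ?g r + indicator {s..<s + t} r * ?g r \<partial>lborel)"
    unfolding T.simps using Suc.prems by (intro nn_integral_cong) (auto simp: indicator_def)
  also have "\<dots> = (\<integral>\<^sup>+ r. indicator {0..<s} r * ?g r \<partial>lborel) + (\<integral>\<^sup>+ r. indicator {s..<s + t} r * ?g r \<partial>lborel)"
    by (rule nn_integral_add) auto
  also have "(\<integral>\<^sup>+ r. indicator {s..<s + t} r * ?g r \<partial>lborel)
      = (\<integral>\<^sup>+ r. indicator {s..<s + t} (s + r) * ?g (s + r) \<partial>lborel)"
    by (subst nn_integral_real_affine[where c=1 and t=s]) auto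
  also have "\<dots> = (\<integral>\<^sup>+ r. ennreal (exp (- l * s)) * (indicator {0..<t} r * ennreal (l * exp (- l * r)) * T n (t - r) f (J (flow r (flow s x)))) \<partial>lborel)"
  proof (intro nn_integral_cong)
    fix r
    have "exp (- (l * (s + r))) = exp (- (l * s)) * exp (- (l * r))"
      by (simp add: exp_add[symmetric] algebra_simps)
    then have "ennreal (l * exp (- l * (s + r))) = ennreal (exp (- l * s)) * ennreal (l * exp (- l * r))"
      using l_pos by (simp add: ennreal_mult mult_ac)
    moreover have "indicator {s..<s + t} (s + r) = (indicator {0..<t} r :: ennreal)"
      by (auto simp: indicator_def)
    ultimately show "indicator {s..<s + t} (s + r) * ?g (s + r) = ennreal (exp (- l * s)) *
         (indicator {0..<t} r * ennreal (l * exp (- l * r)) * T n (t - r) f (J (flow r (flow s x))))"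
      using Suc.prems by (simp add: flow_add mult_ac)
  qed
  also have "\<dots> = T 0 s (T (Suc n) t f) x"
    by (simp add: nn_integral_cmult)
  also have "(\<integral>\<^sup>+ r. indicator {0..<s} r * ?g r \<partial>lborel)
      = (\<integral>\<^sup>+ r. (\<Sum>k\<le>n. indicator {0..<s} r * ennreal (l * exp (- l * r)) * T k (s - r) (T (n - k) t f) (J (flow r x))) \<partial>lborel)"
  proof (intro nn_integral_cong)
    fix r
    show "indicator {0..<s} r * ?g r = (\<Sum>k\<le>n. indicator {0..<s} r * ennreal (l * exp (- l * r)) * T k (s - r) (T (n - k) t f) (J (flow r x)))"
    proof (cases "0 \<le> r \<and> r < s")
      case True
      then have "T n (s + t - r) f (J (flow r x)) = (\<Sum>k\<le>n. T k (s - r) (T (n - k) t f) (J (flow r x)))"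
        using Suc.IH[of "s - r" "J (flow r x)"] Suc.prems by (simp add: J_in flow_in algebra_simps)
      then show ?thesis by (simp add: sum_distrib_left mult_ac)
    qed (auto simp: indicator_def)
  qed
  also have "\<dots> = (\<Sum>k\<le>n. T (Suc k) s (T (n - k) t f) x)"
    by (simp add: nn_integral_sum)
  finally show ?case by (simp only: sum.atMost_Suc_shift add.commute diff_Suc_Suc diff_zero)
qed

lemma T_suminf:
  assumes f: "\<And>i. f i \<in> borel_measurable M" and "x \<in> S"
  shows "T n t (\<lambda>y. \<Sum>i. f i y) x = (\<Sum>i. T n t (f i) x)"
  using assms(2)
proof (induction n arbitrary: t x)
  case 0
  then show ?case by simp
next
  case (Suc n)
  note [measurable] = measurable_T_integrand[OF f Suc.prems]
  show ?case
    by (simp add: Suc J_in flow_in nn_integral_suminf[symmetric])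
qed

definition Tsum :: "real \<Rightarrow> ('a \<Rightarrow> ennreal) \<Rightarrow> 'a \<Rightarrow> ennreal" where
  "Tsum t f x = (\<Sum>n. T n t f x)"

lemma measurable_Tsum [measurable]: "f \<in> borel_measurable M \<Longrightarrow> Tsum t f \<in> borel_measurable M"
  unfolding Tsum_def by measurable

lemma Tsum_suminf:
  assumes "\<And>i. f i \<in> borel_measurable M" "x \<in> S"
  shows "Tsum t (\<lambda>y. \<Sum>i. f i y) x = (\<Sum>i. Tsum t (f i) x)"
  unfolding Tsum_def T_suminf[OF assms] by (rule ennreal_suminf_swap)

text \<open>A Cauchy product: extending the finite sums of \<open>T_add_time\<close> by zeros,
  exchanging the order of summation and setting \<open>j = n - k\<close> decouples the jumps before
  and after \<open>s\<close>.\<close>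

lemma Tsum_add_time:
  assumes "f \<in> borel_measurable M" "s \<ge> 0" "t \<ge> 0" "x \<in> S"
  shows "Tsum (s + t) f x = Tsum s (Tsum t f) x"
proof -
  let ?a = "\<lambda>k n. if k \<le> n then T k s (T (n - k) t f) x else 0"
  have "Tsum (s + t) f x = (\<Sum>n. \<Sum>k. ?a k n)"
    unfolding Tsum_def
  proof (rule arg_cong[where f=suminf], rule ext)
    fix n
    have "T n (s + t) f x = (\<Sum>k\<le>n. ?a k n)"
      using T_add_time[OF assms] by simp
    also have "\<dots> = (\<Sum>k. ?a k n)"
      by (rule suminf_finite[symmetric]) auto
    finally show "T n (s + t) f x = (\<Sum>k. ?a k n)" .
  qed
  also have "\<dots> = (\<Sum>k. \<Sum>n. ?a k n)"
    by (rule ennreal_suminf_swap)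
  also have "\<dots> = (\<Sum>k. \<Sum>j. T k s (T j t f) x)"
  proof (rule arg_cong[where f=suminf], rule ext)
    fix k
    show "(\<Sum>n. ?a k n) = (\<Sum>j. T k s (T j t f) x)"
      using suminf_offset[of "?a k" k, OF summableI] by simp
  qed
  also have "\<dots> = Tsum s (Tsum t f) x"
    unfolding Tsum_def by (subst T_suminf) (use assms in auto)
  finally show ?thesis .
qed

lemma Tsum_const:
  assumes "t \<ge> 0" "x \<in> S"
  shows "Tsum t (\<lambda>_. 1) x = 1"
proof -
  have "(\<lambda>n. exp (- l * t) * ((l * t) ^ n / fact n)) sums (exp (- l * t) * exp (l * t))"
    using exp_converges[of "l * t"] by (intro sums_mult) (simp add: field_simps)
  then have "(\<lambda>n. exp (- l * t) * (l * t) ^ n / fact n) sums 1"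
    by (simp add: exp_add[symmetric])
  then show ?thesis
    unfolding Tsum_def T_const[OF assms]
    using assms l_pos by (subst suminf_ennreal_eq) auto
qed

section \<open>Transition kernels and the semigroup law\<close>

definition P :: "real \<Rightarrow> 'a \<Rightarrow> 'a measure" where
  "P t x = measure_of S (sets M) (\<lambda>A. Tsum t (indicator A) x)"

lemma sets_P [simp, measurable_cong]: "sets (P t x) = sets M"
  using sets.sets_measure_of_eq[of M] unfolding P_def space_M .

lemma space_P [simp]: "space (P t x) = S"
  using sets_eq_imp_space_eq[OF sets_P] by simp

lemma emeasure_P:
  assumes "x \<in> S" "A \<in> sets M"
  shows "emeasure (P t x) A = Tsum t (indicator A) x"
proof (rule emeasure_measure_of[OF P_def[of t x], where X=A])
  show "sets M \<subseteq> Pow S" by (metis sets.space_closed space_M)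
  have "T n t (\<lambda>_. 0) x = 0" for n
    using T_cmult[of "\<lambda>_. 0" x n t 0] assms by simp
  moreover have "indicator {} = (\<lambda>_ :: 'a. 0 :: ennreal)" by (simp add: fun_eq_iff)
  ultimately show "positive (sets (P t x)) (\<lambda>A. Tsum t (indicator A) x)"
    by (simp add: positive_def Tsum_def)
  show "countably_additive (sets (P t x)) (\<lambda>A. Tsum t (indicator A) x)"
    unfolding countably_additive_def
  proof (intro allI impI)
    fix B :: "nat \<Rightarrow> 'a set"
    assume B: "range B \<subseteq> sets (P t x)" "disjoint_family B"
    have "(\<Sum>i. Tsum t (indicator (B i)) x) = Tsum t (\<lambda>y. \<Sum>i. indicator (B i) y) x"
      by (rule Tsum_suminf[symmetric]) (use B assms in auto)
    also have "(\<lambda>y. \<Sum>i. indicator (B i) y) = (indicator (\<Union>i. B i) :: _ \<Rightarrow> ennreal)"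
      using suminf_indicator[OF B(2)] by auto
    finally show "(\<Sum>i. Tsum t (indicator (B i)) x) = Tsum t (indicator (\<Union>i. B i)) x" .
  qed
  show "A \<in> sets (P t x)" using assms by simp
qed

text \<open>The induction over measurable functions consumes exactly the closure properties of
  \<open>T\<close> shown above: congruence, scaling, sums and increasing limits.\<close>

lemma nn_integral_P:
  assumes f: "f \<in> borel_measurable M" and x: "x \<in> S"
  shows "(\<integral>\<^sup>+y. f y \<partial>P t x) = Tsum t f x"
  using f
proof (induction rule: borel_measurable_induct)
  case (cong f g)
  then show ?case
    using x T_cong[of x f g] by (subst nn_integral_cong[where v = g]) (auto simp: Tsum_def)
next
  case (set A)
  then show ?case by (simp add: emeasure_P x)
next
  case (mult u c)
  then show ?case using x by (simp add: nn_integral_cmult Tsum_def T_cmult)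
next
  case (add u v)
  then show ?case using x by (simp add: nn_integral_add Tsum_def T_add suminf_add[symmetric])
next
  case (seq U)
  have inc: "incseq (\<lambda>i. U i y)" for y
    using \<open>incseq U\<close> by (auto simp: incseq_def le_fun_def)
  have "(\<integral>\<^sup>+y. (SUP i. U i) y \<partial>P t x) = (SUP i. \<integral>\<^sup>+y. U i y \<partial>P t x)"
    using seq by (simp add: image_image nn_integral_monotone_convergence_SUP)
  also have "\<dots> = (\<Sum>n. SUP i. T n t (U i) x)"
    unfolding seq Tsum_def using \<open>incseq U\<close> x
    by (subst ennreal_suminf_SUP_eq) (auto simp: incseq_def le_fun_def intro!: T_mono)
  also have "\<dots> = Tsum t (SUP i. U i) x"
    unfolding Tsum_def using seq x
    by (subst T_SUP[symmetric]) (auto simp: SUP_apply[abs_def, symmetric])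
  finally show ?case .
qed

lemma prob_space_P: "t \<ge> 0 \<Longrightarrow> x \<in> S \<Longrightarrow> prob_space (P t x)"
  using nn_integral_P[of "\<lambda>_. 1" x t] by (intro prob_spaceI) (simp add: Tsum_const)

lemma measurable_P [measurable]: "t \<ge> 0 \<Longrightarrow> P t \<in> M \<rightarrow>\<^sub>M prob_algebra M"
proof (intro measurable_prob_algebraI measurable_subprob_algebra)
  fix A assume A: "A \<in> sets M"
  then have "Tsum t (indicator A) \<in> borel_measurable M" by measurable
  then show "(\<lambda>x. emeasure (P t x) A) \<in> borel_measurable M"
    by (rule measurable_cong[THEN iffD2, rotated]) (simp add: emeasure_P A)
qed (auto intro: prob_space_P prob_space_imp_subprob_space)

lemma P_0: "x \<in> S \<Longrightarrow> P 0 x = return M x"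
proof (rule measure_eqI)
  fix A assume A: "A \<in> sets (P 0 x)" and x: "x \<in> S"
  have "Tsum 0 (indicator A) x = (\<Sum>n. if n = 0 then indicator A x else 0)"
    unfolding Tsum_def
  proof (rule arg_cong[where f=suminf], rule ext)
    fix n show "T n 0 (indicator A) x = (if n = 0 then indicator A x else 0)"
      by (cases n) (auto simp: x flow_0)
  qed
  also have "\<dots> = indicator A x" by (subst suminf_finite[of "{0}"]) auto
  finally show "emeasure (P 0 x) A = emeasure (return M x) A"
    using A x by (simp add: emeasure_P)
qed simp

lemma P_add:
  assumes "s \<ge> 0" "t \<ge> 0" "x \<in> S"
  shows "P (s + t) x = P s x \<bind> P t"
proof (rule measure_eqI)
  have in_alg: "P s x \<in> space (prob_algebra M)"
    using assms by (simp add: space_prob_algebra prob_space_P)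
  show sets: "sets (P (s + t) x) = sets (P s x \<bind> P t)"
    using sets_bind'[OF in_alg measurable_P] assms by simp
  fix A assume A: "A \<in> sets (P (s + t) x)"
  have "emeasure (P s x \<bind> P t) A = (\<integral>\<^sup>+y. emeasure (P t y) A \<partial>P s x)"
    using A assms by (intro emeasure_bind_prob_algebra[OF in_alg measurable_P]) auto
  also have "\<dots> = (\<integral>\<^sup>+y. Tsum t (indicator A) y \<partial>P s x)"
    using A by (intro nn_integral_cong) (simp add: emeasure_P)
  also have "\<dots> = Tsum (s + t) (indicator A) x"
    using A assms by (subst nn_integral_P) (auto simp: Tsum_add_time)
  also have "\<dots> = emeasure (P (s + t) x) A"
    using A assms by (simp add: emeasure_P)
  finally show "emeasure (P (s + t) x) A = emeasure (P s x \<bind> P t) A" by simp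
qed

section \<open>The Feller property\<close>

lemma T_bound:
  assumes "t \<ge> 0" "x \<in> S" "\<And>y. y \<in> S \<Longrightarrow> f y \<le> c"
  shows "T n t f x \<le> c * T n t (\<lambda>_. 1) x"
  using T_mono[of x f "\<lambda>_. c * 1" n t] T_cmult[of "\<lambda>_. 1" x n t c] assms by simp

lemma T_one_le: "t \<ge> 0 \<Longrightarrow> x \<in> S \<Longrightarrow> T n t (\<lambda>_. 1) x \<le> 1"
  using sum_le_suminf[of "\<lambda>n. T n t (\<lambda>_. 1) x" "{n}"] Tsum_const[of t x]
  by (simp add: Tsum_def)

lemma flow_tendsto:
  assumes "u \<longlonglongrightarrow> x" "x \<in> S" "\<And>k. u k \<in> S"
  shows "(\<lambda>k. flow t (u k)) \<longlonglongrightarrow> flow t x"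
proof -
  have "continuous_on S (\<lambda>x. (\<lambda>(t, x). flow t x) (t, x))"
    by (rule continuous_on_compose2[OF flow_cont]) (auto intro!: continuous_intros)
  with assms show ?thesis
    by (auto simp: continuous_on_sequentially o_def)
qed

lemma jump_mass:
  assumes "t \<ge> 0"
  shows "(\<integral>\<^sup>+ s. indicator {0..<t} s * ennreal (l * exp (- l * s)) \<partial>lborel) = ennreal (1 - exp (- l * t))"
proof -
  have "(\<integral>\<^sup>+ s. indicator {0..<t} s * ennreal (l * exp (- l * s)) \<partial>lborel)
      = (\<integral>\<^sup>+ s. ennreal (l * exp (- l * s)) * indicator {0..t} s \<partial>lborel)"
  proof (intro nn_integral_cong_AE)
    have "AE s in lborel. s \<noteq> t" by (rule AE_lborel_singleton)
    then show "AE s in lborel. indicator {0..<t} s * ennreal (l * exp (- l * s))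
        = ennreal (l * exp (- l * s)) * indicator {0..t} s"
      by eventually_elim (auto simp: indicator_def)
  qed
  also have "\<dots> = ennreal (- exp (- l * t) - (- exp (- l * 0)))"
  proof (rule nn_integral_FTC_Icc)
    show "((\<lambda>s. - exp (- l * s)) has_real_derivative l * exp (- l * s)) (at s)" for s
      by (auto intro!: derivative_eq_intros)
  qed (use assms l_pos in auto)
  finally show ?thesis by simp
qed

text \<open>Induction on the number of jumps, with dominated convergence over the time of the first
  jump; the jump density times \<open>B\<close> dominates. Sequences suffice because the space is
  first countable.\<close>

lemma T_tendsto:
  assumes f: "continuous_on S f" "\<And>y. y \<in> S \<Longrightarrow> f y \<ge> 0" "\<And>y. y \<in> S \<Longrightarrow> f y \<le> B"
    and t: "t \<ge> 0" and u: "u \<longlonglongrightarrow> x" "x \<in> S" "\<And>k. u k \<in> S"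
  shows "(\<lambda>k. T n t (\<lambda>y. ennreal (f y)) (u k)) \<longlonglongrightarrow> T n t (\<lambda>y. ennreal (f y)) x"
  using t u
proof (induction n arbitrary: t x u)
  case 0
  have "(\<lambda>k. f (flow t (u k))) \<longlonglongrightarrow> f (flow t x)"
    using f(1) flow_tendsto[OF 0(2-)] 0 by (auto simp: continuous_on_sequentially o_def flow_in)
  then show ?case by (auto intro!: ennreal_tendsto_cmult tendsto_ennrealI)
next
  case (Suc n)
  have mf: "(\<lambda>y. ennreal (f y)) \<in> borel_measurable M"
    using borel_measurable_continuous_on_restrict[OF f(1)] by measurable
  note [measurable] = measurable_T_integrand[OF mf Suc.prems(3)] measurable_T_integrand[OF mf Suc.prems(4)]
  let ?w = "\<lambda>s. indicator {0..<t} s * ennreal (l * exp (- l * s)) * ennreal B"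
  show ?case
    unfolding T.simps
  proof (rule nn_integral_dominated_convergence[where w = ?w])
    show "AE s in lborel. indicator {0..<t} s * ennreal (l * exp (- l * s))
        * T n (t - s) (\<lambda>y. ennreal (f y)) (J (flow s (u k))) \<le> ?w s" for k
    proof (intro AE_I2)
      fix s
      show "indicator {0..<t} s * ennreal (l * exp (- l * s))
        * T n (t - s) (\<lambda>y. ennreal (f y)) (J (flow s (u k))) \<le> ?w s"
      proof (cases "0 \<le> s \<and> s < t")
        case True
        have Jf: "J (flow s (u k)) \<in> S" using Suc.prems by (simp add: J_in flow_in)
        have "T n (t - s) (\<lambda>y. ennreal (f y)) (J (flow s (u k))) \<le> ennreal B * T n (t - s) (\<lambda>_. 1) (J (flow s (u k)))"
          using True Jf f by (intro T_bound) (auto intro: ennreal_leI)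
        also have "\<dots> \<le> ennreal B * 1"
          using True Jf by (intro mult_left_mono T_one_le) auto
        finally show ?thesis by (intro mult_left_mono) auto
      qed (auto simp: indicator_def)
    qed
    show "(\<integral>\<^sup>+ s. ?w s \<partial>lborel) < \<infinity>"
      using jump_mass[of t] Suc.prems by (subst nn_integral_multc) (auto simp: ennreal_mult_less_top)
    show "AE s in lborel. (\<lambda>k. indicator {0..<t} s * ennreal (l * exp (- l * s))
        * T n (t - s) (\<lambda>y. ennreal (f y)) (J (flow s (u k))))
        \<longlonglongrightarrow> indicator {0..<t} s * ennreal (l * exp (- l * s))
        * T n (t - s) (\<lambda>y. ennreal (f y)) (J (flow s x))"
    proof (intro AE_I2)
      fix s
      show "(\<lambda>k. indicator {0..<t} s * ennreal (l * exp (- l * s))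
        * T n (t - s) (\<lambda>y. ennreal (f y)) (J (flow s (u k))))
        \<longlonglongrightarrow> indicator {0..<t} s * ennreal (l * exp (- l * s))
        * T n (t - s) (\<lambda>y. ennreal (f y)) (J (flow s x))"
      proof (cases "0 \<le> s \<and> s < t")
        case True
        have "(\<lambda>k. J (flow s (u k))) \<longlonglongrightarrow> J (flow s x)"
          using J_cont flow_tendsto[OF Suc.prems(2-)] Suc.prems
          by (auto simp: continuous_on_sequentially o_def flow_in)
        then show ?thesis
          using True Suc.prems by (intro ennreal_tendsto_cmult Suc.IH) (auto simp: J_in flow_in ennreal_mult_less_top)
      qed simp
    qed
  qed measurable
qed

lemmas bounded_cont = continuous_on_compact_boundE[OF compact_S]

lemma measurable_cont:
  fixes f :: "'a \<Rightarrow> real"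
  shows "continuous_on S f \<Longrightarrow> f \<in> borel_measurable M"
  by (rule borel_measurable_continuous_on_restrict)

lemma Tsum_tendsto:
  assumes f: "continuous_on S f" "\<And>y. y \<in> S \<Longrightarrow> f y \<ge> 0"
    and t: "t \<ge> 0" and u: "u \<longlonglongrightarrow> x" "x \<in> S" "\<And>k. u k \<in> S"
  shows "(\<lambda>k. Tsum t (\<lambda>y. ennreal (f y)) (u k)) \<longlonglongrightarrow> Tsum t (\<lambda>y. ennreal (f y)) x"
proof -
  obtain B where B: "B > 0" "\<And>y. y \<in> S \<Longrightarrow> \<bar>f y\<bar> \<le> B"
    using bounded_cont[OF f(1)] by blast
  have fB: "f y \<le> B" if "y \<in> S" for y
    using B(2)[OF that] by simp
  \<comment> \<open>By \<open>T_const\<close> these weights are the same for every starting point,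
    so one summable bound serves all \<open>u k\<close>, and dominated convergence applies to the
    counting measure over the number of jumps.\<close>
  let ?w = "\<lambda>n. ennreal B * T n t (\<lambda>_. 1) x"
  have "(\<lambda>k. \<integral>\<^sup>+n. T n t (\<lambda>y. ennreal (f y)) (u k) \<partial>count_space UNIV)
      \<longlonglongrightarrow> (\<integral>\<^sup>+n. T n t (\<lambda>y. ennreal (f y)) x \<partial>count_space UNIV)"
  proof (rule nn_integral_dominated_convergence[where w = ?w])
    show "(\<integral>\<^sup>+n. ?w n \<partial>count_space UNIV) < \<infinity>"
      using Tsum_const[OF t u(2)] by (simp add: nn_integral_count_space_nat Tsum_def)
    show "AE n in count_space UNIV. T n t (\<lambda>y. ennreal (f y)) (u k) \<le> ?w n" for k
    proof (intro AE_I2)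
      fix n
      have "T n t (\<lambda>y. ennreal (f y)) (u k) \<le> ennreal B * T n t (\<lambda>_. 1) (u k)"
        using t u fB by (intro T_bound) (auto intro: ennreal_leI)
      also have "\<dots> = ?w n"
        using t u by (simp add: T_const)
      finally show "T n t (\<lambda>y. ennreal (f y)) (u k) \<le> ?w n" .
    qed
    show "AE n in count_space UNIV. (\<lambda>k. T n t (\<lambda>y. ennreal (f y)) (u k)) \<longlonglongrightarrow> T n t (\<lambda>y. ennreal (f y)) x"
      using fB by (intro AE_I2 T_tendsto[OF f _ t u])
  qed auto
  then show ?thesis by (simp add: nn_integral_count_space_nat Tsum_def)
qed

lemma integrable_P:
  assumes f: "continuous_on S f" and "t \<ge> 0" "x \<in> S"
  shows "integrable (P t x) (f :: 'a \<Rightarrow> real)"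
proof -
  interpret prob_space "P t x" using assms by (intro prob_space_P)
  obtain B where B: "B > 0" "\<And>y. y \<in> S \<Longrightarrow> \<bar>f y\<bar> \<le> B"
    using bounded_cont[OF f] by blast
  show ?thesis
    using B measurable_cont[OF f] by (intro integrable_const_bound[where B=B]) auto
qed

lemma integral_P_nonneg:
  assumes f: "continuous_on S f" "\<And>y. y \<in> S \<Longrightarrow> f y \<ge> 0" and "t \<ge> 0" "x \<in> S"
  shows "ennreal (\<integral>y. f y \<partial>P t x) = Tsum t (\<lambda>y. ennreal (f y)) x"
proof -
  have "ennreal (\<integral>y. f y \<partial>P t x) = (\<integral>\<^sup>+y. ennreal (f y) \<partial>P t x)"
    using assms by (intro nn_integral_eq_integral[symmetric] integrable_P AE_I2) auto
  also have "\<dots> = Tsum t (\<lambda>y. ennreal (f y)) x"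
    using assms measurable_cont[OF f(1)] by (intro nn_integral_P) auto
  finally show ?thesis .
qed

lemma integral_P_add_const:
  fixes f :: "'a \<Rightarrow> real"
  assumes "continuous_on S f" "t \<ge> 0" "x \<in> S"
  shows "(\<integral>y. f y + c \<partial>P t x) = (\<integral>y. f y \<partial>P t x) + c"
proof -
  interpret prob_space "P t x" using assms by (intro prob_space_P)
  show ?thesis using integrable_P[OF assms] prob_space by simp
qed

lemma P_feller:
  fixes f :: "'a \<Rightarrow> real"
  assumes f: "continuous_on S f" and t: "t \<ge> 0"
  shows "continuous_on S (\<lambda>x. \<integral>y. f y \<partial>P t x)"
proof -
  obtain B where B: "B > 0" "\<And>y. y \<in> S \<Longrightarrow> \<bar>f y\<bar> \<le> B"
    using bounded_cont[OF f] by blast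
  \<comment> \<open>The shift makes the integrand nonnegative, so that the series with values in
    \<open>ennreal\<close> represents the integral.\<close>
  let ?g = "\<lambda>y. f y + B"
  have g: "continuous_on S ?g" "\<And>y. y \<in> S \<Longrightarrow> ?g y \<ge> 0"
    using f B(2) by (auto intro!: continuous_intros) (smt (verit))
  have "continuous_on S (\<lambda>x. \<integral>y. ?g y \<partial>P t x)"
    unfolding continuous_on_sequentially
  proof (intro allI ballI impI, elim conjE)
    fix u x assume x: "x \<in> S" and u: "\<forall>n. u n \<in> S" "u \<longlonglongrightarrow> x"
    have "(\<lambda>k. ennreal (\<integral>y. ?g y \<partial>P t (u k))) \<longlonglongrightarrow> ennreal (\<integral>y. ?g y \<partial>P t x)"
      using Tsum_tendsto[OF g t u(2) x] u x by (simp add: integral_P_nonneg[OF g t])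
    then show "((\<lambda>x. \<integral>y. ?g y \<partial>P t x) \<circ> u) \<longlonglongrightarrow> (\<integral>y. ?g y \<partial>P t x)"
      unfolding o_def
      by (rule tendsto_ennrealD)
        (use g u in \<open>auto intro!: always_eventually Bochner_Integration.integral_nonneg\<close>)
  qed
  then have "continuous_on S (\<lambda>x. (\<integral>y. ?g y \<partial>P t x) - B)"
    by (intro continuous_intros)
  then show ?thesis
    by (rule continuous_on_cong[THEN iffD1, rotated 2]) (simp_all add: integral_P_add_const f t)
qed

section \<open>The renewal equation at the first jump, and the generator\<close>

lemma Tsum_first_jump:
  assumes f: "f \<in> borel_measurable M" and x: "x \<in> S"
  shows "Tsum t f x = ennreal (exp (- l * t)) * f (flow t x)
    + (\<integral>\<^sup>+ s. indicator {0..<t} s * ennreal (l * exp (- l * s)) * Tsum (t - s) f (J (flow s x)) \<partial>lborel)"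
proof -
  note [measurable] = measurable_T_integrand[OF f x]
  have "Tsum t f x = (\<Sum>n. T (Suc n) t f x) + T 0 t f x"
    unfolding Tsum_def using suminf_offset[of "\<lambda>n. T n t f x" 1, OF summableI] by simp
  also have "(\<Sum>n. T (Suc n) t f x) =
      (\<integral>\<^sup>+ s. (\<Sum>n. indicator {0..<t} s * ennreal (l * exp (- l * s)) * T n (t - s) f (J (flow s x))) \<partial>lborel)"
    unfolding T.simps by (rule nn_integral_suminf[symmetric]) measurable
  finally show ?thesis by (simp add: Tsum_def add.commute)
qed

text \<open>The renewal equation turned into a real inequality: whatever follows the first jump is
  replaced by a bound \<open>c\<close>, and a jump occurs with probability
  \<open>1 - exp (- l * t)\<close>.\<close>

lemma first_jump_le:
  fixes f :: "'a \<Rightarrow> real"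
  assumes f: "continuous_on S f" and t: "t \<ge> 0" and x: "x \<in> S"
    and c: "\<And>s. 0 \<le> s \<Longrightarrow> s < t \<Longrightarrow> (\<integral>y. f y \<partial>P (t - s) (J (flow s x))) \<le> c"
  shows "(\<integral>y. f y \<partial>P t x) \<le> exp (- l * t) * f (flow t x) + (1 - exp (- l * t)) * c"
proof -
  obtain B where B: "B > 0" "\<And>y. y \<in> S \<Longrightarrow> \<bar>f y\<bar> \<le> B"
    using bounded_cont[OF f] by blast
  \<comment> \<open>Large enough to make both \<open>f\<close> and the bound \<open>c\<close>
    nonnegative after the shift.\<close>
  define K where "K = B + \<bar>c\<bar>"
  let ?g = "\<lambda>y. f y + K"
  have g: "continuous_on S ?g" "\<And>y. y \<in> S \<Longrightarrow> ?g y \<ge> 0"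
    using f B(2) by (auto intro!: continuous_intros simp: K_def) (smt (verit))
  have cK: "c + K \<ge> 0" using B by (simp add: K_def)
  have e1: "1 - exp (- l * t) \<ge> 0" using t l_pos by simp
  have "ennreal (\<integral>y. ?g y \<partial>P t x) = ennreal (exp (- l * t)) * ennreal (?g (flow t x))
    + (\<integral>\<^sup>+ s. indicator {0..<t} s * ennreal (l * exp (- l * s))
        * Tsum (t - s) (\<lambda>y. ennreal (?g y)) (J (flow s x)) \<partial>lborel)"
    using measurable_cont[OF g(1)] x
    by (intro trans[OF integral_P_nonneg[OF g t x] Tsum_first_jump]) auto
  also have "\<dots> \<le> ennreal (exp (- l * t)) * ennreal (?g (flow t x))
    + (\<integral>\<^sup>+ s. indicator {0..<t} s * ennreal (l * exp (- l * s)) * ennreal (c + K) \<partial>lborel)"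
  proof (intro add_left_mono nn_integral_mono)
    fix s
    show "indicator {0..<t} s * ennreal (l * exp (- l * s)) * Tsum (t - s) (\<lambda>y. ennreal (?g y)) (J (flow s x))
        \<le> indicator {0..<t} s * ennreal (l * exp (- l * s)) * ennreal (c + K)"
    proof (cases "0 \<le> s \<and> s < t")
      case True
      have "Tsum (t - s) (\<lambda>y. ennreal (?g y)) (J (flow s x)) = ennreal (\<integral>y. ?g y \<partial>P (t - s) (J (flow s x)))"
        using True x by (intro integral_P_nonneg[OF g, symmetric]) (auto simp: J_in flow_in)
      also have "\<dots> \<le> ennreal (c + K)"
        using True x c[of s] by (intro ennreal_leI) (simp add: integral_P_add_const f J_in flow_in)
      finally show ?thesis by (intro mult_left_mono) auto
    qed (auto simp: indicator_def)
  qed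
  also have "\<dots> = ennreal (exp (- l * t)) * ennreal (?g (flow t x)) + ennreal (1 - exp (- l * t)) * ennreal (c + K)"
    using jump_mass[OF t] by (subst nn_integral_multc) auto
  also have "\<dots> = ennreal (exp (- l * t) * ?g (flow t x) + (1 - exp (- l * t)) * (c + K))"
    using g(2)[OF flow_in[OF x]] cK e1 by (simp add: ennreal_mult ennreal_plus)
  finally have "(\<integral>y. ?g y \<partial>P t x) \<le> exp (- l * t) * ?g (flow t x) + (1 - exp (- l * t)) * (c + K)"
    using g(2)[OF flow_in[OF x]] cK e1 by (subst (asm) ennreal_le_iff) auto
  then show ?thesis
    using integral_P_add_const[OF f t x, of K] by (simp add: algebra_simps)
qed

lemma first_jump_ge:
  fixes f :: "'a \<Rightarrow> real"
  assumes f: "continuous_on S f" and t: "t \<ge> 0" and x: "x \<in> S"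
    and c: "\<And>s. 0 \<le> s \<Longrightarrow> s < t \<Longrightarrow> (\<integral>y. f y \<partial>P (t - s) (J (flow s x))) \<ge> c"
  shows "(\<integral>y. f y \<partial>P t x) \<ge> exp (- l * t) * f (flow t x) + (1 - exp (- l * t)) * c"
  using first_jump_le[of "\<lambda>y. - f y" t x "- c"] assms by (simp add: continuous_on_minus algebra_simps)

text \<open>Compactness of \<open>S\<close> makes the continuity in \<open>t\<close> at 0 uniform
  over the starting point.\<close>

lemma flow_uniform:
  fixes f :: "'a \<Rightarrow> real"
  assumes f: "continuous_on S f" and e: "e > 0"
  obtains d where "d > 0" "\<And>t x. 0 \<le> t \<Longrightarrow> t < d \<Longrightarrow> x \<in> S \<Longrightarrow> \<bar>f (flow t x) - f x\<bar> \<le> e"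
proof -
  have "continuous_on (UNIV \<times> S) (\<lambda>(t, x). f (flow t x))"
    using continuous_on_compose2[OF f flow_cont] flow_in by (force simp: split_def)
  from continuous_on_prod_compactE[OF this compact_S UNIV_I e, of 0]
  obtain X where X: "0 \<in> X" "open X"
    "\<forall>t\<in>X \<inter> UNIV. \<forall>x\<in>S. dist (f (flow t x)) (f (flow 0 x)) \<le> e" by auto
  then obtain d where "d > 0" "ball 0 d \<subseteq> X" by (auto simp: open_contains_ball)
  with X that[of d] show ?thesis by (auto simp: dist_real_def flow_0 subset_iff)
qed

lemma P_uniform:
  fixes f :: "'a \<Rightarrow> real"
  assumes f: "continuous_on S f" and e: "e > 0"
  obtains d where "d > 0" "\<And>t x. 0 \<le> t \<Longrightarrow> t < d \<Longrightarrow> x \<in> S \<Longrightarrow> \<bar>(\<integral>y. f y \<partial>P t x) - f x\<bar> \<le> e"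
proof -
  obtain B where B: "B > 0" "\<And>y. y \<in> S \<Longrightarrow> \<bar>f y\<bar> \<le> B"
    using bounded_cont[OF f] by blast
  obtain d where d: "d > 0" "\<And>t x. 0 \<le> t \<Longrightarrow> t < d \<Longrightarrow> x \<in> S \<Longrightarrow> \<bar>f (flow t x) - f x\<bar> \<le> e / 2"
    using flow_uniform[OF f, of "e / 2"] e by auto
  have Pb: "(\<integral>y. f y \<partial>P t x) \<le> B" "- B \<le> (\<integral>y. f y \<partial>P t x)" if "t \<ge> 0" "x \<in> S" for t x
  proof -
    interpret prob_space "P t x" using that by (intro prob_space_P)
    have "f y \<le> B" "- B \<le> f y" if "y \<in> S" for y
      using B(2)[OF that] by auto
    then show "(\<integral>y. f y \<partial>P t x) \<le> B" "- B \<le> (\<integral>y. f y \<partial>P t x)"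
      using integrable_P[OF f that] by (auto intro!: integral_le_const integral_ge_const)
  qed
  \<comment> \<open>The jump probability is at most \<open>l * t\<close> and enters twice, once with
    the value after the jump and once with the missing mass of the jump-free path. Each contribution
    is at most \<open>e / 4\<close>, and the flow contributes \<open>e / 2\<close>.\<close>
  have "\<bar>(\<integral>y. f y \<partial>P t x) - f x\<bar> \<le> e" if t: "0 \<le> t" "t < min d (e / (4 * l * B))" and x: "x \<in> S" for t x
  proof -
    let ?E = "1 - exp (- l * t)"
    have E: "0 \<le> ?E" "?E \<le> l * t"
      using t l_pos exp_ge_add_one_self[of "- l * t"] by auto
    have "l * t * B \<le> e / 4"
      using t B l_pos by (simp add: field_simps)
    moreover have "?E * B \<le> l * t * B" using E B by (intro mult_right_mono) auto
    ultimately have EB: "?E * B \<le> e / 4" by simp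
    have "(\<integral>y. f y \<partial>P t x) \<le> exp (- l * t) * f (flow t x) + ?E * B"
      using t x by (intro first_jump_le f) (auto intro!: Pb J_in flow_in)
    moreover have "(\<integral>y. f y \<partial>P t x) \<ge> exp (- l * t) * f (flow t x) + ?E * (- B)"
      using t x by (intro first_jump_ge f) (auto intro!: Pb J_in flow_in)
    moreover have "exp (- l * t) * f (flow t x) = f (flow t x) - ?E * f (flow t x)"
      by (simp add: algebra_simps)
    moreover have "\<bar>?E * f (flow t x)\<bar> \<le> ?E * B"
      using E B(2)[OF flow_in[OF x]] by (simp add: abs_mult mult_left_mono)
    moreover have "\<bar>f (flow t x) - f x\<bar> \<le> e / 2" using d t x by auto
    ultimately show ?thesis using EB unfolding abs_le_iff minus_mult_right[symmetric] by linarith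
  qed
  moreover have "min d (e / (4 * l * B)) > 0" using d e l_pos B by simp
  ultimately show ?thesis using that by blast
qed

lemma feller_P:
  fixes f :: "'a \<Rightarrow> real"
  assumes f: "continuous_on S f"
  shows "uniform_limit S (\<lambda>t x. \<integral>y. f y \<partial>P t x) f (at_right 0)"
  unfolding uniform_limit_iff
proof (intro allI impI)
  fix e :: real assume "e > 0"
  then obtain d where d: "d > 0" "\<And>t x. 0 \<le> t \<Longrightarrow> t < d \<Longrightarrow> x \<in> S \<Longrightarrow> \<bar>(\<integral>y. f y \<partial>P t x) - f x\<bar> \<le> e / 2"
    using P_uniform[OF f, of "e / 2"] by auto
  have "dist (\<integral>y. f y \<partial>P t x) (f x) < e" if "0 < t" "t < d" "x \<in> S" for t x
    using d(2)[of t x] that \<open>e > 0\<close> unfolding dist_real_def by linarith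
  then show "\<forall>\<^sub>F t in at_right 0. \<forall>x\<in>S. dist (\<integral>y. f y \<partial>P t x) (f x) < e"
    using d(1) by (auto simp: eventually_at_right_field)
qed

text \<open>To first order in \<open>t\<close> there is either no jump, and \<open>f\<close> moves
  along the flow by \<open>t * G x\<close>, or one jump of probability \<open>l * t\<close> that
  replaces \<open>f x\<close> by \<open>f (J x)\<close>. The work is to make all errors uniform in
  \<open>x\<close>.\<close>

lemma generator_P:
  fixes f G :: "'a \<Rightarrow> real"
  assumes f: "continuous_on S f" and G: "continuous_on S G"
    and deriv: "\<And>t x. x \<in> S \<Longrightarrow> ((\<lambda>t. f (flow t x)) has_real_derivative G (flow t x)) (at t)"
  shows "uniform_limit S (\<lambda>t x. ((\<integral>y. f y \<partial>P t x) - f x) / t)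
    (\<lambda>x. G x + l * (f (J x) - f x)) (at_right 0)"
  unfolding uniform_limit_iff
proof (intro allI impI)
  fix e :: real assume e: "e > 0"
  define h where "h = (\<lambda>x. f (J x))"
  have h: "continuous_on S h"
    unfolding h_def using continuous_on_compose2[OF f J_cont] J_in by auto
  obtain B where B: "B > 0" "\<And>y. y \<in> S \<Longrightarrow> \<bar>f y\<bar> \<le> B" using bounded_cont[OF f] by blast
  obtain C where C: "C > 0" "\<And>y. y \<in> S \<Longrightarrow> \<bar>G y\<bar> \<le> C" using bounded_cont[OF G] by blast
  \<comment> \<open>Tolerance for the errors of size \<open>t * r\<close>: the flow contributes one
    of them and the value after a jump \<open>2 * l\<close>, so together they cost
    \<open>t * e / 4\<close>.\<close>
  define r where "r = e / (4 * (1 + 2 * l))"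
  have r: "r > 0" using e l_pos by (simp add: r_def)
  obtain d1 where d1: "d1 > 0" "\<And>t x. 0 \<le> t \<Longrightarrow> t < d1 \<Longrightarrow> x \<in> S \<Longrightarrow> \<bar>(\<integral>y. f y \<partial>P t x) - f x\<bar> \<le> r"
    using P_uniform[OF f r] by blast
  obtain d2 where d2: "d2 > 0" "\<And>t x. 0 \<le> t \<Longrightarrow> t < d2 \<Longrightarrow> x \<in> S \<Longrightarrow> \<bar>h (flow t x) - h x\<bar> \<le> r"
    using flow_uniform[OF h r] by blast
  obtain d3 where d3: "d3 > 0" "\<And>t x. 0 \<le> t \<Longrightarrow> t < d3 \<Longrightarrow> x \<in> S \<Longrightarrow> \<bar>G (flow t x) - G x\<bar> \<le> r"
    using flow_uniform[OF G r] by blast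
  \<comment> \<open>\<open>t * t * K\<close> collects the second-order errors:
    \<open>(l * t)\<^sup>2 * (2 * B)\<close> from expanding the exponential, and
    \<open>l * t * (t * C)\<close> from the drift lost on the event of a jump.\<close>
  define K where "K = 2 * l\<^sup>2 * B + l * C"
  have K: "K > 0" using B C l_pos by (simp add: K_def add_pos_pos)
  define d where "d = Min {d1, d2, d3, e / (4 * K)}"
  have d: "d > 0" "d \<le> d1" "d \<le> d2" "d \<le> d3" "d \<le> e / (4 * K)"
    using d1 d2 d3 e K by (auto simp: d_def)
  have main: "dist (((\<integral>y. f y \<partial>P t x) - f x) / t) (G x + l * (f (J x) - f x)) < e"
    if t: "0 < t" "t < d" and x: "x \<in> S" for t x
  proof -
    let ?p = "\<integral>y. f y \<partial>P t x"
    let ?q = "exp (- l * t)"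
    have q: "0 \<le> 1 - ?q" "1 - ?q \<le> l * t" "?q > 0" "?q \<le> 1"
      using t l_pos exp_ge_add_one_self[of "- l * t"] by auto
    have near: "\<bar>(\<integral>y. f y \<partial>P (t - s) (J (flow s x))) - h x\<bar> \<le> 2 * r" if "0 \<le> s" "s < t" for s
      using d1(2)[of "t - s" "J (flow s x)"] d2(2)[of s x] that t d x
      by (simp add: J_in flow_in h_def)
    have up: "?p \<le> ?q * f (flow t x) + (1 - ?q) * (h x + 2 * r)"
      using t x near by (intro first_jump_le f) (auto simp: abs_le_iff diff_le_eq algebra_simps)
    have lo: "?p \<ge> ?q * f (flow t x) + (1 - ?q) * (h x - 2 * r)"
      using t x near by (intro first_jump_ge f) (auto simp: abs_le_iff diff_le_eq algebra_simps)
    obtain z where z: "0 < z" "z < t" "f (flow t x) - f (flow 0 x) = (t - 0) * G (flow z x)"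
      using MVT2[OF t(1), of "\<lambda>t. f (flow t x)" "\<lambda>t. G (flow t x)"] deriv[OF x] by auto
    define b where "b = f (flow t x) - f x - t * G x"
    have b: "\<bar>b\<bar> \<le> t * r"
    proof -
      have "b = t * (G (flow z x) - G x)"
        using z x by (simp add: b_def flow_0 algebra_simps)
      then show ?thesis
        using d3(2)[of z x] z t d x by (simp add: abs_mult mult_left_mono)
    qed
    let ?R = "?p - f x - t * (G x + l * (h x - f x))"
    have "\<bar>?p - (?q * f (flow t x) + (1 - ?q) * h x)\<bar> \<le> (1 - ?q) * (2 * r)"
      using up lo by (simp add: abs_le_iff algebra_simps)
    moreover have "(1 - ?q) * (2 * r) \<le> l * t * (2 * r)"
      using q r by (intro mult_right_mono) auto
    moreover have "?q * f (flow t x) + (1 - ?q) * h x - f x - t * (G x + l * (h x - f x))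
        = (?q - 1 + l * t) * (f x - h x) - (1 - ?q) * (t * G x) + ?q * b"
      by (simp add: b_def algebra_simps)
    moreover have "\<bar>(?q - 1 + l * t) * (f x - h x)\<bar> \<le> (l * t)\<^sup>2 * (2 * B)"
    proof -
      have "\<bar>f x - h x\<bar> \<le> 2 * B"
        using B(2)[OF x] B(2)[OF J_in[OF x]] by (simp add: h_def)
      moreover have "\<bar>?q - 1 + l * t\<bar> \<le> (l * t)\<^sup>2"
        using exp_second_order[of "l * t"] t l_pos by simp
      ultimately show ?thesis unfolding abs_mult by (intro mult_mono) auto
    qed
    moreover have "\<bar>(1 - ?q) * (t * G x)\<bar> \<le> (l * t) * (t * C)"
      unfolding abs_mult using q t C(2)[OF x] by (intro mult_mono) auto
    moreover have "\<bar>?q * b\<bar> \<le> t * r"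
      using b q mult_mono[of ?q 1 "\<bar>b\<bar>" "t * r"] by (simp add: abs_mult)
    ultimately have "\<bar>?R\<bar> \<le> l * t * (2 * r) + (l * t)\<^sup>2 * (2 * B) + (l * t) * (t * C) + t * r"
      by linarith
    also have "\<dots> = t * ((1 + 2 * l) * r + t * K)"
      by (simp add: K_def power2_eq_square algebra_simps)
    also have "\<dots> \<le> t * (e / 4 + e / 4)"
    proof (intro mult_left_mono add_mono)
      show "(1 + 2 * l) * r \<le> e / 4" using l_pos by (simp add: r_def divide_simps) (simp add: algebra_simps)
      have "t \<le> e / (4 * K)" using t d by linarith
      then show "t * K \<le> e / 4" using K by (simp add: field_simps)
    qed (use t in auto)
    also have "\<dots> < t * e" using t e by simp
    finally have "\<bar>?R\<bar> < t * e" .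
    moreover have "(?p - f x) / t - (G x + l * (f (J x) - f x)) = ?R / t"
      using t by (simp add: h_def field_simps)
    ultimately show ?thesis
      using t by (simp only: dist_real_def abs_divide) (simp add: pos_divide_less_eq mult.commute)
  qed
  then show "\<forall>\<^sub>F t in at_right 0. \<forall>x\<in>S. dist (((\<integral>y. f y \<partial>P t x) - f x) / t) (G x + l * (f (J x) - f x)) < e"
    using d(1) by (auto simp: eventually_at_right_field)
qed

end

section \<open>Invariant measures of Feller semigroups on the circle times two points\<close>

text \<open>Fibres of a continuous map into a discrete space are relatively open, so continuity may
  be checked on each of them. With the index as the map, this reduces the state space to single
  circles.\<close>

lemma continuous_on_discrete_fibres:
  fixes q :: "'a::topological_space \<Rightarrow> 'b::discrete_topology" and f :: "'a \<Rightarrow> 'c::topological_space"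
  assumes q: "continuous_on X q" and f: "\<And>i. continuous_on {x\<in>X. q x = i} f"
  shows "continuous_on X f"
  unfolding continuous_on_def
proof
  fix x assume x: "x \<in> X"
  obtain U where U: "open U" "U \<inter> X = {y\<in>X. q y = q x}"
    using q[unfolded continuous_on_open_invariant, rule_format, of "{q x}"] discrete_topology_class.open_discrete[of "{q x}"]
    by (auto simp: vimage_def)
  have "(f \<longlongrightarrow> f x) (at x within {y\<in>X. q y = q x})"
    using f[of "q x"] x by (auto simp: continuous_on_def)
  moreover have "at x within {y\<in>X. q y = q x} = at x within X"
    by (rule at_within_nhd[of x U]) (use U x in auto)
  ultimately show "(f \<longlongrightarrow> f x) (at x within X)" by simp
qed

text \<open>The hypothesis \<open>zero\<close> says that closed sets are zero sets; metrizability is not assumed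
  because the index type \<open>nat\<close> is not an instance of \<open>metric_space\<close>.\<close>

lemma prob_measure_eqI_continuous:
  fixes S :: "'a::topological_space set"
  assumes zero: "\<And>C :: 'a set. closed C \<Longrightarrow> \<exists>\<delta> :: 'a \<Rightarrow> real. continuous_on UNIV \<delta> \<and> (\<forall>x. \<delta> x \<ge> 0) \<and> C = {x. \<delta> x = 0}"
    and S: "closed S"
    and M: "M \<in> space (prob_algebra (restrict_space borel S))"
    and N: "N \<in> space (prob_algebra (restrict_space borel S))"
    and eq: "\<And>g :: 'a \<Rightarrow> real. continuous_on S g \<Longrightarrow> (\<integral>x. g x \<partial>M) = (\<integral>x. g x \<partial>N)"
  shows "M = N"
proof -
  \<comment> \<open>These truncated functions decrease to the indicator of the zero set of
    \<open>\<delta>\<close>. Integrals of continuous functions therefore determine the masses of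
    closed sets, which form an intersection-stable generator.\<close>
  have closed_eq: "measure L C = lim (\<lambda>n. \<integral>x. max 0 (1 - real n * \<delta> x) \<partial>L)"
    if L: "L \<in> space (prob_algebra (borel :: 'a measure))"
      and C: "continuous_on UNIV \<delta>" "\<And>x. \<delta> x \<ge> 0" "C = {x. \<delta> x = 0}" for L C and \<delta> :: "'a \<Rightarrow> real"
  proof -
    interpret prob_space L using L by (simp add: space_prob_algebra)
    have sL: "sets L = sets borel" using L by (simp add: space_prob_algebra)
    have [measurable]: "\<delta> \<in> borel_measurable L"
      unfolding measurable_cong_sets[OF sL refl] by (rule borel_measurable_continuous_onI[OF C(1)])
    have Cset: "C \<in> sets L"
    proof -
      have "{x \<in> space L. \<delta> x = 0} \<in> sets L" by measurable
      then show ?thesis using sets_eq_imp_space_eq[OF sL] by (simp add: C)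
    qed
    have "(\<lambda>n. \<integral>x. max 0 (1 - real n * \<delta> x) \<partial>L) \<longlonglongrightarrow> (\<integral>x. indicat_real C x \<partial>L)"
    proof (rule integral_dominated_convergence[where w="\<lambda>_. 1"])
      show "AE x in L. (\<lambda>n. max 0 (1 - real n * \<delta> x)) \<longlonglongrightarrow> indicat_real C x"
      proof (intro AE_I2)
        fix x
        show "(\<lambda>n. max 0 (1 - real n * \<delta> x)) \<longlonglongrightarrow> indicat_real C x"
        proof (cases "x \<in> C")
          case True
          then show ?thesis by (simp add: max_def C)
        next
          case False
          then have pos: "\<delta> x > 0"
            using C(2)[of x] C(3) by auto
          obtain k :: nat where k: "1 / \<delta> x < real k" using reals_Archimedean2 by blast
          have "max 0 (1 - real n * \<delta> x) = 0" if "n \<ge> k" for n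
          proof -
            have "1 / \<delta> x \<le> real n" using k that by linarith
            then show ?thesis using pos by (simp add: field_simps)
          qed
          then have "\<forall>\<^sub>F n in sequentially. max 0 (1 - real n * \<delta> x) = 0"
            by (auto simp: eventually_sequentially)
          then show ?thesis using False by (simp add: tendsto_eventually)
        qed
      qed
    qed (use C Cset in auto)
    then show ?thesis using Cset by (simp add: limI)
  qed
  \<comment> \<open>The measures are moved to the whole Borel space, where closed sets generate.
    Nothing is lost, because \<open>S\<close> is closed and its measurable subsets are
    Borel.\<close>
  have distr_in: "distr L borel (\<lambda>x. x) \<in> space (prob_algebra borel)"
    and distr_int: "continuous_on UNIV g \<Longrightarrow> (\<integral>x. g x \<partial>distr L borel (\<lambda>x. x)) = (\<integral>x. g x \<partial>L)"
    and distr_em: "A \<in> sets L \<Longrightarrow> emeasure L A = emeasure (distr L borel (\<lambda>x. x)) A"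
    if L: "L \<in> space (prob_algebra (restrict_space borel S))" for L A and g :: "'a \<Rightarrow> real"
  proof -
    have sL: "sets L = sets (restrict_space borel S)" using L by (simp add: space_prob_algebra)
    have m: "(\<lambda>x. x) \<in> L \<rightarrow>\<^sub>M borel"
      unfolding measurable_cong_sets[OF sL refl] by (rule measurable_restrict_space1) simp
    show "distr L borel (\<lambda>x. x) \<in> space (prob_algebra borel)"
      using L m by (auto simp: space_prob_algebra intro: prob_space.prob_space_distr)
    show "(\<integral>x. g x \<partial>distr L borel (\<lambda>x. x)) = (\<integral>x. g x \<partial>L)" if "continuous_on UNIV g"
      using borel_measurable_continuous_onI[OF that] by (intro integral_distr m) auto
    show "emeasure L A = emeasure (distr L borel (\<lambda>x. x)) A" if A: "A \<in> sets L"
    proof -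
      have "A \<in> sets borel" "A \<subseteq> space L"
        using A S sets.sets_into_space[OF A] unfolding sL by (auto simp: sets_restrict_space)
      then show ?thesis by (subst emeasure_distr[OF m]) (auto intro: arg_cong[where f="emeasure L"])
    qed
  qed
  let ?M = "distr M borel (\<lambda>x. x)" and ?N = "distr N borel (\<lambda>x. x)"
  interpret M': prob_space ?M using distr_in[OF M] by (simp add: space_prob_algebra)
  interpret N': prob_space ?N using distr_in[OF N] by (simp add: space_prob_algebra)
  have "?M = ?N"
  proof (rule measure_eqI_generator_eq[where E="Collect closed" and A="\<lambda>_. UNIV" and \<Omega>=UNIV])
    show "Int_stable (Collect closed :: 'a set set)" by (auto simp: Int_stable_def)
    show "sets ?M = sigma_sets UNIV (Collect closed)" "sets ?N = sigma_sets UNIV (Collect closed)"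
      by (simp_all add: borel_eq_closed)
    fix C :: "'a set" assume "C \<in> Collect closed"
    then have C: "closed C" by simp
    show "emeasure ?M C = emeasure ?N C"
    proof -
      obtain \<delta> :: "'a \<Rightarrow> real" where \<delta>: "continuous_on UNIV \<delta>" "\<And>x. \<delta> x \<ge> 0" "C = {x. \<delta> x = 0}"
        using zero[OF C] by blast
      have cont: "continuous_on UNIV (\<lambda>x. max 0 (1 - real n * \<delta> x))" for n
        by (intro continuous_intros \<delta>)
      have "measure ?M C = measure ?N C"
        unfolding closed_eq[OF distr_in[OF M] \<delta>] closed_eq[OF distr_in[OF N] \<delta>]
          distr_int[OF M cont] distr_int[OF N cont]
        by (subst eq) (auto intro: continuous_on_subset[OF cont])
      then show ?thesis by (simp add: M'.emeasure_eq_measure N'.emeasure_eq_measure)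
    qed
  qed auto
  with distr_em[OF M] distr_em[OF N] show ?thesis
    using M N by (intro measure_eqI) (auto simp: space_prob_algebra)
qed

section \<open>The state space: a circle times two points\<close>

lemma compact_states: "compact states"
  unfolding states_def by (intro compact_Times) (auto intro: finite_imp_compact)

lemma states_nonempty: "(1, 0) \<in> states"
  by (simp add: states_def)

lemma closed_zero_set_states:
  fixes C :: "(complex \<times> nat) set"
  assumes "closed C"
  shows "\<exists>\<delta> :: complex \<times> nat \<Rightarrow> real. continuous_on UNIV \<delta> \<and> (\<forall>x. \<delta> x \<ge> 0) \<and> C = {x. \<delta> x = 0}"
proof -
  define F where "F = (\<lambda>i. {z. (z, i) \<in> C})"
  have F: "closed (F i)" for i
    using continuous_closed_vimage[of C "\<lambda>z. (z, i)"] assms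
    by (auto simp: F_def vimage_def intro!: continuous_intros)
  \<comment> \<open>The distance to the fibre of \<open>C\<close> over the index. The empty fibre
    needs its own value, because \<open>infdist\<close> to the empty set is 0.\<close>
  define \<delta> where "\<delta> = (\<lambda>(z, i). if F i = {} then 1 else infdist z (F i))"
  have "continuous_on UNIV \<delta>"
  proof (rule continuous_on_discrete_fibres[where q=snd])
    fix i :: nat
    have "continuous_on {x \<in> UNIV. snd x = i} (\<lambda>x :: complex \<times> nat. if F i = {} then 1 else infdist (fst x) (F i))"
      by (cases "F i = {}") (auto intro!: continuous_intros)
    then show "continuous_on {x \<in> UNIV. snd x = i} \<delta>"
      by (rule continuous_on_cong[THEN iffD1, rotated 2]) (simp_all add: \<delta>_def split_beta)
  qed (auto intro!: continuous_intros)
  moreover have "\<forall>x. \<delta> x \<ge> 0" by (auto simp: \<delta>_def infdist_nonneg)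
  moreover have "C = {x. \<delta> x = 0}"
  proof (intro set_eqI)
    fix x :: "complex \<times> nat"
    obtain z i where x: "x = (z, i)" by (cases x)
    have "x \<in> C \<longleftrightarrow> z \<in> F i" by (simp add: F_def x)
    also have "\<dots> \<longleftrightarrow> F i \<noteq> {} \<and> infdist z (F i) = 0"
      using in_closed_iff_infdist_zero[OF F[of i], of z] by blast
    also have "\<dots> \<longleftrightarrow> x \<in> {x. \<delta> x = 0}" by (simp add: \<delta>_def x)
    finally show "x \<in> C \<longleftrightarrow> x \<in> {x. \<delta> x = 0}" .
  qed
  ultimately show ?thesis by blast
qed

lemma space_state_space [simp]: "space state_space = states"
  by (simp add: state_space_def space_restrict_space)

lemmas cont_states_bounded = continuous_on_compact_boundE[OF compact_states]

lemma cont_states_integrable: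
  fixes f :: "complex \<times> nat \<Rightarrow> real"
  assumes M: "M \<in> space (prob_algebra state_space)" and f: "continuous_on states f"
  shows "integrable M f"
proof -
  interpret prob_space M using M by (simp add: space_prob_algebra)
  have sM: "sets M = sets state_space" using M by (simp add: space_prob_algebra)
  obtain B where B: "B > 0" "\<And>y. y \<in> states \<Longrightarrow> \<bar>f y\<bar> \<le> B"
    using cont_states_bounded[OF f] by blast
  have "f \<in> borel_measurable M"
    unfolding measurable_cong_sets[OF sM refl] state_space_def
    by (rule borel_measurable_continuous_on_restrict[OF f])
  then show ?thesis
    using B sets_eq_imp_space_eq[OF sM] by (intro integrable_const_bound[where B=B]) auto
qed

lemma cont_states_integral_bound:
  fixes f :: "complex \<times> nat \<Rightarrow> real"
  assumes M: "M \<in> space (prob_algebra state_space)" and f: "continuous_on states f"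
    and B: "\<And>y. y \<in> states \<Longrightarrow> \<bar>f y\<bar> \<le> B"
  shows "\<bar>\<integral>x. f x \<partial>M\<bar> \<le> B"
proof -
  interpret prob_space M using M by (simp add: space_prob_algebra)
  have sM: "sets M = sets state_space" using M by (simp add: space_prob_algebra)
  have "f y \<le> B" "- B \<le> f y" if "y \<in> space M" for y
    using B[of y] that sets_eq_imp_space_eq[OF sM] by auto
  then have "(\<integral>x. f x \<partial>M) \<le> B" "- B \<le> (\<integral>x. f x \<partial>M)"
    using cont_states_integrable[OF M f]
    by (auto intro!: integral_le_const integral_ge_const)
  then show ?thesis by auto
qed

section \<open>Invariance and time averages for Feller semigroups\<close>

context
  fixes P assumes P: "feller_semigroup P"
begin

lemma feller_measurable: "t \<ge> 0 \<Longrightarrow> P t \<in> state_space \<rightarrow>\<^sub>M prob_algebra state_space"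
  using P by (simp add: feller_semigroup_def)

lemma feller_in_prob: "t \<ge> 0 \<Longrightarrow> x \<in> states \<Longrightarrow> P t x \<in> space (prob_algebra state_space)"
  using measurable_space[OF feller_measurable] by simp

lemma feller_cont:
  "t \<ge> 0 \<Longrightarrow> continuous_on states f \<Longrightarrow> continuous_on states (\<lambda>x. \<integral>y. (f y :: real) \<partial>P t x)"
  using P by (simp add: feller_semigroup_def)

lemma feller_integral_bind:
  assumes M: "M \<in> space (prob_algebra state_space)" and t: "t \<ge> 0" and f: "continuous_on states f"
  shows "(\<integral>x. f x \<partial>(M \<bind> P t)) = (\<integral>x. \<integral>y. (f y :: real) \<partial>P t x \<partial>M)"
proof -
  interpret prob_space M using M by (simp add: space_prob_algebra)
  have sM: "sets M = sets state_space" using M by (simp add: space_prob_algebra)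
  obtain B where B: "B > 0" "\<And>y. y \<in> states \<Longrightarrow> \<bar>f y\<bar> \<le> B"
    using cont_states_bounded[OF f] by blast
  show ?thesis
  proof (rule integral_bind[where K=state_space and B=B and B'=1])
    show "f \<in> borel_measurable state_space"
      unfolding state_space_def by (rule borel_measurable_continuous_on_restrict[OF f])
    show "P t \<in> M \<rightarrow>\<^sub>M subprob_algebra state_space"
      unfolding measurable_cong_sets[OF sM refl]
      by (rule measurable_prob_algebraD[OF feller_measurable[OF t]])
    show "AE x in M. emeasure (P t x) (space (P t x)) \<le> ennreal 1"
      using feller_in_prob[OF t] sets_eq_imp_space_eq[OF sM]
      by (intro AE_I2) (auto simp: space_prob_algebra prob_space.emeasure_space_1)
  qed (use B in \<open>auto intro: finite_measure_axioms\<close>)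
qed

lemma feller_integral_add:
  assumes "s \<ge> 0" "t \<ge> 0" "x \<in> states" "continuous_on states f"
  shows "(\<integral>y. (f y :: real) \<partial>P (s + t) x) = (\<integral>z. \<integral>y. f y \<partial>P t z \<partial>P s x)"
proof -
  have "P (s + t) x = P s x \<bind> P t" using P assms by (simp add: feller_semigroup_def)
  then show ?thesis using feller_integral_bind[OF feller_in_prob] assms by simp
qed

lemma feller_integral_0:
  assumes "x \<in> states" "continuous_on states f"
  shows "(\<integral>y. (f y :: real) \<partial>P 0 x) = f x"
proof -
  have "P 0 x = return state_space x" using P assms by (simp add: feller_semigroup_def)
  moreover have "f \<in> borel_measurable state_space"
      unfolding state_space_def by (rule borel_measurable_continuous_on_restrict[OF assms(2)])
  ultimately show ?thesis using assms by (simp add: integral_return)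
qed

text \<open>Under an invariant measure every difference quotient of the semigroup has mean zero, and
  uniform convergence passes this on to the limit.\<close>

lemma invariant_generator_0:
  assumes M: "M \<in> space (prob_algebra state_space)" and inv: "\<And>t. t \<ge> 0 \<Longrightarrow> M \<bind> P t = M"
    and f: "continuous_on states f" and h: "continuous_on states h"
    and lim: "uniform_limit states (\<lambda>t x. ((\<integral>y. f y \<partial>P t x) - f x) / t) h (at_right 0)"
  shows "(\<integral>x. (h x :: real) \<partial>M) = 0"
proof (rule ccontr)
  assume "(\<integral>x. h x \<partial>M) \<noteq> 0"
  define e where "e = \<bar>\<integral>x. h x \<partial>M\<bar> / 2"
  have e: "e > 0" using \<open>(\<integral>x. h x \<partial>M) \<noteq> 0\<close> by (simp add: e_def)
  from uniform_limitD[OF lim e] obtain d where d: "d > 0"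
    "\<And>t. 0 < t \<Longrightarrow> t < d \<Longrightarrow> \<forall>x\<in>states. dist (((\<integral>y. f y \<partial>P t x) - f x) / t) (h x) < e"
    by (auto simp: eventually_at_right_field)
  define t where "t = d / 2"
  have t: "0 < t" "t < d" using d by (auto simp: t_def)
  let ?g = "\<lambda>x. ((\<integral>y. f y \<partial>P t x) - f x) / t"
  have g: "continuous_on states ?g"
    using t f by (intro continuous_intros feller_cont) auto
  have "(\<integral>x. ?g x \<partial>M) = ((\<integral>x. \<integral>y. f y \<partial>P t x \<partial>M) - (\<integral>x. f x \<partial>M)) / t"
    using t f M by (subst Bochner_Integration.integral_divide_zero, subst Bochner_Integration.integral_diff)
      (auto intro!: cont_states_integrable feller_cont)
  also have "\<dots> = 0"
    using feller_integral_bind[OF M _ f, of t] inv[of t] t by simp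
  finally have g0: "(\<integral>x. ?g x \<partial>M) = 0" .
  have "\<bar>\<integral>x. h x - ?g x \<partial>M\<bar> \<le> e"
    using d(2)[OF t] by (intro cont_states_integral_bound[OF M] continuous_intros h g)
      (fastforce simp: dist_real_def abs_minus_commute)
  moreover have "(\<integral>x. h x - ?g x \<partial>M) = (\<integral>x. h x \<partial>M) - (\<integral>x. ?g x \<partial>M)"
    by (intro Bochner_Integration.integral_diff cont_states_integrable[OF M] h g)
  ultimately show False using g0 e t by (simp add: e_def)
qed

text \<open>If \<open>L f = g - c\<close>, then telescoping along the grid \<open>k * h\<close> shows that the averages of
  \<open>P\<close> applied to \<open>g\<close> are close to \<open>c\<close>.\<close>

lemma feller_averages:
  fixes g :: "complex \<times> nat \<Rightarrow> real"
  assumes f: "continuous_on states f" and g: "continuous_on states g"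
    and lim: "uniform_limit states (\<lambda>t x. ((\<integral>y. f y \<partial>P t x) - f x) / t) (\<lambda>x. g x - c) (at_right 0)"
    and x: "x \<in> states" and e: "e > 0"
  obtains d where "d > 0"
    "\<And>h. 0 < h \<Longrightarrow> h < d \<Longrightarrow> \<exists>C. \<forall>n. \<bar>(\<Sum>k<n. \<integral>y. g y \<partial>P (real k * h) x) - real n * c\<bar> \<le> C + real n * e"
proof -
  from uniform_limitD[OF lim e] obtain d where d: "d > 0"
    "\<And>t. 0 < t \<Longrightarrow> t < d \<Longrightarrow> \<forall>x\<in>states. dist (((\<integral>y. f y \<partial>P t x) - f x) / t) (g x - c) < e"
    by (auto simp: eventually_at_right_field)
  obtain B where B: "B > 0" "\<And>y. y \<in> states \<Longrightarrow> \<bar>f y\<bar> \<le> B"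
    using cont_states_bounded[OF f] by blast
  have "\<exists>C. \<forall>n. \<bar>(\<Sum>k<n. \<integral>y. g y \<partial>P (real k * h) x) - real n * c\<bar> \<le> C + real n * e"
    if h: "0 < h" "h < d" for h
  proof -
    define F where "F = (\<lambda>k. \<integral>y. f y \<partial>P (real k * h) x)"
    \<comment> \<open>The error of the difference quotient at step \<open>h\<close>, uniformly at
      most \<open>e\<close>. Integrated against \<open>P (real k * h) x\<close>, the quotient itself
      becomes an increment of \<open>F\<close>, and these telescope.\<close>
    define R where "R = (\<lambda>x. ((\<integral>y. f y \<partial>P h x) - f x) / h - (g x - c))"
    have R: "continuous_on states R"
      unfolding R_def using h f g by (intro continuous_intros feller_cont) auto
    have Rb: "\<bar>\<integral>y. R y \<partial>P (real k * h) x\<bar> \<le> e" for k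
    proof (rule cont_states_integral_bound[OF feller_in_prob R])
      fix y assume "y \<in> states"
      then show "\<bar>R y\<bar> \<le> e" using d(2)[OF h] by (fastforce simp: dist_real_def R_def)
    qed (use h x in auto)
    have step: "(\<integral>y. g y \<partial>P (real k * h) x) - c = (F (Suc k) - F k) / h - (\<integral>y. R y \<partial>P (real k * h) x)" for k
    proof -
      let ?M = "P (real k * h) x"
      have M: "?M \<in> space (prob_algebra state_space)" using h x by (intro feller_in_prob) auto
      interpret prob_space ?M using M by (simp add: space_prob_algebra)
      have I: "integrable ?M g" "integrable ?M f" "integrable ?M (\<lambda>z. \<integral>y. f y \<partial>P h z)"
        using h f g by (auto intro!: cont_states_integrable[OF M] feller_cont)
      have "F (Suc k) = (\<integral>z. \<integral>y. f y \<partial>P h z \<partial>?M)"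
        using feller_integral_add[of "real k * h" h x f] h x f by (simp add: F_def algebra_simps)
      then have "(\<integral>y. R y \<partial>?M) = (F (Suc k) - F k) / h - ((\<integral>y. g y \<partial>?M) - c)"
        unfolding R_def F_def using I prob_space by simp
      then show ?thesis by simp
    qed
    have "\<bar>(\<Sum>k<n. \<integral>y. g y \<partial>P (real k * h) x) - real n * c\<bar> \<le> 2 * B / h + real n * e" for n
    proof -
      have "(\<Sum>k<n. \<integral>y. g y \<partial>P (real k * h) x) - real n * c = (\<Sum>k<n. (\<integral>y. g y \<partial>P (real k * h) x) - c)"
        by (simp add: sum_subtractf)
      also have "\<dots> = (\<Sum>k<n. F (Suc k) - F k) / h - (\<Sum>k<n. \<integral>y. R y \<partial>P (real k * h) x)"
        unfolding step by (simp add: sum_subtractf sum_divide_distrib diff_divide_distrib)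
      also have "(\<Sum>k<n. F (Suc k) - F k) = F n - F 0"
        by (rule sum_lessThan_telescope)
      finally have "\<bar>(\<Sum>k<n. \<integral>y. g y \<partial>P (real k * h) x) - real n * c\<bar>
        \<le> \<bar>F n - F 0\<bar> / h + \<bar>\<Sum>k<n. \<integral>y. R y \<partial>P (real k * h) x\<bar>"
        using h abs_triangle_ineq4[of "(F n - F 0) / h"] by (simp add: abs_divide)
      moreover have "\<bar>\<Sum>k<n. \<integral>y. R y \<partial>P (real k * h) x\<bar> \<le> real n * e"
        using sum_norm_le[of "{..<n}" "\<lambda>k. \<integral>y. R y \<partial>P (real k * h) x" "\<lambda>_. e"] Rb by simp
      moreover have "\<bar>F k\<bar> \<le> B" for k
        unfolding F_def using h x by (intro cont_states_integral_bound[OF feller_in_prob] f B) auto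
      from this[of n] this[of 0] have "\<bar>F n - F 0\<bar> \<le> 2 * B" by linarith
      then have "\<bar>F n - F 0\<bar> / h \<le> 2 * B / h" using h by (intro divide_right_mono) auto
      ultimately show ?thesis by linarith
    qed
    then show ?thesis by blast
  qed
  with d(1) that show ?thesis by blast
qed

text \<open>That \<open>M\<close> annihilates the image of the generator would give invariance only
  with knowledge of a core. Instead, averages along a time grid are compared: for \<open>g\<close>
  they approach its \<open>M\<close>-mean, for its image under \<open>P t\<close> the
  \<open>M\<close>-mean of that image. If \<open>t\<close> is a multiple of the grid step, the
  second sequence is a shift of the first, so both means agree.\<close>

lemma invariant_of_poisson:
  assumes M: "M \<in> space (prob_algebra state_space)"
    and poisson: "\<And>g. continuous_on states g \<Longrightarrow> \<exists>f. continuous_on states f \<and>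
      uniform_limit states (\<lambda>t x. ((\<integral>y. f y \<partial>P t x) - f x) / t) (\<lambda>x. g x - (\<integral>x. (g x :: real) \<partial>M)) (at_right 0)"
    and t: "t \<ge> 0"
  shows "M \<bind> P t = M"
proof (rule prob_measure_eqI_continuous)
  show "\<exists>\<delta> :: complex \<times> nat \<Rightarrow> real. continuous_on UNIV \<delta> \<and> (\<forall>x. \<delta> x \<ge> 0) \<and> C = {x. \<delta> x = 0}"
    if "closed C" for C using closed_zero_set_states[OF that] .
  show "closed states" by (rule compact_imp_closed[OF compact_states])
  have sM: "sets M = sets state_space" using M by (simp add: space_prob_algebra)
  show "M \<in> space (prob_algebra (restrict_space borel states))"
    using M by (simp add: state_space_def)
  have "M \<bind> P t \<in> space (prob_algebra state_space)"
    using prob_space_bind'[OF M feller_measurable[OF t]] sets_bind'[OF M feller_measurable[OF t]]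
    by (simp add: space_prob_algebra)
  then show "M \<bind> P t \<in> space (prob_algebra (restrict_space borel states))"
    by (simp add: state_space_def)
  fix g :: "complex \<times> nat \<Rightarrow> real" assume g: "continuous_on states g"
  let ?g = "\<lambda>x. \<integral>y. g y \<partial>P t x"
  have g': "continuous_on states ?g" using feller_cont[OF t g] .
  let ?x = "(1, 0) :: complex \<times> nat"
  define c where "c = (\<integral>x. g x \<partial>M)"
  define c' where "c' = (\<integral>x. ?g x \<partial>M)"
  have "c' = c"
  proof (cases "t = 0")
    case True
    then show ?thesis unfolding c_def c'_def
      using sets_eq_imp_space_eq[OF sM] by (intro Bochner_Integration.integral_cong) (auto simp: feller_integral_0 g)
  next
    case False
    with t have t: "t > 0" by simp
    show ?thesis
    proof (rule ccontr)
      assume "c' \<noteq> c"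
      define e where "e = \<bar>c' - c\<bar> / 4"
      have e: "e > 0" using \<open>c' \<noteq> c\<close> by (simp add: e_def)
      obtain B where B: "B > 0" "\<And>y. y \<in> states \<Longrightarrow> \<bar>g y\<bar> \<le> B"
        using cont_states_bounded[OF g] by blast
      obtain f where f: "continuous_on states f"
        "uniform_limit states (\<lambda>t x. ((\<integral>y. f y \<partial>P t x) - f x) / t) (\<lambda>x. g x - c) (at_right 0)"
        using poisson[OF g] unfolding c_def by blast
      obtain f' where f': "continuous_on states f'"
        "uniform_limit states (\<lambda>t x. ((\<integral>y. f' y \<partial>P t x) - f' x) / t) (\<lambda>x. ?g x - c') (at_right 0)"
        using poisson[OF g'] unfolding c'_def by blast
      obtain d where d: "d > 0" "\<And>h. 0 < h \<Longrightarrow> h < d \<Longrightarrow>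
          \<exists>C. \<forall>n. \<bar>(\<Sum>k<n. \<integral>y. g y \<partial>P (real k * h) ?x) - real n * c\<bar> \<le> C + real n * e"
        using feller_averages[OF f(1) g f(2) states_nonempty e] by blast
      obtain d' where d': "d' > 0" "\<And>h. 0 < h \<Longrightarrow> h < d' \<Longrightarrow>
          \<exists>C. \<forall>n. \<bar>(\<Sum>k<n. \<integral>y. ?g y \<partial>P (real k * h) ?x) - real n * c'\<bar> \<le> C + real n * e"
        using feller_averages[OF f'(1) g' f'(2) states_nonempty e] by blast
      define D where "D = min d d'"
      have D: "0 < D" "D \<le> d" "D \<le> d'" using d(1) d'(1) by (auto simp: D_def)
      \<comment> \<open>The grid step \<open>t / m\<close> has to lie below both thresholds, so that
        one grid serves \<open>g\<close> and its image, and it has to divide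
        \<open>t\<close>.\<close>
      obtain m :: nat where m: "t / D < real m" using reals_Archimedean2 by blast
      have "0 < t / D" using t D by simp
      with m have m0: "real m > 0" by linarith
      define h where "h = t / real m"
      have "h < D"
        using m m0 D(1) by (simp add: h_def pos_divide_less_eq mult.commute)
      moreover have "0 < h" "real m * h = t" using m0 t by (auto simp: h_def)
      ultimately have h: "0 < h" "h < d" "h < d'" "real m * h = t"
        using D by linarith+
      define a where "a = (\<lambda>k. \<integral>y. g y \<partial>P (real k * h) ?x)"
      have a: "\<bar>a k\<bar> \<le> B" for k
        unfolding a_def using h by (intro cont_states_integral_bound[OF feller_in_prob] g B states_nonempty) auto
      have shift: "(\<integral>y. ?g y \<partial>P (real k * h) ?x) = a (k + m)" for k
        using feller_integral_add[of "real k * h" t ?x g] h t g states_nonempty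
        by (simp add: a_def distrib_right)
      obtain C where C: "\<And>n. \<bar>(\<Sum>k<n. a k) - real n * c\<bar> \<le> C + real n * e"
        using d(2)[OF h(1,2)] unfolding a_def by blast
      obtain C' where C': "\<And>n. \<bar>(\<Sum>k<n. a (k + m)) - real n * c'\<bar> \<le> C' + real n * e"
        using d'(2)[OF h(1,3)] unfolding shift by blast
      \<comment> \<open>Shifting by \<open>m\<close> exchanges only \<open>m\<close> terms at each
        end, a bounded change that averaging removes.\<close>
      have diff: "\<bar>(\<Sum>k<n. a (k + m)) - (\<Sum>k<n. a k)\<bar> \<le> 2 * (real m * B)" for n
      proof -
        have "(\<Sum>k<n. a (k + m)) + (\<Sum>k<m. a k) = (\<Sum>k<n + m. a k)"
          by (induction n) (auto simp: algebra_simps)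
        also have "\<dots> = (\<Sum>k<n. a k) + (\<Sum>k<m. a (k + n))"
          by (induction m) (auto simp: algebra_simps)
        finally have "(\<Sum>k<n. a (k + m)) - (\<Sum>k<n. a k) = (\<Sum>k<m. a (k + n)) - (\<Sum>k<m. a k)"
          by simp
        moreover have "\<bar>\<Sum>k<m. a (k + n)\<bar> \<le> real m * B" "\<bar>\<Sum>k<m. a k\<bar> \<le> real m * B"
          using sum_norm_le[of "{..<m}" "\<lambda>k. a (k + n)" "\<lambda>_. B"] sum_norm_le[of "{..<m}" a "\<lambda>_. B"] a
          by simp_all
        ultimately show ?thesis by linarith
      qed
      \<comment> \<open>The means differ by \<open>4 * e\<close>, while the two approximations allow
        only \<open>2 * e\<close> per step plus a constant; large \<open>n\<close> gives the
        contradiction.\<close>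
      have bound: "real n * (4 * e) \<le> C + C' + 2 * (real m * B) + real n * (2 * e)" for n
      proof -
        have "real n * (4 * e) = \<bar>real n * c' - real n * c\<bar>"
          by (simp add: e_def abs_mult right_diff_distrib[symmetric])
        also have "\<dots> \<le> C + C' + 2 * (real m * B) + real n * (2 * e)"
          using C[of n] C'[of n] diff[of n] by linarith
        finally show ?thesis .
      qed
      obtain n :: nat where "(C + C' + 2 * (real m * B)) / (2 * e) < real n"
        using reals_Archimedean2 by blast
      then have "C + C' + 2 * (real m * B) < real n * (2 * e)"
        using e by (simp add: field_simps)
      with bound[of n] show False by (simp add: algebra_simps)
    qed
  qed
  then show "(\<integral>x. g x \<partial>(M \<bind> P t)) = (\<integral>x. g x \<partial>M)"
    using feller_integral_bind[OF M t g] by (simp add: c_def c'_def)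
qed

end

section \<open>Periodic functions of the angle as functions on the circle\<close>

lemma periodic_cis:
  fixes f :: "real \<Rightarrow> 'a"
  assumes per: "\<And>x. f (x + 2 * pi) = f x" and eq: "cis a = cis b"
  shows "f a = f b"
proof -
  have nat: "f (x + 2 * pi * real n) = f x" for x n
  proof (induction n)
    case (Suc n)
    then show ?case using per[of "x + 2 * pi * real n"] by (simp add: algebra_simps)
  qed simp
  have "sin a = sin b \<and> cos a = cos b" using eq by (simp add: complex_eq_iff)
  then obtain n :: int where n: "a = b + 2 * pi * real_of_int n"
    unfolding sin_cos_eq_iff by (auto simp: mult.commute mult.left_commute)
  show ?thesis
  proof (cases "n \<ge> 0")
    case True
    then show ?thesis using nat[of b "nat n"] n by simp
  next
    case False
    then show ?thesis using nat[of a "nat (- n)"] n by simp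
  qed
qed

lemma cis_Arg_sphere [simp]: "z \<in> sphere 0 1 \<Longrightarrow> cis (Arg z) = z"
  by (subst cis_Arg) (auto simp: sgn_div_norm)

lemma cis_Arg_cis [simp]: "cis (Arg (cis x)) = cis x"
  by (rule cis_Arg_sphere) simp

text \<open>\<open>Arg\<close> jumps on the negative real axis. Near \<open>z0\<close> it is
  replaced by the branch \<open>Arg z0 + Arg (z / z0)\<close>, which is continuous at
  \<open>z0\<close> because \<open>z0 / z0 = 1\<close>; the two have the same \<open>cis\<close>, so
  \<open>F\<close> does not distinguish them.\<close>

lemma continuous_on_lift:
  fixes F :: "'p::topological_space \<Rightarrow> real \<Rightarrow> 'b::topological_space"
  assumes F: "continuous_on UNIV (\<lambda>(t, s). F t s)"
    and per: "\<And>t a b. cis a = cis b \<Longrightarrow> F t a = F t b"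
  shows "continuous_on (UNIV \<times> sphere 0 1) (\<lambda>(t, z). F t (Arg z))"
  unfolding continuous_on_def
proof (intro ballI)
  fix p :: "'p \<times> complex" assume p: "p \<in> UNIV \<times> sphere 0 1"
  obtain t0 z0 where p0: "p = (t0, z0)" "z0 \<in> sphere 0 1" using p by auto
  then have z0: "z0 \<noteq> 0" by auto
  let ?a = "\<lambda>z. Arg z0 + Arg (z / z0)"
  have eq: "F t (?a z) = F t (Arg z)" if "z \<in> sphere 0 1" for t z
  proof (rule per)
    have "z / z0 \<in> sphere 0 1" using that p0 by (simp add: norm_divide)
    then have "cis (?a z) = z"
      using p0 z0 by (simp add: cis_mult[symmetric] del: mem_sphere_0)
    then show "cis (?a z) = cis (Arg z)" using that by (simp del: mem_sphere_0)
  qed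
  have "isCont Arg (z0 / z0)" using z0 by (intro continuous_at_Arg) simp
  moreover have "isCont (\<lambda>z. z / z0) z0" using z0 by (intro continuous_intros) auto
  ultimately have "isCont (\<lambda>z. Arg (z / z0)) z0"
    using isCont_o2[of z0 "\<lambda>z. z / z0" Arg] by blast
  moreover have "(snd \<longlongrightarrow> z0) (at p within UNIV \<times> sphere 0 1)"
    using tendsto_snd[OF tendsto_ident_at, of p] by (simp add: p0)
  ultimately have "((\<lambda>q. Arg (snd q / z0)) \<longlongrightarrow> Arg (snd p / z0)) (at p within UNIV \<times> sphere 0 1)"
    unfolding p0(1) snd_conv by (rule isCont_tendsto_compose[where g="\<lambda>z. Arg (z / z0)"])
  then have tp: "((\<lambda>q. (fst q, ?a (snd q))) \<longlongrightarrow> (fst p, ?a (snd p))) (at p within UNIV \<times> sphere 0 1)"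
    by (intro tendsto_Pair tendsto_fst tendsto_ident_at tendsto_add tendsto_const)
  have "((\<lambda>q. F (fst q) (?a (snd q))) \<longlongrightarrow> F (fst p) (?a (snd p))) (at p within UNIV \<times> sphere 0 1)"
    using continuous_on_tendsto_compose[OF F tp] by simp
  then have "((\<lambda>q. F (fst q) (?a (snd q))) \<longlongrightarrow> F (fst p) (Arg (snd p))) (at p within UNIV \<times> sphere 0 1)"
    using eq[of "snd p"] p0 by simp
  moreover have "\<forall>\<^sub>F q in at p within UNIV \<times> sphere 0 1. F (fst q) (?a (snd q)) = F (fst q) (Arg (snd q))"
    unfolding eventually_at_filter by (intro always_eventually allI impI eq) (auto simp: mem_Times_iff)
  ultimately have "((\<lambda>q. F (fst q) (Arg (snd q))) \<longlongrightarrow> F (fst p) (Arg (snd p))) (at p within UNIV \<times> sphere 0 1)"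
    by (rule Lim_transform_eventually)
  then show "((\<lambda>(t, z). F t (Arg z)) \<longlongrightarrow> (case p of (t, z) \<Rightarrow> F t (Arg z))) (at p within UNIV \<times> sphere 0 1)"
    by (simp add: case_prod_unfold)
qed

lemma continuous_on_times_states:
  fixes f :: "'p::topological_space \<times> complex \<times> nat \<Rightarrow> 'b::topological_space"
  assumes "\<And>i. i \<in> {0, 1} \<Longrightarrow> continuous_on (UNIV \<times> sphere 0 1) (\<lambda>(t, z). f (t, z, i))"
  shows "continuous_on (UNIV \<times> states) f"
proof (rule continuous_on_discrete_fibres[where q="\<lambda>p. snd (snd p)"])
  fix i
  show "continuous_on {x \<in> UNIV \<times> states. snd (snd x) = i} f"
  proof (cases "i \<in> {0, 1}")
    case True
    have "continuous_on {x \<in> UNIV \<times> states. snd (snd x) = i} (\<lambda>x. (\<lambda>(t, z). f (t, z, i)) (fst x, fst (snd x)))"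
      by (rule continuous_on_compose2[OF assms[OF True]]) (auto intro!: continuous_intros simp: states_def)
    then show ?thesis
      by (rule continuous_on_cong[THEN iffD1, rotated 2]) (auto simp: split_beta)
  next
    case False
    then have "{x \<in> (UNIV :: 'p set) \<times> states. snd (snd x) = i} = {}" by (auto simp: states_def)
    then show ?thesis by (simp only: continuous_on_empty)
  qed
qed (auto intro!: continuous_intros)

lemma continuous_on_states:
  fixes f :: "complex \<times> nat \<Rightarrow> 'b::topological_space"
  assumes cont: "\<And>i. i \<in> {0, 1} \<Longrightarrow> continuous_on UNIV (F i)"
    and per: "\<And>i a b. i \<in> {0, 1} \<Longrightarrow> cis a = cis b \<Longrightarrow> F i a = F i b"
    and f: "\<And>z i. z \<in> sphere 0 1 \<Longrightarrow> i \<in> {0, 1} \<Longrightarrow> f (z, i) = F i (Arg z)"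
  shows "continuous_on states f"
proof -
  \<comment> \<open>A dummy real parameter allows the reuse of the version with parameters.\<close>
  have "continuous_on (UNIV \<times> states) (\<lambda>p :: real \<times> complex \<times> nat. f (snd p))"
  proof (rule continuous_on_times_states)
    fix i :: nat assume i: "i \<in> {0, 1}"
    have "continuous_on (UNIV \<times> sphere 0 1) (\<lambda>(t :: real, z). F i (Arg z))"
      by (rule continuous_on_lift[OF _ per[OF i]])
        (auto simp: split_beta intro!: continuous_on_compose2[OF cont[OF i]] continuous_intros)
    then show "continuous_on (UNIV \<times> sphere 0 1) (\<lambda>(t :: real, z). f (snd (t, z, i)))"
      by (rule continuous_on_cong[THEN iffD1, rotated 2]) (use i f in auto)
  qed
  then have "continuous_on states (\<lambda>x. (\<lambda>p :: real \<times> complex \<times> nat. f (snd p)) (0, x))"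
    by (rule continuous_on_compose2) (auto intro!: continuous_intros)
  then show ?thesis by simp
qed

lemma ang_speed_eq:
  "ang_speed A i \<theta> = (A i $ 2 $ 1 * cos \<theta> + A i $ 2 $ 2 * sin \<theta>) * cos \<theta>
    - (A i $ 1 $ 1 * cos \<theta> + A i $ 1 $ 2 * sin \<theta>) * sin \<theta>"
  by (simp add: ang_speed_def e_vec_def inner_vec_def matrix_vector_mult_def sum_2 vector_2 cos_add sin_add)

lemma ang_speed_cis: "cis a = cis b \<Longrightarrow> ang_speed A i a = ang_speed A i b"
  by (auto simp: ang_speed_eq complex_eq_iff)

lemma C1_fun_deriv:
  assumes f: "C1_fun f" and i: "i \<in> {0, 1}"
  shows "((\<lambda>s. f (cis s, i)) has_real_derivative deriv (\<lambda>s. f (cis s, i)) x) (at x)"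
  using f i unfolding C1_fun_def
  by (metis DERIV_deriv_iff_real_differentiable)

lemma C1_fun_deriv_cis:
  assumes f: "C1_fun f" and i: "i \<in> {0, 1}" and "cis a = cis b"
  shows "deriv (\<lambda>s. f (cis s, i)) a = deriv (\<lambda>s. f (cis s, i)) b"
proof (rule periodic_cis[OF _ assms(3)])
  fix x
  have "((\<lambda>s. f (cis (s + 2 * pi), i)) has_real_derivative deriv (\<lambda>s. f (cis s, i)) (x + 2 * pi)) (at x)"
    using C1_fun_deriv[OF f i, of "x + 2 * pi"] by (subst (asm) DERIV_shift)
  moreover have "cis (s + 2 * pi) = cis s" for s by (simp add: complex_eq_iff)
  ultimately show "deriv (\<lambda>s. f (cis s, i)) (x + 2 * pi) = deriv (\<lambda>s. f (cis s, i)) x"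
    by (simp add: DERIV_imp_deriv)
qed

lemma C1_fun_cont:
  assumes f: "C1_fun f"
  shows "continuous_on states f"
proof (rule continuous_on_states[where F="\<lambda>i s. f (cis s, i)"])
  show "continuous_on UNIV (\<lambda>s. f (cis s, i))" if "i \<in> {0, 1}" for i
    using C1_fun_deriv[OF f that] by (intro continuous_at_imp_continuous_on) (auto intro: DERIV_isCont)
qed (simp_all del: mem_sphere_0)

text \<open>The transport part of the generator, in the role of \<open>G\<close> in
  \<open>generator_P\<close>.\<close>

definition drift :: "(nat \<Rightarrow> real^2^2) \<Rightarrow> (complex \<times> nat \<Rightarrow> real) \<Rightarrow> complex \<times> nat \<Rightarrow> real" where
  "drift A f = (\<lambda>(z, i). ang_speed A i (Arg z) * deriv (\<lambda>s. f (cis s, i)) (Arg z))"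

lemma drift_cont:
  assumes f: "C1_fun f"
  shows "continuous_on states (drift A f)"
proof (rule continuous_on_states[where F="\<lambda>i s. ang_speed A i s * deriv (\<lambda>s. f (cis s, i)) s"])
  show "continuous_on UNIV (\<lambda>s. ang_speed A i s * deriv (\<lambda>s. f (cis s, i)) s)" if "i \<in> {0, 1}" for i
    using f that unfolding C1_fun_def ang_speed_eq by (intro continuous_intros) auto
  show "ang_speed A i a * deriv (\<lambda>s. f (cis s, i)) a = ang_speed A i b * deriv (\<lambda>s. f (cis s, i)) b"
    if "i \<in> {0, 1}" "cis a = cis b" for i a b
    using ang_speed_cis[OF that(2)] C1_fun_deriv_cis[OF f that] by simp
qed (simp add: drift_def)

lemma swap_cont: "continuous_on states (\<lambda>(z, i). (z, 1 - i))"
  by (rule continuous_on_states[where F="\<lambda>i s. (cis s, 1 - i)"])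
    (auto intro!: continuous_intros simp del: mem_sphere_0)

lemma swap_states: "(case x of (z, i) \<Rightarrow> (z, 1 - i)) \<in> states" if "x \<in> states"
  using that by (auto simp: states_def)

lemma ang_generator_eq:
  "ang_generator A \<beta> f = (\<lambda>x. drift A f x + \<beta> / 2 * (f (case x of (z, i) \<Rightarrow> (z, 1 - i)) - f x))"
  by (auto simp: ang_generator_def drift_def)

lemma ang_generator_cont:
  assumes f: "C1_fun f"
  shows "continuous_on states (ang_generator A \<beta> f)"
proof -
  have "continuous_on states (\<lambda>x. f (case x of (z, i) \<Rightarrow> (z, 1 - i)))"
    using swap_states by (intro continuous_on_compose2[OF C1_fun_cont[OF f] swap_cont]) auto
  then show ?thesis
    unfolding ang_generator_eq by (intro continuous_on_add continuous_on_mult continuous_on_const continuous_on_diff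
        drift_cont[OF f] C1_fun_cont[OF f])
qed

text \<open>Solvability of the Poisson equation for a single candidate \<open>M\<close> gives both existence and
  uniqueness of the invariant measure.\<close>

lemma invariant_measure_eqI:
  assumes sg: "\<exists>P. angular_semigroup A \<beta> P"
    and M: "M \<in> space (prob_algebra state_space)"
    and poisson: "\<And>g. continuous_on states g \<Longrightarrow>
      \<exists>f. C1_fun f \<and> (\<forall>x\<in>states. ang_generator A \<beta> f x = g x - (\<integral>x. g x \<partial>M))"
  shows "invariant_measure A \<beta> = M"
  unfolding invariant_measure_def
proof (rule the_equality)
  show "angular_invariant A \<beta> M"
  proof -
    obtain P where P: "angular_semigroup A \<beta> P" using sg by blast
    then have feller: "feller_semigroup P" by (simp add: angular_semigroup_def)
    have "M \<bind> P t = M" if "t \<ge> 0" for t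
    proof (rule invariant_of_poisson[OF feller M _ that])
      fix g :: "complex \<times> nat \<Rightarrow> real" assume "continuous_on states g"
      from poisson[OF this] obtain f where f: "C1_fun f"
        "\<And>x. x \<in> states \<Longrightarrow> ang_generator A \<beta> f x = g x - (\<integral>x. g x \<partial>M)" by blast
      have "uniform_limit states (\<lambda>t x. ((\<integral>y. f y \<partial>P t x) - f x) / t) (ang_generator A \<beta> f) (at_right 0)"
        using P f(1) by (simp add: angular_semigroup_def)
      then have "uniform_limit states (\<lambda>t x. ((\<integral>y. f y \<partial>P t x) - f x) / t) (\<lambda>x. g x - (\<integral>x. g x \<partial>M)) (at_right 0)"
        by (rule uniform_limit_cong'[THEN iffD1, rotated 2]) (auto simp: f)
      with C1_fun_cont[OF f(1)] show "\<exists>f. continuous_on states f \<and>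
        uniform_limit states (\<lambda>t x. ((\<integral>y. f y \<partial>P t x) - f x) / t) (\<lambda>x. g x - (\<integral>x. g x \<partial>M)) (at_right 0)"
        by blast
    qed
    then show ?thesis using P M by (auto simp: angular_invariant_def)
  qed
next
  fix N assume N: "angular_invariant A \<beta> N"
  then obtain P where P: "angular_semigroup A \<beta> P" "\<And>t. t \<ge> 0 \<Longrightarrow> N \<bind> P t = N"
    and Np: "N \<in> space (prob_algebra state_space)"
    by (auto simp: angular_invariant_def)
  have feller: "feller_semigroup P" using P by (simp add: angular_semigroup_def)
  show "N = M"
  proof (rule prob_measure_eqI_continuous[OF closed_zero_set_states])
    show "closed states" by (rule compact_imp_closed[OF compact_states])
    show "N \<in> space (prob_algebra (restrict_space borel states))" using Np by (simp add: state_space_def)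
    show "M \<in> space (prob_algebra (restrict_space borel states))" using M by (simp add: state_space_def)
    fix g :: "complex \<times> nat \<Rightarrow> real" assume g: "continuous_on states g"
    from poisson[OF this] obtain f where f: "C1_fun f"
      "\<And>x. x \<in> states \<Longrightarrow> ang_generator A \<beta> f x = g x - (\<integral>x. g x \<partial>M)" by blast
    interpret prob_space N using Np by (simp add: space_prob_algebra)
    have sp: "space N = states"
      using Np sets_eq_imp_space_eq[of N state_space] by (simp add: space_prob_algebra)
    \<comment> \<open>Integrating the Poisson equation against \<open>N\<close> identifies its mean
      of \<open>g\<close> with that of \<open>M\<close>. Only the action on C1 functions is used, so
      \<open>N\<close> may be invariant under a different semigroup from the one used for
      \<open>M\<close>.\<close>
    have "(\<integral>x. ang_generator A \<beta> f x \<partial>N) = 0"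
      using P f(1) by (intro invariant_generator_0[OF feller Np P(2) C1_fun_cont[OF f(1)] ang_generator_cont[OF f(1)]])
        (auto simp: angular_semigroup_def)
    also have "(\<integral>x. ang_generator A \<beta> f x \<partial>N) = (\<integral>x. g x - (\<integral>x. g x \<partial>M) \<partial>N)"
      by (intro Bochner_Integration.integral_cong) (simp_all add: sp f)
    also have "\<dots> = (\<integral>x. g x \<partial>N) - (\<integral>x. g x \<partial>M)"
      using cont_states_integrable[OF Np g] prob_space by simp
    finally show "(\<integral>x. g x \<partial>N) = (\<integral>x. g x \<partial>M)" by simp
  qed
qed

section \<open>Flows on the circle\<close>

text \<open>\<open>\<tau>\<close> measures time along the flow, which it conjugates to a translation.\<close>

lemma angle_flow_exists:
  fixes d \<tau> :: "real \<Rightarrow> real"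
  assumes deriv: "\<And>x. (\<tau> has_real_derivative 1 / d x) (at x)" and d: "\<And>x. d x \<noteq> 0"
    and bij: "bij \<tau>" and per: "\<And>x. \<tau> (x + 2 * pi) = \<tau> x + p"
  obtains \<Phi> where "\<And>x. \<Phi> 0 x = x" "\<And>s t x. \<Phi> (s + t) x = \<Phi> t (\<Phi> s x)"
    "continuous_on UNIV (\<lambda>(t, x). \<Phi> t x)"
    "\<And>t x. ((\<lambda>t. \<Phi> t x) has_real_derivative d (\<Phi> t x)) (at t)"
    "\<And>t x. \<Phi> t (x + 2 * pi) = \<Phi> t x + 2 * pi"
proof -
  define g where "g = inv \<tau>"
  have g1 [simp]: "g (\<tau> x) = x" for x unfolding g_def using bij by (simp add: bij_is_inj)
  have g2 [simp]: "\<tau> (g y) = y" for y unfolding g_def using bij by (simp add: bij_is_surj surj_f_inv_f)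
  have cont_\<tau>: "isCont \<tau> x" for x using deriv by (rule DERIV_isCont)
  have cont_g: "isCont g y" for y
    using isCont_inverse_function[of 1 "g y" g \<tau>] cont_\<tau> by simp
  have deriv_g: "(g has_real_derivative d (g y)) (at y)" for y
  proof -
    have "(g has_real_derivative inverse (1 / d (g y))) (at y)"
      by (rule DERIV_inverse_function[where f=\<tau> and a="y - 1" and b="y + 1"])
        (use deriv d cont_g in auto)
    then show ?thesis by simp
  qed
  define \<Phi> where "\<Phi> = (\<lambda>t x. g (\<tau> x + t))"
  have cg: "continuous_on UNIV g" and c\<tau>: "continuous_on UNIV \<tau>"
    using cont_g cont_\<tau> by (auto intro: continuous_at_imp_continuous_on)
  have "continuous_on UNIV (\<lambda>p :: real \<times> real. \<tau> (snd p))"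
    by (rule continuous_on_compose2[OF c\<tau> continuous_on_snd[OF continuous_on_id]]) simp
  then have "continuous_on UNIV (\<lambda>p :: real \<times> real. \<tau> (snd p) + fst p)"
    by (intro continuous_on_add continuous_on_fst continuous_on_id)
  then have "continuous_on UNIV (\<lambda>p :: real \<times> real. g (\<tau> (snd p) + fst p))"
    by (rule continuous_on_compose2[OF cg]) simp
  then have "continuous_on UNIV (\<lambda>(t, x). \<Phi> t x)"
    by (simp add: \<Phi>_def case_prod_unfold)
  moreover have "((\<lambda>t. \<Phi> t x) has_real_derivative d (\<Phi> t x)) (at t)" for t x
    unfolding \<Phi>_def by (rule DERIV_cong[OF DERIV_chain2[OF deriv_g]]) (auto intro!: derivative_eq_intros)
  moreover have "\<Phi> t (x + 2 * pi) = \<Phi> t x + 2 * pi" for t x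
  proof -
    have "\<tau> (\<Phi> t x + 2 * pi) = \<tau> (x + 2 * pi) + t" by (simp add: per \<Phi>_def)
    then show ?thesis by (metis \<Phi>_def g1)
  qed
  ultimately show ?thesis
    using that[of \<Phi>] by (simp add: \<Phi>_def add_ac)
qed

text \<open>Without equilibria each angular flow has a global time coordinate \<tau>. The resulting
  flow on the line commutes with the shift by \<open>2 * pi\<close>, hence descends to the circle,
  and the Dyson series applies with jump rate \<open>\<beta> / 2\<close>.\<close>

lemma angular_semigroup_exists:
  assumes \<beta>: "\<beta> > 0"
    and flow: "\<And>i. i \<in> {0, 1} \<Longrightarrow> \<exists>\<tau> p. (\<forall>x. (\<tau> has_real_derivative 1 / ang_speed A i x) (at x)) \<and>
      (\<forall>x. ang_speed A i x \<noteq> 0) \<and> bij \<tau> \<and> (\<forall>x. \<tau> (x + 2 * pi) = \<tau> x + p)"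
  shows "\<exists>P. angular_semigroup A \<beta> P"
proof -
  define Q where "Q = (\<lambda>i \<Phi>. (\<forall>x. \<Phi> 0 x = x) \<and> (\<forall>s t x. \<Phi> (s + t) x = \<Phi> t (\<Phi> s x)) \<and>
      continuous_on UNIV (\<lambda>(t, x). \<Phi> t x) \<and>
      (\<forall>t x. ((\<lambda>t. \<Phi> t x) has_real_derivative ang_speed A i (\<Phi> t x)) (at t)) \<and>
      (\<forall>t x. \<Phi> t (x + 2 * pi) = \<Phi> t x + 2 * pi))"
  have "\<forall>i\<in>{0, 1}. \<exists>\<Phi>. Q i \<Phi>"
  proof
    fix i :: nat assume "i \<in> {0, 1}"
    from flow[OF this] obtain \<tau> p where \<tau>: "\<And>x. (\<tau> has_real_derivative 1 / ang_speed A i x) (at x)"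
      "\<And>x. ang_speed A i x \<noteq> 0" "bij \<tau>" "\<And>x. \<tau> (x + 2 * pi) = \<tau> x + p" by blast
    show "\<exists>\<Phi>. Q i \<Phi>"
    proof (rule angle_flow_exists[OF \<tau>])
      fix \<Phi>
      assume a: "\<And>x. \<Phi> 0 x = x" "\<And>s t x. \<Phi> (s + t) x = \<Phi> t (\<Phi> s x)"
        "continuous_on UNIV (\<lambda>(t, x). \<Phi> t x)"
        "\<And>t x. ((\<lambda>t. \<Phi> t x) has_real_derivative ang_speed A i (\<Phi> t x)) (at t)"
        "\<And>t x. \<Phi> t (x + 2 * pi) = \<Phi> t x + 2 * pi"
      show ?thesis
        unfolding Q_def by (intro exI[of _ \<Phi>] conjI allI) (fact a)+
    qed
  qed
  from bchoice[OF this] obtain \<Phi> where \<Phi>: "\<forall>i\<in>{0, 1}. Q i (\<Phi> i)" by blast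
  have \<Phi>0: "\<Phi> i 0 x = x"
    and \<Phi>_add: "\<Phi> i (s + t) x = \<Phi> i t (\<Phi> i s x)"
    and \<Phi>_cont: "continuous_on UNIV (\<lambda>(t, x). \<Phi> i t x)"
    and \<Phi>_deriv: "((\<lambda>t. \<Phi> i t x) has_real_derivative ang_speed A i (\<Phi> i t x)) (at t)"
    and \<Phi>_per: "\<Phi> i t (x + 2 * pi) = \<Phi> i t x + 2 * pi"
    if "i \<in> {0, 1}" for i s t x
    using \<Phi>[rule_format, OF that] unfolding Q_def by blast+
  have \<Phi>_cis: "cis (\<Phi> i t a) = cis (\<Phi> i t b)" if "i \<in> {0, 1}" "cis a = cis b" for i t a b
  proof (rule periodic_cis[OF _ that(2)])
    show "cis (\<Phi> i t (x + 2 * pi)) = cis (\<Phi> i t x)" for x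
      unfolding \<Phi>_per[OF that(1)] by (simp add: complex_eq_iff)
  qed
  define flow where "flow = (\<lambda>t (z, i). (cis (\<Phi> i t (Arg z)), i :: nat))"
  define J :: "complex \<times> nat \<Rightarrow> complex \<times> nat" where "J = (\<lambda>(z, i). (z, 1 - i))"
  interpret switched_flow states flow J "\<beta> / 2"
  proof
    show "compact states" by (rule compact_states)
    show "states \<noteq> {}" using states_nonempty by blast
    show "continuous_on (UNIV \<times> states) (\<lambda>(t, x). flow t x)"
    proof (rule continuous_on_times_states)
      fix i :: nat assume i: "i \<in> {0, 1}"
      have "continuous_on (UNIV \<times> sphere 0 1) (\<lambda>(t, z). (cis (\<Phi> i t (Arg z)), i))"
      proof (rule continuous_on_lift)
        have "continuous_on UNIV (\<lambda>p. (cis (case p of (t, s) \<Rightarrow> \<Phi> i t s), i))"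
          by (intro continuous_intros \<Phi>_cont i)
        then show "continuous_on UNIV (\<lambda>(t, s). (cis (\<Phi> i t s), i))" by (simp add: case_prod_unfold)
        show "(cis (\<Phi> i t a), i) = (cis (\<Phi> i t b), i)" if "cis a = cis b" for t a b
          using \<Phi>_cis[OF i that] by simp
      qed
      then show "continuous_on (UNIV \<times> sphere 0 1) (\<lambda>(t, z). case (t, z, i) of (t, x) \<Rightarrow> flow t x)"
        by (simp add: flow_def)
    qed
    show "continuous_on states J" unfolding J_def by (rule swap_cont)
    show "\<beta> / 2 > 0" using \<beta> by simp
    fix x :: "complex \<times> nat" assume x: "x \<in> states"
    then obtain z i where xi: "x = (z, i)" "z \<in> sphere 0 1" "i \<in> {0, 1}" by (auto simp: states_def)
    show "flow t x \<in> states" for t using xi by (auto simp: flow_def states_def)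
    show "J x \<in> states" using x by (auto simp: J_def states_def)
    show "flow 0 x = x" using xi by (simp add: flow_def \<Phi>0 del: mem_sphere_0 insert_iff)
    show "flow (s + t) x = flow t (flow s x)" for s t
      using \<Phi>_cis[OF xi(3), of "Arg (cis (\<Phi> i s (Arg z)))" "\<Phi> i s (Arg z)" t] xi
      by (simp add: flow_def \<Phi>_add del: mem_sphere_0 insert_iff)
  qed
  have M: "restrict_space borel states = state_space" by (simp add: state_space_def)
  have "feller_semigroup P"
    unfolding feller_semigroup_def
  proof (intro conjI allI impI ballI)
    show "P t \<in> state_space \<rightarrow>\<^sub>M prob_algebra state_space" if "t \<ge> 0" for t
      using measurable_P[OF that] by (simp add: M)
    show "P 0 x = return state_space x" if "x \<in> states" for x
      using P_0[OF that] by (simp add: M)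
  qed (simp_all add: P_add P_feller feller_P)
  moreover have "uniform_limit states (\<lambda>t x. ((\<integral>y. f y \<partial>P t x) - f x) / t) (ang_generator A \<beta> f) (at_right 0)"
    if f: "C1_fun f" for f
  proof -
    have "((\<lambda>t. f (flow t x)) has_real_derivative drift A f (flow t x)) (at t)" if x: "x \<in> states" for x t
    proof -
      obtain z i where xi: "x = (z, i)" "i \<in> {0, 1}" using x by (auto simp: states_def)
      have "((\<lambda>t. f (cis (\<Phi> i t (Arg z)), i)) has_real_derivative
          deriv (\<lambda>s. f (cis s, i)) (\<Phi> i t (Arg z)) * ang_speed A i (\<Phi> i t (Arg z))) (at t)"
        by (rule DERIV_chain2[OF C1_fun_deriv[OF f xi(2)] \<Phi>_deriv[OF xi(2)]])
      moreover have "drift A f (flow t x) = deriv (\<lambda>s. f (cis s, i)) (\<Phi> i t (Arg z)) * ang_speed A i (\<Phi> i t (Arg z))"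
        using C1_fun_deriv_cis[OF f xi(2) cis_Arg_cis] ang_speed_cis[OF cis_Arg_cis]
        by (simp add: drift_def flow_def xi)
      ultimately show ?thesis by (simp add: flow_def xi(1))
    qed
    from generator_P[OF C1_fun_cont[OF f] drift_cont[OF f] this] show ?thesis
      unfolding ang_generator_eq J_def .
  qed
  ultimately show ?thesis by (auto simp: angular_semigroup_def)
qed

section \<open>An explicit time coordinate for elliptic rotations\<close>

lemma bij_bounded_displacement:
  fixes R :: "real \<Rightarrow> real"
  assumes deriv: "\<And>x. (R has_real_derivative R' x) (at x)" and pos: "\<And>x. R' x > 0"
    and near: "\<And>x. \<bar>R x - x\<bar> \<le> c"
  shows "bij R"
proof (rule bijI)
  show "inj R"
  proof (rule linorder_injI)
    fix x y :: real assume "x < y"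
    then have "R x < R y" by (rule DERIV_pos_imp_increasing) (use deriv pos in blast)
    then show "R x \<noteq> R y" by simp
  qed
  show "surj R"
  proof (unfold surj_def, rule allI)
    fix y
    have "R (y - c) \<le> y" "y \<le> R (y + c)" "y - c \<le> y + c"
      using near[of "y - c"] near[of "y + c"] by (auto simp: abs_le_iff)
    then obtain x where "R x = y"
      using IVT[of R "y - c" y "y + c"] DERIV_isCont[OF deriv] by blast
    then show "\<exists>x. y = R x" by blast
  qed
qed

text \<open>\<open>tan_scale b\<close> is the continuous branch of \<open>\<lambda>x. arctan (b * tan x)\<close> that fixes \<open>0\<close>.\<close>

definition tan_scale :: "real \<Rightarrow> real \<Rightarrow> real" where
  "tan_scale b x = x + arctan ((b - 1) * sin x * cos x / ((cos x)\<^sup>2 + b * (sin x)\<^sup>2))"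

lemma trig_form_pos:
  fixes p q x :: real
  assumes "p > 0" "q > 0"
  shows "p * (cos x)\<^sup>2 + q * (sin x)\<^sup>2 > 0"
proof (cases "cos x = 0")
  case True
  then have "(sin x)\<^sup>2 = 1" using sin_cos_squared_add[of x] by simp
  then show ?thesis using True assms by simp
next
  case False
  then show ?thesis using assms by (intro add_pos_nonneg) auto
qed

text \<open>If \<open>tan y = b * tan x\<close>, the subtraction formula for
  \<open>tan (y - x)\<close> gives the fraction under \<open>arctan\<close> in
  \<open>tan_scale\<close>. Its denominator is positive everywhere, so no branch has to be chosen,
  and the derivative is the usual one of \<open>arctan (b * tan x)\<close>.\<close>

lemma tan_scale_deriv:
  assumes b: "b > 0"
  shows "(tan_scale b has_real_derivative b / ((cos x)\<^sup>2 + b\<^sup>2 * (sin x)\<^sup>2)) (at x)"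
proof -
  let ?c = "cos x" and ?s = "sin x"
  let ?N = "(b - 1) * ?s * ?c" and ?D = "?c\<^sup>2 + b * ?s\<^sup>2"
  let ?N' = "(b - 1) * (?c * ?c - ?s * ?s)" and ?E = "?c\<^sup>2 + b\<^sup>2 * ?s\<^sup>2"
  have D: "?D > 0" using trig_form_pos[of 1 b x] b by simp
  have E: "?E > 0" using trig_form_pos[of 1 "b\<^sup>2" x] b by simp
  have s2: "?s\<^sup>2 = 1 - ?c\<^sup>2" by (rule sin_squared_eq)
  have dN: "((\<lambda>x. (b - 1) * sin x * cos x) has_real_derivative ?N') (at x)"
    by (auto intro!: derivative_eq_intros simp: algebra_simps)
  have dD: "((\<lambda>x. (cos x)\<^sup>2 + b * (sin x)\<^sup>2) has_real_derivative 2 * ?N) (at x)"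
    by (auto intro!: derivative_eq_intros simp: algebra_simps)
  have "(tan_scale b has_real_derivative
      1 + (?N' * ?D - ?N * (2 * ?N)) / (?D * ?D) / (1 + (?N / ?D)\<^sup>2)) (at x)"
    unfolding tan_scale_def
    by (rule DERIV_cong[OF DERIV_add[OF DERIV_ident DERIV_chain2[OF DERIV_arctan DERIV_divide[OF dN dD]]]])
      (use D in \<open>simp_all add: divide_simps\<close>)
  moreover have "1 + (?N' * ?D - ?N * (2 * ?N)) / (?D * ?D) / (1 + (?N / ?D)\<^sup>2) = b / ?E"
  proof -
    \<comment> \<open>The quotient rule and the derivative of \<open>arctan\<close> leave exactly
      this sum of squares as denominator; it factors through
      \<open>(cos x)\<^sup>2 + (sin x)\<^sup>2 = 1\<close>.\<close>
    have DN: "?D\<^sup>2 + ?N\<^sup>2 = ?E"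
      unfolding power_mult_distrib s2 by (simp add: power2_eq_square algebra_simps)
    have num: "?D\<^sup>2 + ?N' * ?D - ?N\<^sup>2 = b"
      unfolding power_mult_distrib power2_eq_square[symmetric] s2 by (simp add: power2_eq_square algebra_simps)
    have "1 + (?N / ?D)\<^sup>2 = ?E / (?D * ?D)"
    proof -
      have "1 + (n / d)\<^sup>2 = (d\<^sup>2 + n\<^sup>2) / (d * d)" if "d > 0" for n d :: real
        using that by (simp add: field_simps power2_eq_square)
      from this[OF D, of ?N] show ?thesis unfolding DN .
    qed
    then have "1 + (?N' * ?D - ?N * (2 * ?N)) / (?D * ?D) / (1 + (?N / ?D)\<^sup>2) = 1 + (?N' * ?D - ?N * (2 * ?N)) / ?E"
      using D by simp
    also have "\<dots> = (?E + (?N' * ?D - ?N * (2 * ?N))) / ?E"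
      using E by (simp add: add_divide_distrib)
    also have "?E + (?N' * ?D - ?N * (2 * ?N)) = b"
    proof -
      have "(d\<^sup>2 + n\<^sup>2) + (k * d - n * (2 * n)) = d\<^sup>2 + k * d - n\<^sup>2" for d n k :: real
        by (simp add: power2_eq_square)
      from this[of ?D ?N ?N'] show ?thesis unfolding DN num .
    qed
    finally show ?thesis .
  qed
  ultimately show ?thesis by simp
qed

lemma tan_scale_period: "tan_scale b (x + 2 * pi) = tan_scale b x + 2 * pi"
  by (simp add: tan_scale_def)

lemma bij_tan_scale:
  assumes b: "b > 0"
  shows "bij (tan_scale b)"
proof (rule bij_bounded_displacement[OF tan_scale_deriv[OF b], of "pi / 2"])
  show "b / ((cos x)\<^sup>2 + b\<^sup>2 * (sin x)\<^sup>2) > 0" for x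
    using b trig_form_pos[of 1 "b\<^sup>2" x] by simp
  show "\<bar>tan_scale b x - x\<bar> \<le> pi / 2" for x
    using arctan_bounded[of "(b - 1) * sin x * cos x / ((cos x)\<^sup>2 + b * (sin x)\<^sup>2)"]
    unfolding tan_scale_def abs_le_iff by linarith
qed

lemma bij_tan_scale_cmult:
  assumes "b > 0" "c \<noteq> 0"
  shows "bij (\<lambda>x. c * tan_scale b x)"
proof -
  have "bij (\<lambda>x. c * x)"
    using assms by (intro o_bij[where g="\<lambda>x. x / c"]) auto
  then show ?thesis
    using bij_comp[OF bij_tan_scale[OF assms(1)]] by (simp add: o_def)
qed

section \<open>The Poisson equation\<close>

lemma integrable_continuous_UNIV:
  fixes f :: "real \<Rightarrow> real"
  shows "continuous_on UNIV f \<Longrightarrow> f integrable_on {a..b}"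
  by (intro integrable_continuous_interval) (rule continuous_on_subset[OF _ subset_UNIV])

lemma integral_pos_continuous:
  fixes f :: "real \<Rightarrow> real"
  assumes f: "continuous_on {a..b} f" and ab: "a < b" and nonneg: "\<And>x. x \<in> {a..b} \<Longrightarrow> f x \<ge> 0"
    and x: "x \<in> {a..b}" "f x > 0"
  shows "integral {a..b} f > 0"
proof -
  have "integral {a..b} f \<noteq> 0"
    using integral_eq_0_iff[OF f ab nonneg] x by force
  moreover have "integral {a..b} f \<ge> 0"
    using nonneg by (intro integral_nonneg integrable_continuous_interval f)
  ultimately show ?thesis by simp
qed

lemma periodic_antiderivative:
  fixes k :: "real \<Rightarrow> real"
  assumes k: "continuous_on UNIV k" and per: "\<And>x. k (x + 2 * pi) = k x"
    and int: "integral {- pi..pi} k = 0"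
  obtains F where "\<And>x. (F has_real_derivative k x) (at x)" "\<And>x. F (x + 2 * pi) = F x"
proof -
  have "\<exists>F. \<forall>x :: real. - \<infinity> < ereal x \<longrightarrow> ereal x < \<infinity> \<longrightarrow> (F has_vector_derivative k x) (at x)"
    using k by (intro einterval_antiderivative) (auto simp: continuous_on_eq_continuous_at)
  then obtain F where F: "\<And>x. (F has_real_derivative k x) (at x)"
    by (auto simp: has_real_derivative_iff_has_vector_derivative)
  have "((\<lambda>x. F (x + 2 * pi) - F x) has_real_derivative 0) (at x)" for x
  proof -
    have "((\<lambda>x. F (x + 2 * pi)) has_real_derivative k x) (at x)"
      using F[of "x + 2 * pi"] unfolding DERIV_shift per .
    from DERIV_diff[OF this F[of x]] show ?thesis by simp
  qed
  then have const: "F (x + 2 * pi) - F x = F (- pi + 2 * pi) - F (- pi)" for x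
    by (rule DERIV_isconst_all[OF allI])
  have "(k has_integral F pi - F (- pi)) {- pi..pi}"
    using F by (intro fundamental_theorem_of_calculus)
      (auto simp: has_real_derivative_iff_has_vector_derivative[symmetric] intro: has_field_derivative_at_within)
  with int have "F pi = F (- pi)" by (simp add: has_integral_iff)
  with const that[of F] F show ?thesis by simp
qed

text \<open>The generator equation for \<open>F 0\<close>, \<open>F 1\<close> becomes a scalar linear equation for \<open>F 1 - F 0\<close>;
  its integrating factor \<open>exp V\<close> is periodic, and the solvability condition is that the
  right-hand side is centred with respect to the weights \<open>exp V * p0\<close>, \<open>exp V * p1\<close>.\<close>

lemma poisson_solution:
  fixes p0 p1 V G0 G1 :: "real \<Rightarrow> real" and c :: real
  assumes c: "c > 0"
    and cont: "continuous_on UNIV p0" "continuous_on UNIV p1" "continuous_on UNIV G0" "continuous_on UNIV G1"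
    and per: "\<And>x. p0 (x + 2 * pi) = p0 x" "\<And>x. p1 (x + 2 * pi) = p1 x"
      "\<And>x. G0 (x + 2 * pi) = G0 x" "\<And>x. G1 (x + 2 * pi) = G1 x" "\<And>x. V (x + 2 * pi) = V x"
    and p0: "\<And>x. p0 x > 0"
    and V: "\<And>x. (V has_real_derivative c * (p0 x - p1 x)) (at x)"
    and centred: "integral {- pi..pi} (\<lambda>x. exp (V x) * (p1 x * G1 x + p0 x * G0 x)) = 0"
  obtains F0 F1 where "\<And>x. F0 (x + 2 * pi) = F0 x" "\<And>x. F1 (x + 2 * pi) = F1 x"
    "\<And>x. (F0 has_real_derivative - p0 x * (G0 x - c * (F1 x - F0 x))) (at x)"
    "\<And>x. (F1 has_real_derivative p1 x * (G1 x + c * (F1 x - F0 x))) (at x)"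
proof -
  have contV: "continuous_on UNIV V"
    using V by (intro continuous_at_imp_continuous_on) (auto intro: DERIV_isCont)
  obtain H where H: "\<And>x. (H has_real_derivative exp (V x) * (p1 x * G1 x + p0 x * G0 x)) (at x)"
    "\<And>x. H (x + 2 * pi) = H x"
    by (rule periodic_antiderivative[OF _ _ centred]) (auto intro!: continuous_intros cont contV simp: per)
  have contH: "continuous_on UNIV H"
    using H(1) by (intro continuous_at_imp_continuous_on) (auto intro: DERIV_isCont)
  let ?q = "\<lambda>x. p0 x * exp (- V x)"
  have contq: "continuous_on UNIV ?q" by (intro continuous_intros cont contV)
  have qpos: "integral {- pi..pi} ?q > 0"
    using p0 by (intro integral_pos_continuous[where x=0] continuous_on_subset[OF contq])
      (auto simp: less_imp_le)
  \<comment> \<open>The hypothesis \<open>centred\<close> makes the difference \<open>D\<close>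
    periodic for every constant of integration. The constant is then fixed so that the prescribed
    derivative of \<open>F0\<close> has mean zero, which makes \<open>F0\<close> periodic too;
    positivity of \<open>p0\<close> keeps the denominator away from zero.\<close>
  define K where "K = integral {- pi..pi} (\<lambda>x. p0 x * G0 x - c * (?q x * H x)) / (c * integral {- pi..pi} ?q)"
  define D where "D = (\<lambda>x. exp (- V x) * (K + H x))"
  have contD: "continuous_on UNIV D" unfolding D_def by (intro continuous_intros contV contH)
  have D: "(D has_real_derivative c * (p1 x - p0 x) * D x + (p1 x * G1 x + p0 x * G0 x)) (at x)" for x
  proof -
    have "(D has_real_derivative exp (- V x) * (- (c * (p0 x - p1 x))) * (K + H x)
        + exp (V x) * (p1 x * G1 x + p0 x * G0 x) * exp (- V x)) (at x)"
      unfolding D_def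
      by (rule DERIV_cong[OF DERIV_mult[OF DERIV_chain2[OF DERIV_exp DERIV_minus[OF V]] DERIV_add[OF DERIV_const H(1)]]])
        simp
    moreover have "exp (V x) * (p1 x * G1 x + p0 x * G0 x) * exp (- V x) = p1 x * G1 x + p0 x * G0 x"
      by (simp add: exp_minus)
    ultimately show ?thesis
      by (elim DERIV_cong) (simp add: D_def algebra_simps)
  qed
  have i1: "(\<lambda>x. p0 x * G0 x - c * (?q x * H x)) integrable_on {- pi..pi}"
    by (intro integrable_continuous_UNIV continuous_intros cont contV contH)
  have i2: "(\<lambda>x. c * K * ?q x) integrable_on {- pi..pi}"
    by (intro integrable_continuous_UNIV continuous_intros cont contV)
  have "integral {- pi..pi} (\<lambda>x. - p0 x * (G0 x - c * D x))
      = integral {- pi..pi} (\<lambda>x. c * K * ?q x - (p0 x * G0 x - c * (?q x * H x)))"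
    by (intro integral_cong) (simp add: D_def algebra_simps)
  also have "\<dots> = c * K * integral {- pi..pi} ?q - integral {- pi..pi} (\<lambda>x. p0 x * G0 x - c * (?q x * H x))"
    using i1 i2 by (simp only: integral_diff integral_mult_right)
  also have "\<dots> = 0"
    using qpos c by (simp add: K_def)
  finally have zero: "integral {- pi..pi} (\<lambda>x. - p0 x * (G0 x - c * D x)) = 0" .
  have perD: "D (x + 2 * pi) = D x" for x by (simp add: D_def per H)
  obtain F0 where F0: "\<And>x. (F0 has_real_derivative - p0 x * (G0 x - c * D x)) (at x)"
    "\<And>x. F0 (x + 2 * pi) = F0 x"
    by (rule periodic_antiderivative[OF _ _ zero]) (auto intro!: continuous_intros cont contD simp: per perD)
  define F1 where "F1 = (\<lambda>x. F0 x + D x)"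
  have DF: "D x = F1 x - F0 x" for x by (simp add: F1_def)
  have "(F1 has_real_derivative p1 x * (G1 x + c * D x)) (at x)" for x
    unfolding F1_def by (rule DERIV_cong[OF DERIV_add[OF F0(1) D]]) (simp add: algebra_simps)
  then show ?thesis
    using that[of F0 F1] F0 perD by (simp add: DF)
qed

text \<open>The density lives on one period of the line for each index and is pushed to the circle
  by \<open>cis\<close>; the doubly covered endpoint is a null set. This keeps all later integrals
  ordinary ones over \<open>{- pi..pi}\<close>.\<close>

lemma circle_density_measure:
  fixes w :: "nat \<Rightarrow> real \<Rightarrow> real"
  assumes cont: "\<And>i. i \<in> {0, 1} \<Longrightarrow> continuous_on UNIV (w i)"
    and pos: "\<And>i x. i \<in> {0, 1} \<Longrightarrow> w i x > 0"
    and norm: "(\<Sum>i\<in>{0, 1}. integral {- pi..pi} (w i)) = 1"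
  obtains M where "M \<in> space (prob_algebra state_space)"
    "\<And>g. continuous_on states g \<Longrightarrow>
      (\<integral>x. g x \<partial>M) = (\<Sum>i\<in>{0, 1}. integral {- pi..pi} (\<lambda>x. g (cis x, i) * w i x))"
proof -
  define I where "I = {0, 1 :: nat}"
  note cont = cont[folded I_def] and pos = pos[folded I_def] and norm = norm[folded I_def]
  have states_I: "states = sphere 0 1 \<times> I" and [simp]: "finite I"
    by (simp_all add: states_def I_def)
  let ?N = "count_space I \<Otimes>\<^sub>M (lborel :: real measure)"
  define r where "r = (\<lambda>(i, x). indicator {- pi..pi} x * w i x)"
  define h where "h = (\<lambda>(i :: nat, x). (cis x, i))"
  define M where "M = distr (density ?N (\<lambda>p. ennreal (r p))) state_space h"
  interpret F: finite_measure "count_space I"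
    by (rule finite_measure_count_space) simp
  interpret pair_sigma_finite "count_space I" "lborel :: real measure" ..
  have r [measurable]: "r \<in> borel_measurable ?N"
  proof (rule measurable_pair_measure_countable1)
    fix i :: nat assume i: "i \<in> I"
    have [measurable]: "w i \<in> borel_measurable borel"
      using cont[OF i] by (rule borel_measurable_continuous_onI)
    show "(\<lambda>y. r (i, y)) \<in> borel_measurable lborel" by (simp add: r_def)
  qed (simp add: countable_finite)
  have h [measurable]: "h \<in> ?N \<rightarrow>\<^sub>M state_space"
  proof (rule measurable_pair_measure_countable1)
    fix i :: nat assume i: "i \<in> I"
    have "(\<lambda>y. (cis y, i)) \<in> borel_measurable borel"
      by (intro borel_measurable_continuous_onI continuous_intros)
    then show "(\<lambda>y. h (i, y)) \<in> lborel \<rightarrow>\<^sub>M state_space"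
      unfolding state_space_def h_def using i by (intro measurable_restrict_space2) (auto simp: states_I)
  qed (simp add: countable_finite)
  have r_nonneg: "r p \<ge> 0" if "p \<in> space ?N" for p
    using that pos by (auto simp: r_def space_pair_measure less_imp_le)
  have int: "(\<integral>x. indicator {- pi..pi} x * k x \<partial>lborel) = integral {- pi..pi} k"
      "integrable lborel (\<lambda>x. indicator {- pi..pi} x * k x)" if "continuous_on UNIV k" for k :: "real \<Rightarrow> real"
  proof -
    have "set_integrable lborel {- pi..pi} k"
      using that by (intro borel_integrable_atLeastAtMost') (auto intro: continuous_on_subset)
    then show "(\<integral>x. indicator {- pi..pi} x * k x \<partial>lborel) = integral {- pi..pi} k"
      "integrable lborel (\<lambda>x. indicator {- pi..pi} x * k x)"
      using set_borel_integral_eq_integral(2)[of "{- pi..pi}" k]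
      by (simp_all add: set_lebesgue_integral_def set_integrable_def)
  qed
  have total: "(\<integral>\<^sup>+p. ennreal (r p) \<partial>?N) = 1"
  proof -
    have "(\<integral>\<^sup>+p. ennreal (r p) \<partial>?N) = (\<integral>\<^sup>+i. \<integral>\<^sup>+x. ennreal (r (i, x)) \<partial>lborel \<partial>count_space I)"
      by (rule lborel.nn_integral_fst[symmetric]) measurable
    also have "\<dots> = (\<Sum>i\<in>I. \<integral>\<^sup>+x. ennreal (r (i, x)) \<partial>lborel)"
      by (rule nn_integral_count_space_finite) simp
    also have "\<dots> = (\<Sum>i\<in>I. ennreal (integral {- pi..pi} (w i)))"
    proof (rule sum.cong[OF refl])
      fix i :: nat assume i: "i \<in> I"
      have "(\<integral>\<^sup>+x. ennreal (r (i, x)) \<partial>lborel) = ennreal (\<integral>x. r (i, x) \<partial>lborel)"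
        using int(2)[OF cont[OF i]] pos[OF i]
        by (intro nn_integral_eq_integral) (auto simp: r_def less_imp_le)
      then show "(\<integral>\<^sup>+x. ennreal (r (i, x)) \<partial>lborel) = ennreal (integral {- pi..pi} (w i))"
        using int(1)[OF cont[OF i]] by (simp add: r_def)
    qed
    also have "\<dots> = ennreal (\<Sum>i\<in>I. integral {- pi..pi} (w i))"
      using cont pos by (intro sum_ennreal integral_nonneg integrable_continuous_UNIV)
        (auto simp: less_imp_le)
    finally show ?thesis using norm by simp
  qed
  have "prob_space (density ?N (\<lambda>p. ennreal (r p)))"
  proof (intro prob_spaceI)
    let ?D = "density ?N (\<lambda>p. ennreal (r p))"
    have "emeasure ?D (space ?D) = (\<integral>\<^sup>+p. 1 \<partial>?D)"
      by (simp only: nn_integral_const mult_1_left)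
    also have "\<dots> = (\<integral>\<^sup>+p. ennreal (r p) * 1 \<partial>?N)"
      by (rule nn_integral_density) measurable
    also have "\<dots> = 1"
      using total by (simp only: mult_1_right)
    finally show "emeasure ?D (space ?D) = 1" .
  qed
  then have "M \<in> space (prob_algebra state_space)"
    unfolding M_def by (auto simp: space_prob_algebra intro!: prob_space.prob_space_distr)
  moreover have "(\<integral>x. g x \<partial>M) = (\<Sum>i\<in>I. integral {- pi..pi} (\<lambda>x. g (cis x, i) * w i x))"
    if g: "continuous_on states g" for g
  proof -
    have [measurable]: "g \<in> borel_measurable state_space"
      unfolding state_space_def by (rule borel_measurable_continuous_on_restrict[OF g])
    obtain B where B: "B > 0" "\<And>y. y \<in> states \<Longrightarrow> \<bar>g y\<bar> \<le> B"
      using cont_states_bounded[OF g] by blast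
    have "integrable ?N r"
      using total r_nonneg by (intro integrableI_nonneg AE_I2) auto
    then have "integrable ?N (\<lambda>p. B * r p)" by simp
    then have intg: "integrable ?N (\<lambda>p. r p * g (h p))"
    proof (rule Bochner_Integration.integrable_bound)
      show "AE p in ?N. norm (r p * g (h p)) \<le> norm (B * r p)"
      proof (intro AE_I2)
        fix p assume p: "p \<in> space ?N"
        then have "h p \<in> states" using measurable_space[OF h p] by simp
        then show "norm (r p * g (h p)) \<le> norm (B * r p)"
          using mult_right_mono[OF B(2) r_nonneg[OF p]] B(1) r_nonneg[OF p] by (simp add: abs_mult mult.commute)
      qed
    qed measurable
    have "(\<integral>x. g x \<partial>M) = (\<integral>p. g (h p) \<partial>density ?N (\<lambda>p. ennreal (r p)))"
      unfolding M_def by (rule integral_distr) measurable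
    also have "\<dots> = (\<integral>p. r p * g (h p) \<partial>?N)"
      using r_nonneg by (subst integral_density) auto
    also have "\<dots> = (\<integral>i. \<integral>x. r (i, x) * g (h (i, x)) \<partial>lborel \<partial>count_space I)"
      using intg by (rule integral_fst'[symmetric])
    also have "\<dots> = (\<Sum>i\<in>I. \<integral>x. r (i, x) * g (h (i, x)) \<partial>lborel)"
      by (rule lebesgue_integral_count_space_finite) simp
    also have "\<dots> = (\<Sum>i\<in>I. integral {- pi..pi} (\<lambda>x. g (cis x, i) * w i x))"
    proof (rule sum.cong[OF refl])
      fix i :: nat assume i: "i \<in> I"
      have "continuous_on UNIV (\<lambda>x. g (cis x, i))"
        using i by (intro continuous_on_compose2[OF g] continuous_intros) (auto simp: states_I)
      then have "continuous_on UNIV (\<lambda>x. g (cis x, i) * w i x)"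
        by (intro continuous_intros cont i)
      from int(1)[OF this] show "(\<integral>x. r (i, x) * g (h (i, x)) \<partial>lborel) = integral {- pi..pi} (\<lambda>x. g (cis x, i) * w i x)"
        by (simp add: r_def h_def mult_ac)
    qed
    finally show ?thesis .
  qed
  ultimately show ?thesis using that unfolding I_def by blast
qed

section \<open>Sign of the growth exponent\<close>

text \<open>As \<open>y\<close> and \<open>v\<close> never have opposite signs,
  \<open>y x * exp (t * v x)\<close> is nondecreasing in \<open>t\<close> for each \<open>x\<close>,
  strictly at \<open>x0\<close>. So the integral increases strictly; a linear lower bound makes it
  eventually positive, and its unique zero is \<open>c\<close>.\<close>

lemma exp_tilt_sign_change:
  fixes y v w :: "real \<Rightarrow> real"
  assumes pq: "p < q"
    and cont: "continuous_on UNIV y" "continuous_on UNIV v" "continuous_on UNIV w"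
    and w: "\<And>x. w x > 0" and yv: "\<And>x. y x * v x \<ge> 0"
    and x0: "x0 \<in> {p..q}" "y x0 > 0" "v x0 > 0"
    and neg: "integral {p..q} (\<lambda>x. y x * w x) < 0"
  shows "\<exists>c>0. (\<forall>t. 0 < t \<and> t < c \<longrightarrow> integral {p..q} (\<lambda>x. y x * exp (t * v x) * w x) < 0) \<and>
    (\<forall>t>c. integral {p..q} (\<lambda>x. y x * exp (t * v x) * w x) > 0)"
proof -
  define F where "F = (\<lambda>t. integral {p..q} (\<lambda>x. y x * exp (t * v x) * w x))"
  have int: "(\<lambda>x. y x * exp (t * v x) * w x) integrable_on {p..q}" for t
    by (intro integrable_continuous_UNIV continuous_intros cont)
  have sgn: "v x > 0 \<Longrightarrow> y x \<ge> 0" "v x < 0 \<Longrightarrow> y x \<le> 0" for x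
    using yv[of x] by (auto simp: zero_le_mult_iff)
  have mono: "F s < F t" if "s < t" for s t
  proof -
    let ?d = "\<lambda>x. y x * exp (t * v x) * w x - y x * exp (s * v x) * w x"
    have d: "?d x = y x * (exp (t * v x) - exp (s * v x)) * w x" for x
      by (simp add: algebra_simps)
    have nonneg: "y x * (exp (t * v x) - exp (s * v x)) \<ge> 0" for x
    proof -
      consider "v x = 0" | "v x > 0" | "v x < 0" by linarith
      then show ?thesis
      proof cases
        case 2
        then have "s * v x \<le> t * v x" using that by simp
        then show ?thesis using sgn(1)[OF 2] by (intro mult_nonneg_nonneg) auto
      next
        case 3
        then have "t * v x \<le> s * v x" using that by simp
        then show ?thesis using sgn(2)[OF 3] by (intro mult_nonpos_nonpos) auto
      qed simp
    qed
    have "integral {p..q} ?d > 0"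
    proof (rule integral_pos_continuous[OF _ pq _ x0(1)])
      show "continuous_on {p..q} ?d"
        by (rule continuous_on_subset[OF _ subset_UNIV]) (intro continuous_intros cont)
      show "?d x \<ge> 0" for x
        unfolding d using nonneg[of x] w[of x] by simp
      show "?d x0 > 0"
        unfolding d using x0 that w[of x0] by simp
    qed
    then show ?thesis using int by (simp add: F_def integral_diff)
  qed
  have F0: "F 0 < 0" using neg by (simp add: F_def)
  \<comment> \<open>The slope of the lower bound: where \<open>v\<close> is positive,
    \<open>exp (t * v) \<ge> 1 + t * v\<close>; where \<open>v\<close> is negative,
    \<open>y \<le> 0\<close> and the tilt only reduces the negative contribution.\<close>
  define L where "L = integral {p..q} (\<lambda>x. y x * max (v x) 0 * w x)"
  have contL: "continuous_on UNIV (\<lambda>x. y x * max (v x) 0 * w x)"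
    by (intro continuous_intros cont)
  have L: "L > 0"
    unfolding L_def
  proof (rule integral_pos_continuous[OF _ pq _ x0(1)])
    show "continuous_on {p..q} (\<lambda>x. y x * max (v x) 0 * w x)"
      by (rule continuous_on_subset[OF contL subset_UNIV])
    show "y x * max (v x) 0 * w x \<ge> 0" for x
      using sgn(1)[of x] w[of x] by (cases "v x > 0") (auto simp: max_def)
    show "y x0 * max (v x0) 0 * w x0 > 0" using x0 w[of x0] by simp
  qed
  have lower: "F t \<ge> F 0 + t * L" if t: "t > 0" for t
  proof -
    have i2: "(\<lambda>x. t * (y x * max (v x) 0 * w x)) integrable_on {p..q}"
      by (intro integrable_continuous_UNIV continuous_intros cont)
    have "F 0 + t * L = integral {p..q} (\<lambda>x. y x * exp (0 * v x) * w x + t * (y x * max (v x) 0 * w x))"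
      unfolding F_def L_def
      by (simp only: integral_add[OF int[of 0] i2] integral_mult_right)
    also have "\<dots> \<le> F t"
      unfolding F_def
    proof (rule integral_le[OF _ int])
      show "(\<lambda>x. y x * exp (0 * v x) * w x + t * (y x * max (v x) 0 * w x)) integrable_on {p..q}"
        by (intro integrable_continuous_UNIV continuous_intros cont)
      fix x
      have "y x * (1 + t * max (v x) 0) \<le> y x * exp (t * v x)"
      proof (cases "v x > 0")
        case True
        then show ?thesis using sgn(1)[OF True] exp_ge_add_one_self[of "t * v x"]
          by (intro mult_left_mono) auto
      next
        case False
        then have "t * v x \<le> 0" using t by (simp add: mult_le_0_iff)
        then have e: "exp (t * v x) \<le> 1" by simp
        show ?thesis
        proof (cases "v x = 0")
          case False
          with \<open>\<not> 0 < v x\<close> have "v x < 0" by simp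
          then show ?thesis using mult_left_mono_neg[OF e sgn(2)] by (simp add: max_def)
        qed simp
      qed
      from mult_right_mono[OF this less_imp_le[OF w[of x]]]
      show "y x * exp (0 * v x) * w x + t * (y x * max (v x) 0 * w x) \<le> y x * exp (t * v x) * w x"
        by (simp add: algebra_simps)
    qed
    finally show ?thesis .
  qed
  \<comment> \<open>Chosen so that the linear lower bound takes the value 1 at
    \<open>T\<close>.\<close>
  define T where "T = (1 - F 0) / L"
  have T: "T > 0" using F0 L by (simp add: T_def)
  have FT: "F T > 0" using lower[OF T] L by (simp add: T_def)
  have "continuous_on UNIV F"
  proof -
    have "continuous_on (UNIV \<times> cbox p q) (\<lambda>(t, x). y x * exp (t * v x) * w x)"
      unfolding case_prod_unfold
      by (intro continuous_intros continuous_on_compose2[OF cont(1)] continuous_on_compose2[OF cont(2)]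
          continuous_on_compose2[OF cont(3)]) auto
    from integral_continuous_on_param[OF this] show ?thesis by (simp add: F_def)
  qed
  then have "continuous_on {0..T} F" by (rule continuous_on_subset) simp
  then obtain c where c: "0 \<le> c" "c \<le> T" "F c = 0"
    using IVT'[of F 0 0 T] F0 FT T by auto
  have "c > 0" using c F0 by (cases "c = 0") auto
  moreover have "F t < 0" if "t < c" for t using mono[OF that] c by simp
  moreover have "F t > 0" if "t > c" for t using mono[OF that] c by simp
  ultimately show ?thesis unfolding F_def by blast
qed

lemma sqrt_threshold_iff:
  fixes a b :: real
  assumes "a > 0" "b > 0"
  shows "a * (b - 1 / b) > 2 \<longleftrightarrow> b > (1 + sqrt (1 + a\<^sup>2)) / a"
proof -
  have "a * (b - 1 / b) > 2 \<longleftrightarrow> 1 + a\<^sup>2 < (a * b - 1)\<^sup>2"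
  proof -
    have "a * (b - 1 / b) > 2 \<longleftrightarrow> a * b * (a * (b - 1 / b)) > a * b * 2"
      using assms by simp
    also have "a * b * (a * (b - 1 / b)) = a\<^sup>2 * b\<^sup>2 - a\<^sup>2"
      using assms by (simp add: field_simps power2_eq_square)
    also have "a\<^sup>2 * b\<^sup>2 - a\<^sup>2 > a * b * 2 \<longleftrightarrow> 1 + a\<^sup>2 < (a * b - 1)\<^sup>2"
      by (auto simp: power2_eq_square algebra_simps)
    finally show ?thesis .
  qed
  also have "\<dots> \<longleftrightarrow> sqrt (1 + a\<^sup>2) < \<bar>a * b - 1\<bar>"
    by (metis real_sqrt_abs real_sqrt_less_iff)
  \<comment> \<open>The other sign of the absolute value is excluded:
    \<open>a * b - 1 > - 1\<close>, while the root is at least 1.\<close>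
  also have "\<dots> \<longleftrightarrow> sqrt (1 + a\<^sup>2) < a * b - 1"
  proof -
    have "1 \<le> sqrt (1 + a\<^sup>2)" by simp
    moreover have "a * b > 0" using assms by simp
    ultimately show ?thesis by (smt (verit))
  qed
  also have "\<dots> \<longleftrightarrow> b > (1 + sqrt (1 + a\<^sup>2)) / a"
    using assms by (auto simp: field_simps)
  finally show ?thesis .
qed

section \<open>The given pair of matrices\<close>

locale switched_rotations =
  fixes a b :: real and A :: "nat \<Rightarrow> real^2^2"
  assumes a: "a > 0" and b: "b > 0"
    and A0: "A 0 = vector [vector [-1, a * b], vector [- a / b, -1]]"
    and A1: "A 1 = vector [vector [-1, - a / b], vector [a * b, -1]]"
begin

text \<open>The hypothesis of the theorem reads \<open>a * m > 1\<close>: the radial rate is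
  positive at the angle \<open>pi / 4\<close>.\<close>

definition m where "m = (b - 1 / b) / 2"

definition speed :: "nat \<Rightarrow> real \<Rightarrow> real" where
  "speed i x = (if i = 0 then 1 / b * (cos x)\<^sup>2 + b * (sin x)\<^sup>2 else b * (cos x)\<^sup>2 + 1 / b * (sin x)\<^sup>2)"

lemma speed_pos: "speed i x > 0"
  using trig_form_pos[of "1 / b" b x] trig_form_pos[of b "1 / b" x] b by (simp add: speed_def)

text \<open>Together with \<open>ang_speed_1\<close>: the two fields rotate in opposite senses and
  have no zeros, which is what gives the invariant density its closed form.\<close>

lemma ang_speed_0: "ang_speed A 0 x = - (a * speed 0 x)"
  using b by (simp add: ang_speed_eq A0 vector_2 speed_def power2_eq_square field_simps)

lemma ang_speed_1: "ang_speed A 1 x = a * speed 1 x"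
  using b by (simp add: ang_speed_eq A1[unfolded One_nat_def] A1 vector_2 speed_def power2_eq_square field_simps)

text \<open>The two matrices have the same symmetric part, with diagonal -1 and off-diagonal entry
  \<open>a * m\<close>, so the radial rate does not see the index.\<close>

lemma rad_growth_A:
  assumes "i \<in> {0, 1}"
  shows "rad_growth A x i = a * m * sin (2 * x) - 1"
proof -
  have "rad_growth A x i = (A i $ 1 $ 2 + A i $ 2 $ 1) * (sin x * cos x)
      + A i $ 1 $ 1 * (cos x)\<^sup>2 + A i $ 2 $ 2 * (sin x)\<^sup>2"
    by (simp add: rad_growth_def e_vec_def inner_vec_def matrix_vector_mult_def sum_2 vector_2
        power2_eq_square algebra_simps)
  also have "\<dots> = (a * b - a / b) * (sin x * cos x) - ((cos x)\<^sup>2 + (sin x)\<^sup>2)"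
    using assms by (auto simp: A0 A1 A1[unfolded One_nat_def] vector_2 algebra_simps)
  also have "\<dots> = a * m * sin (2 * x) - 1"
    unfolding m_def sin_double sin_cos_squared_add2 using b by (simp add: field_simps)
  finally show ?thesis .
qed

text \<open>The time coordinates are \<open>tan_scale b\<close> and \<open>tan_scale (1 / b)\<close>
  up to the factors \<open>- 1 / a\<close> and \<open>1 / a\<close>, whose signs are the senses of
  rotation.\<close>

lemma semigroup_exists:
  assumes "\<beta> > 0"
  shows "\<exists>P. angular_semigroup A \<beta> P"
proof (rule angular_semigroup_exists[OF assms])
  fix i :: nat assume i: "i \<in> {0, 1}"
  show "\<exists>\<tau> p. (\<forall>x. (\<tau> has_real_derivative 1 / ang_speed A i x) (at x)) \<and>
      (\<forall>x. ang_speed A i x \<noteq> 0) \<and> bij \<tau> \<and> (\<forall>x. \<tau> (x + 2 * pi) = \<tau> x + p)"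
  proof (cases "i = 0")
    case True
    have "((\<lambda>x. - 1 / a * tan_scale b x) has_real_derivative 1 / ang_speed A i x) (at x)" for x
    proof (rule DERIV_cong[OF DERIV_cmult[OF tan_scale_deriv[OF b]]])
      have "b / ((cos x)\<^sup>2 + b\<^sup>2 * (sin x)\<^sup>2) = 1 / speed 0 x"
        using b by (simp add: speed_def field_simps power2_eq_square)
      then show "- 1 / a * (b / ((cos x)\<^sup>2 + b\<^sup>2 * (sin x)\<^sup>2)) = 1 / ang_speed A i x"
        using True by (simp add: ang_speed_0)
    qed
    moreover have "ang_speed A i x \<noteq> 0" for x
      using a speed_pos[of 0 x] True by (simp add: ang_speed_0)
    moreover have "bij (\<lambda>x. - 1 / a * tan_scale b x)"
      using a b by (intro bij_tan_scale_cmult) auto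
    moreover have "- 1 / a * tan_scale b (x + 2 * pi) = - 1 / a * tan_scale b x + (- 1 / a * (2 * pi))" for x
      unfolding tan_scale_period by (rule distrib_left)
    ultimately show ?thesis by blast
  next
    case False
    then have i1: "i = 1" using i by simp
    have b': "1 / b > 0" using b by simp
    have "((\<lambda>x. 1 / a * tan_scale (1 / b) x) has_real_derivative 1 / ang_speed A i x) (at x)" for x
    proof (rule DERIV_cong[OF DERIV_cmult[OF tan_scale_deriv[OF b']]])
      have "1 / b / ((cos x)\<^sup>2 + (1 / b)\<^sup>2 * (sin x)\<^sup>2) = 1 / speed 1 x"
        using b by (simp add: speed_def field_simps power2_eq_square)
      then show "1 / a * (1 / b / ((cos x)\<^sup>2 + (1 / b)\<^sup>2 * (sin x)\<^sup>2)) = 1 / ang_speed A i x"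
        unfolding i1 ang_speed_1 by simp
    qed
    moreover have "ang_speed A i x \<noteq> 0" for x
      unfolding i1 ang_speed_1 using a speed_pos[of 1 x] by simp
    moreover have "bij (\<lambda>x. 1 / a * tan_scale (1 / b) x)"
      using a b by (intro bij_tan_scale_cmult) auto
    moreover have "1 / a * tan_scale (1 / b) (x + 2 * pi) = 1 / a * tan_scale (1 / b) x + (1 / a * (2 * pi))" for x
      unfolding tan_scale_period by (rule distrib_left)
    ultimately show ?thesis by blast
  qed
qed

text \<open>The source of the \<open>arctan\<close> in \<open>V\<close>: by
  \<open>speed_diff\<close> the difference of the speeds is the derivative of
  \<open>m * sin (2 * x)\<close>, so the quotient of difference and product is the derivative of an
  arctangent.\<close>

lemma speed_mult: "speed 0 x * speed 1 x = 1 + (m * sin (2 * x))\<^sup>2"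
proof -
  have c2: "(cos x)\<^sup>2 = 1 - (sin x)\<^sup>2" by (rule cos_squared_eq)
  have "speed 0 x * speed 1 x = (cos x)^4 + (sin x)^4 + (b\<^sup>2 + 1 / b\<^sup>2) * ((sin x)\<^sup>2 * (cos x)\<^sup>2)"
    using b by (simp add: speed_def field_simps power2_eq_square power4_eq_xxxx)
  also have "(cos x)^4 + (sin x)^4 = 1 - 2 * ((sin x)\<^sup>2 * (cos x)\<^sup>2)"
  proof -
    have "p^4 + q^4 = (p\<^sup>2 + q\<^sup>2)\<^sup>2 - 2 * (q\<^sup>2 * p\<^sup>2)" for p q :: real
      by (simp add: power2_eq_square power4_eq_xxxx algebra_simps)
    from this[of "cos x" "sin x"] show ?thesis by simp
  qed
  also have "1 - 2 * ((sin x)\<^sup>2 * (cos x)\<^sup>2) + (b\<^sup>2 + 1 / b\<^sup>2) * ((sin x)\<^sup>2 * (cos x)\<^sup>2)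
      = 1 + (b\<^sup>2 + 1 / b\<^sup>2 - 2) * ((sin x)\<^sup>2 * (cos x)\<^sup>2)"
    by (simp add: algebra_simps)
  also have "b\<^sup>2 + 1 / b\<^sup>2 - 2 = (2 * m)\<^sup>2"
    using b by (simp add: m_def power2_eq_square field_simps)
  also have "(2 * m)\<^sup>2 * ((sin x)\<^sup>2 * (cos x)\<^sup>2) = (m * sin (2 * x))\<^sup>2"
    by (simp add: sin_double power_mult_distrib)
  finally show ?thesis .
qed

lemma speed_add: "speed 0 x + speed 1 x = b + 1 / b"
proof -
  have "speed 0 x + speed 1 x = (b + 1 / b) * ((sin x)\<^sup>2 + (cos x)\<^sup>2)"
    unfolding speed_def by (simp del: sin_cos_squared_add add: distrib_left distrib_right)
  then show ?thesis by simp
qed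

lemma speed_diff: "speed 1 x - speed 0 x = 2 * m * cos (2 * x)"
  unfolding speed_def m_def cos_double by (simp add: algebra_simps diff_divide_distrib)

lemma speed_period: "speed i (x + 2 * pi) = speed i x"
  by (simp add: speed_def)

lemma speed_cont: "continuous_on UNIV (speed i)"
  unfolding speed_def using b by (cases "i = 0") (auto intro!: continuous_intros)

definition V :: "real \<Rightarrow> real \<Rightarrow> real" where
  "V \<beta> x = \<beta> / (2 * a) * arctan (m * sin (2 * x))"

lemma V_period: "V \<beta> (x + 2 * pi) = V \<beta> x"
proof -
  have "sin (2 * (x + 2 * pi)) = sin ((2 * x + 2 * pi) + 2 * pi)" by (simp add: algebra_simps)
  then have "sin (2 * (x + 2 * pi)) = sin (2 * x)" unfolding sin_periodic .
  then show ?thesis unfolding V_def by simp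
qed

lemma V_deriv:
  "(V \<beta> has_real_derivative \<beta> / 2 * (1 / (a * speed 0 x) - 1 / (a * speed 1 x))) (at x)"
proof -
  have "(V \<beta> has_real_derivative \<beta> / (2 * a) * ((2 * m * cos (2 * x)) / (1 + (m * sin (2 * x))\<^sup>2))) (at x)"
    unfolding V_def
    by (rule DERIV_cong[OF DERIV_cmult[OF DERIV_chain2[OF DERIV_arctan]]])
      (auto intro!: derivative_eq_intros simp: divide_simps)
  also have "\<beta> / (2 * a) * ((2 * m * cos (2 * x)) / (1 + (m * sin (2 * x))\<^sup>2))
      = \<beta> / 2 * (1 / (a * speed 0 x) - 1 / (a * speed 1 x))"
    unfolding speed_mult[symmetric] speed_diff[symmetric]
    using a speed_pos[of 0 x] speed_pos[of 1 x] by (simp add: field_simps)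
  finally show ?thesis .
qed

lemma V_cont: "continuous_on UNIV (V \<beta>)"
  unfolding V_def by (intro continuous_intros)

definition weight :: "real \<Rightarrow> nat \<Rightarrow> real \<Rightarrow> real" where
  "weight \<beta> i x = exp (V \<beta> x) / (a * speed i x)"

lemma weight_cont: "continuous_on UNIV (weight \<beta> i)"
proof -
  have "a * speed i x \<noteq> 0" for x using a speed_pos[of i x] by simp
  then show ?thesis
    unfolding weight_def by (intro continuous_intros V_cont speed_cont) auto
qed

lemma weight_pos: "weight \<beta> i x > 0"
  using a speed_pos[of i x] by (simp add: weight_def)

text \<open>Dividing the generator equation by the angular speeds, which are
  \<open>- 1 / p 0\<close> and \<open>1 / p 1\<close>, gives the system of
  \<open>poisson_solution\<close>. Reading its periodic solution at \<open>Arg z\<close> gives a C1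
  function on the circle.\<close>

lemma poisson_solvable:
  assumes \<beta>: "\<beta> > 0" and g: "continuous_on states g"
    and centred: "(\<Sum>i\<in>{0, 1}. integral {- pi..pi} (\<lambda>x. g (cis x, i) * weight \<beta> i x)) = 0"
  shows "\<exists>f. C1_fun f \<and> (\<forall>x\<in>states. ang_generator A \<beta> f x = g x)"
proof -
  define p where "p = (\<lambda>i x. 1 / (a * speed i x))"
  define G where "G = (\<lambda>i x. g (cis x, i))"
  have sp: "a * speed i x \<noteq> 0" for i x using a speed_pos[of i x] by simp
  have contp: "continuous_on UNIV (p i)" for i
    unfolding p_def using sp by (intro continuous_intros speed_cont) auto
  have contG: "continuous_on UNIV (G i)" if "i \<in> {0, 1}" for i
    unfolding G_def using that
    by (intro continuous_on_compose2[OF g] continuous_intros) (auto simp: states_def)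
  have w: "weight \<beta> i x = exp (V \<beta> x) * p i x" for i x by (simp add: weight_def p_def)
  have iw: "(\<lambda>x. G i x * weight \<beta> i x) integrable_on {- pi..pi}" if "i \<in> {0, 1}" for i
    by (intro integrable_continuous_UNIV continuous_intros contG weight_cont that)
  have "integral {- pi..pi} (\<lambda>x. exp (V \<beta> x) * (p 1 x * G 1 x + p 0 x * G 0 x))
      = integral {- pi..pi} (\<lambda>x. G 0 x * weight \<beta> 0 x + G 1 x * weight \<beta> 1 x)"
    by (intro integral_cong) (simp add: w algebra_simps)
  also have "\<dots> = 0"
    using centred by (subst integral_add) (use iw in \<open>auto simp: G_def\<close>)
  finally have zero: "integral {- pi..pi} (\<lambda>x. exp (V \<beta> x) * (p 1 x * G 1 x + p 0 x * G 0 x)) = 0" .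
  have cis_per: "cis (x + 2 * pi) = cis x" for x by (simp add: complex_eq_iff)
  obtain F0 F1 where F: "\<And>x. F0 (x + 2 * pi) = F0 x" "\<And>x. F1 (x + 2 * pi) = F1 x"
    "\<And>x. (F0 has_real_derivative - p 0 x * (G 0 x - \<beta> / 2 * (F1 x - F0 x))) (at x)"
    "\<And>x. (F1 has_real_derivative p 1 x * (G 1 x + \<beta> / 2 * (F1 x - F0 x))) (at x)"
  proof (rule poisson_solution[OF _ contp[of 0] contp[of 1] contG[of 0] contG[of 1] _ _ _ _ _ _ _ zero, of "\<beta> / 2"])
    show "(V \<beta> has_real_derivative \<beta> / 2 * (p 0 x - p 1 x)) (at x)" for x
      unfolding p_def by (rule V_deriv)
    show "p 0 x > 0" for x using a speed_pos[of 0 x] by (simp add: p_def)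
  qed (use \<beta> in \<open>auto simp: p_def G_def speed_period V_period cis_per\<close>)
  have F0c: "F0 (Arg (cis x)) = F0 x" "F1 (Arg (cis x)) = F1 x" for x
    using periodic_cis[of F0, OF F(1) cis_Arg_cis] periodic_cis[of F1, OF F(2) cis_Arg_cis] by auto
  define f where "f = (\<lambda>(z, i :: nat). if i = 0 then F0 (Arg z) else F1 (Arg z))"
  have f0: "(\<lambda>s. f (cis s, 0)) = F0" and f1: "(\<lambda>s. f (cis s, 1)) = F1"
    by (auto simp: f_def F0c)
  have d0: "deriv F0 = (\<lambda>x. - p 0 x * (G 0 x - \<beta> / 2 * (F1 x - F0 x)))"
    and d1: "deriv F1 = (\<lambda>x. p 1 x * (G 1 x + \<beta> / 2 * (F1 x - F0 x)))"
    using DERIV_imp_deriv[OF F(3)] DERIV_imp_deriv[OF F(4)] by auto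
  have cF: "continuous_on UNIV F0" "continuous_on UNIV F1"
    using F(3,4) by (auto intro!: continuous_at_imp_continuous_on DERIV_isCont)
  have "C1_fun f"
    unfolding C1_fun_def
  proof
    fix i :: nat assume "i \<in> {0, 1}"
    then consider "i = 0" | "i = 1" by auto
    then show "(\<forall>\<theta>. (\<lambda>s. f (cis s, i)) differentiable at \<theta>) \<and> continuous_on UNIV (deriv (\<lambda>s. f (cis s, i)))"
    proof cases
      case 1
      show ?thesis unfolding 1 f0 d0 using F(3)
        by (auto intro!: continuous_intros contp contG cF simp: real_differentiable_def)
    next
      case 2
      show ?thesis unfolding 2 f1 d1 using F(4)
        by (auto intro!: continuous_intros contp contG[of 1, simplified] cF simp: real_differentiable_def)
    qed
  qed
  moreover have "ang_generator A \<beta> f x = g x" if x: "x \<in> states" for x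
  proof -
    obtain z i where xi: "x = (z, i)" "z \<in> sphere 0 1" "i = 0 \<or> i = 1"
      using x by (auto simp: states_def)
    have G: "G i (Arg z) = g (z, i)" unfolding G_def using xi(2) by (simp del: mem_sphere_0)
    from xi(3) show ?thesis
    proof
      assume i: "i = 0"
      have "ang_speed A 0 (Arg z) * deriv F0 (Arg z) = G 0 (Arg z) - \<beta> / 2 * (F1 (Arg z) - F0 (Arg z))"
        unfolding d0 ang_speed_0 p_def using sp[of 0 "Arg z"] by simp
      then show ?thesis using G unfolding xi(1) i ang_generator_def split_conv f0
        by (simp add: f_def)
    next
      assume i: "i = 1"
      have "ang_speed A 1 (Arg z) * deriv F1 (Arg z) = G 1 (Arg z) + \<beta> / 2 * (F1 (Arg z) - F0 (Arg z))"
        unfolding d1 ang_speed_1 p_def using sp[of 1 "Arg z"] by simp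
      then show ?thesis using G unfolding xi(1) i ang_generator_def split_conv f1
        by (simp add: f_def algebra_simps)
    qed
  qed
  ultimately show ?thesis by blast
qed

text \<open>Since the radial rate ignores the index, only the sum of the two densities matters. The
  numerator of \<open>1 / speed 0 x + 1 / speed 1 x\<close> is constant by \<open>speed_add\<close>,
  which leaves \<open>speed_mult\<close> as the only denominator. The factor \<open>C\<close>
  depends on \<open>\<beta>\<close> through the normalisation; only its sign is needed.\<close>

lemma growth_exponent_formula:
  assumes \<beta>: "\<beta> > 0"
  obtains C where "C > 0" "growth_exponent A \<beta> = C * integral {- pi..pi}
    (\<lambda>x. (a * m * sin (2 * x) - 1) * exp (V \<beta> x) / (1 + (m * sin (2 * x))\<^sup>2))"
proof -
  define Z where "Z = (\<Sum>i\<in>{0, 1}. integral {- pi..pi} (weight \<beta> i))"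
  have "integral {- pi..pi} (weight \<beta> i) > 0" for i
    using weight_pos by (intro integral_pos_continuous[where x=0] continuous_on_subset[OF weight_cont])
      (auto simp: less_imp_le)
  then have Z: "Z > 0" by (auto simp: Z_def intro!: add_pos_pos)
  have norm: "(\<Sum>i\<in>{0, 1}. integral {- pi..pi} (\<lambda>x. weight \<beta> i x / Z)) = 1"
    using Z by (simp add: integral_divide Z_def add_divide_distrib[symmetric])
  obtain M where M: "M \<in> space (prob_algebra state_space)"
    and M_int: "\<And>g. continuous_on states g \<Longrightarrow>
      (\<integral>x. g x \<partial>M) = (\<Sum>i\<in>{0, 1}. integral {- pi..pi} (\<lambda>x. g (cis x, i) * (weight \<beta> i x / Z)))"
    by (rule circle_density_measure[OF _ _ norm])
      (use Z weight_pos weight_cont in \<open>auto intro!: continuous_intros divide_pos_pos\<close>)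
  have "invariant_measure A \<beta> = M"
  proof (rule invariant_measure_eqI[OF semigroup_exists[OF \<beta>] M])
    fix g :: "complex \<times> nat \<Rightarrow> real" assume g: "continuous_on states g"
    define c where "c = (\<integral>x. g x \<partial>M)"
    interpret prob_space M using M by (simp add: space_prob_algebra)
    have gc: "continuous_on states (\<lambda>x. g x - c)" by (intro continuous_intros g)
    have "(\<integral>x. g x - c \<partial>M) = 0"
      using cont_states_integrable[OF M g] prob_space by (simp add: c_def)
    then have "(\<Sum>i\<in>{0, 1}. integral {- pi..pi} (\<lambda>x. (g (cis x, i) - c) * weight \<beta> i x)) = 0"
      using Z unfolding M_int[OF gc]
      by (simp add: times_divide_eq_right integral_divide add_divide_distrib[symmetric])
    then show "\<exists>f. C1_fun f \<and> (\<forall>x\<in>states. ang_generator A \<beta> f x = g x - (\<integral>x. g x \<partial>M))"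
      unfolding c_def[symmetric] by (rule poisson_solvable[OF \<beta> gc])
  qed
  let ?y = "\<lambda>x. a * m * sin (2 * x) - 1"
  have y_cis: "?y x = ?y x'" if "cis x = cis x'" for x x'
    using that by (simp add: sin_double complex_eq_iff)
  have cont: "continuous_on states (\<lambda>(z, i). rad_growth A (Arg z) i)"
  proof (rule continuous_on_states[where F="\<lambda>i. ?y"])
    show "continuous_on UNIV ?y" by (intro continuous_intros)
    show "?y x = ?y x'" if "cis x = cis x'" for x x'
      using that by (rule y_cis)
  qed (simp add: rad_growth_A)
  have "growth_exponent A \<beta> = (\<Sum>i\<in>{0, 1}. integral {- pi..pi} (\<lambda>x. ?y x * (weight \<beta> i x / Z)))"
    unfolding growth_exponent_def \<open>invariant_measure A \<beta> = M\<close> M_int[OF cont]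
    by (intro sum.cong refl integral_cong) (simp only: split_conv rad_growth_A y_cis[OF cis_Arg_cis])
  also have "\<dots> = integral {- pi..pi} (\<lambda>x. ?y x * (weight \<beta> 0 x / Z) + ?y x * (weight \<beta> 1 x / Z))"
    using Z by (subst integral_add)
      (auto intro!: integrable_continuous_UNIV continuous_intros weight_cont[of _ "Suc 0"] weight_cont)
  also have "\<dots> = integral {- pi..pi} (\<lambda>x. (b + 1 / b) / (a * Z) * (?y x * exp (V \<beta> x) / (1 + (m * sin (2 * x))\<^sup>2)))"
  proof (rule integral_cong)
    fix x
    have s: "speed 0 x > 0" "speed 1 x > 0" using speed_pos by auto
    have "u * (e / (a * p) / Z) + u * (e / (a * q) / Z) = (p + q) / (a * Z) * (u * e / (p * q))"
      if "p > 0" "q > 0" for u e p q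
      using that a Z by (simp add: field_simps)
    from this[OF s] show "?y x * (weight \<beta> 0 x / Z) + ?y x * (weight \<beta> 1 x / Z)
        = (b + 1 / b) / (a * Z) * (?y x * exp (V \<beta> x) / (1 + (m * sin (2 * x))\<^sup>2))"
      unfolding weight_def speed_mult speed_add .
  qed
  also have "\<dots> = (b + 1 / b) / (a * Z) * integral {- pi..pi} (\<lambda>x. ?y x * exp (V \<beta> x) / (1 + (m * sin (2 * x))\<^sup>2))"
    by (rule integral_mult_right)
  finally show ?thesis
    using a b Z by (intro that[of "(b + 1 / b) / (a * Z)"]) (auto intro!: divide_pos_pos add_pos_pos)
qed

lemma growth_exponent_sign_change:
  assumes am: "a * m > 1"
  shows "\<exists>\<beta>\<^sub>c>0. (\<forall>\<beta>. 0 < \<beta> \<and> \<beta> < \<beta>\<^sub>c \<longrightarrow> growth_exponent A \<beta> < 0) \<and>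
    (\<forall>\<beta>>\<beta>\<^sub>c. growth_exponent A \<beta> > 0)"
proof -
  \<comment> \<open>With this shift the exponent \<open>?v\<close> changes sign exactly where
    \<open>?y\<close> does, namely where \<open>m * sin (2 * x) = 1 / a\<close>.\<close>
  define u where "u = arctan (1 / a)"
  let ?y = "\<lambda>x. a * m * sin (2 * x) - 1"
  let ?v = "\<lambda>x. arctan (m * sin (2 * x)) - u"
  let ?w = "\<lambda>x. 1 / (1 + (m * sin (2 * x))\<^sup>2)"
  have den: "1 + (m * sin (2 * x))\<^sup>2 > 0" for x
    by (simp add: add_pos_nonneg)
  have sgn: "?v x > 0 \<longleftrightarrow> ?y x > 0" "?v x < 0 \<longleftrightarrow> ?y x < 0" for x
    using a by (auto simp: u_def arctan_less_iff field_simps)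
  have "\<exists>c>0. (\<forall>t. 0 < t \<and> t < c \<longrightarrow> integral {- pi..pi} (\<lambda>x. ?y x * exp (t * ?v x) * ?w x) < 0) \<and>
    (\<forall>t>c. integral {- pi..pi} (\<lambda>x. ?y x * exp (t * ?v x) * ?w x) > 0)"
  proof (rule exp_tilt_sign_change)
    show "continuous_on UNIV ?y" "continuous_on UNIV ?v" by (intro continuous_intros)+
    show contw: "continuous_on UNIV ?w"
      using den by (intro continuous_intros) (metis less_irrefl)
    show "?w x > 0" for x using den[of x] by simp
    show "?y x * ?v x \<ge> 0" for x
      using sgn[of x] by (simp only: zero_le_mult_iff) linarith
    \<comment> \<open>Here \<open>sin (2 * x) = 1\<close>, so \<open>?y\<close> takes the value
      \<open>a * m - 1\<close>.\<close>
    show "pi / 4 \<in> {- pi..pi}" by simp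
    show y0: "?y (pi / 4) > 0" using am by simp
    show "?v (pi / 4) > 0" using y0 sgn(1)[of "pi / 4"] by blast
    show "integral {- pi..pi} (\<lambda>x. ?y x * ?w x) < 0"
    proof -
      \<comment> \<open>Without tilt the sine term is odd and integrates to zero over the symmetric
        interval; only minus the integral of the positive weight remains.\<close>
      let ?o = "\<lambda>x. a * m * sin (2 * x) * ?w x"
      have io: "?o integrable_on {- pi..pi}" and iw: "?w integrable_on {- pi..pi}"
        by (intro integrable_continuous_UNIV contw continuous_on_mult[OF _ contw] continuous_intros)+
      have "integral {- pi..pi} (\<lambda>x. ?o (- x)) = integral {- pi..pi} ?o"
        using Henstock_Kurzweil_Integration.integral_reflect_real[of pi "- pi" ?o] by simp
      moreover have "(\<lambda>x. ?o (- x)) = (\<lambda>x. - ?o x)" by auto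
      ultimately have "integral {- pi..pi} ?o = 0" using io by simp
      moreover have "integral {- pi..pi} ?w > 0"
        using den contw by (intro integral_pos_continuous[where x=0] continuous_on_subset[OF contw])
          (auto simp: less_imp_le)
      moreover have "integral {- pi..pi} (\<lambda>x. ?y x * ?w x) = integral {- pi..pi} ?o - integral {- pi..pi} ?w"
        by (subst integral_diff[OF io iw, symmetric]) (simp add: diff_divide_distrib)
      ultimately show ?thesis by simp
    qed
  qed simp
  then obtain c where c: "c > 0"
    "\<And>t. 0 < t \<Longrightarrow> t < c \<Longrightarrow> integral {- pi..pi} (\<lambda>x. ?y x * exp (t * ?v x) * ?w x) < 0"
    "\<And>t. t > c \<Longrightarrow> integral {- pi..pi} (\<lambda>x. ?y x * exp (t * ?v x) * ?w x) > 0"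
    by blast
  have gr: "\<exists>C>0. growth_exponent A \<beta> = C * integral {- pi..pi} (\<lambda>x. ?y x * exp (\<beta> / (2 * a) * ?v x) * ?w x)"
    if \<beta>: "\<beta> > 0" for \<beta>
  proof -
    obtain C where C: "C > 0" "growth_exponent A \<beta> = C * integral {- pi..pi}
        (\<lambda>x. ?y x * exp (V \<beta> x) / (1 + (m * sin (2 * x))\<^sup>2))"
      using growth_exponent_formula[OF \<beta>] .
    \<comment> \<open>Compensates the shift by \<open>u\<close>. It is constant in \<open>x\<close>
      and positive, so the tilted integral has the same sign as the exponent.\<close>
    let ?k = "exp (\<beta> / (2 * a) * u)"
    have "?y x * exp (V \<beta> x) / (1 + (m * sin (2 * x))\<^sup>2) = ?k * (?y x * exp (\<beta> / (2 * a) * ?v x) * ?w x)" for x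
    proof -
      have "exp (V \<beta> x) = ?k * exp (\<beta> / (2 * a) * ?v x)"
        by (simp add: V_def exp_add[symmetric] right_diff_distrib)
      then show ?thesis by simp
    qed
    then have "growth_exponent A \<beta> = C * ?k * integral {- pi..pi} (\<lambda>x. ?y x * exp (\<beta> / (2 * a) * ?v x) * ?w x)"
      unfolding C(2) by (simp only: integral_mult_right mult.assoc)
    moreover have "C * ?k > 0" using C by simp
    ultimately show ?thesis by blast
  qed
  show ?thesis
  \<comment> \<open>The tilt parameter is \<open>t = \<beta> / (2 * a)\<close>, the factor in front
    of the \<open>arctan\<close> in \<open>V\<close>.\<close>
  proof (intro exI[of _ "2 * a * c"] conjI allI impI)
    show "2 * a * c > 0" using a c by simp
    fix \<beta>
    show "growth_exponent A \<beta> < 0" if "0 < \<beta> \<and> \<beta> < 2 * a * c"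
    proof -
      have "0 < \<beta> / (2 * a)" "\<beta> / (2 * a) < c" using that a by (auto simp: field_simps)
      note neg = c(2)[OF this]
      from that obtain C where "C > 0" "growth_exponent A \<beta>
          = C * integral {- pi..pi} (\<lambda>x. ?y x * exp (\<beta> / (2 * a) * ?v x) * ?w x)"
        using gr by blast
      with neg show ?thesis by (simp only: mult_pos_neg)
    qed
    show "growth_exponent A \<beta> > 0" if "\<beta> > 2 * a * c"
    proof -
      have "c < \<beta> / (2 * a)" using that a by (simp add: pos_less_divide_eq mult_ac)
      note pos = c(3)[OF this]
      have "0 < 2 * a * c" using a c(1) by simp
      then have "\<beta> > 0" using that by linarith
      then obtain C where "C > 0" "growth_exponent A \<beta>
          = C * integral {- pi..pi} (\<lambda>x. ?y x * exp (\<beta> / (2 * a) * ?v x) * ?w x)"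
        using gr by blast
      with pos show ?thesis by (simp only: mult_pos_pos)
    qed
  qed
qed

end

theorem corollary3p4:
  fixes a b :: real and A :: "nat \<Rightarrow> real^2^2"
  assumes "a > 0" and "b > 0"
    and "A 0 = vector [vector [-1, a * b], vector [- a / b, -1]]"
    and "A 1 = vector [vector [-1, - a / b], vector [a * b, -1]]"
  shows "(a * (b - 1 / b) > 2 \<longleftrightarrow> b > (1 + sqrt (1 + a\<^sup>2)) / a) \<and>
    (a * (b - 1 / b) > 2 \<longrightarrow>
      (\<exists>\<beta>\<^sub>c>0. (\<forall>\<beta>. 0 < \<beta> \<and> \<beta> < \<beta>\<^sub>c \<longrightarrow> growth_exponent A \<beta> < 0) \<and>
               (\<forall>\<beta>>\<beta>\<^sub>c. growth_exponent A \<beta> > 0)))"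
proof -
  interpret switched_rotations a b A by unfold_locales (fact assms)+
  show ?thesis
    using sqrt_threshold_iff[OF assms(1,2)] growth_exponent_sign_change
    by (simp add: m_def)
qed

end
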